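(* Let $G=\mathrm{GL}_3$ and let $$\gamma=\begin{bmatrix}a&0&0\\0&0&b\\0&b\epsilon&0\end{bmatrix},\qquad a,b\in\mathcal O,\ b\neq0,$$ with $m=\mathrm{val}(a)$, $n=\mathrm{val}(b)$. Let $M_0=\mathrm{GL}_1\times\mathrm{GL}_2$ be the block diagonal Levi subgroup and put $c=\mathrm{vol}\big(\mathfrak a^{\mathrm{SL}_3}_{M_0\cap\mathrm{SL}_3}/X_*(M_0\cap\mathrm{SL}_3)\big)$. If $m\le n$, then $$J_{M_0}(\gamma)=c\Big[2m\,q^{2m+n}+\sum_{j=m+n+1}^{2m+n-1}2(j-m-n)\,q^j-\sum_{j=0}^{2m-1}\Big(\Big\lfloor\frac j2\Big\rfloor+1\Big)q^j\Big].$$ If $m>n$, then $$J_{M_0}(\gamma)=c\Big[(2n+1)\,q^{3n+1}+\sum_{j=2n+1}^{3n}(2j-4n-1)\,q^j-\sum_{j=0}^{2n}\Big(\Big\lfloor\frac j2\Big\rfloor+1\Big)q^j\Big].$$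
   Context: $F=\mathbf F_q((\epsilon))$, $\mathcal O=\mathbf F_q[[\epsilon]]$, $\mathrm{val}(\epsilon)=1$; the characteristic of $\mathbf F_q$ is $>|W|$, where $W$ is the Weyl group of $G$. $\lfloor x\rfloor$ is the largest integer $\le x$. Sums whose lower index exceeds the upper index are zero. $\mathfrak g$ is the Lie algebra of $G$. $T$ is the centralizer of $\gamma$ in $G_F$, a maximal torus isomorphic to $F^\times\times\mathrm{Res}_{E_2/F}E_2^\times$ with $E_2=\mathbf F_q((\epsilon^{1/2}))$; it is elliptic in $M_0$. For a Levi subgroup $M$, $X_*(M)=\mathrm{Hom}(X^*(M),\mathbf Z)$, $\mathfrak a_M=X_*(M)\otimes\mathbf R$, and $\mathfrak a_M^G\subset\mathfrak a_M$ is the subspace annihilated by $X^*(G)$. The same notation is used for $\mathrm{SL}_3$ and $M_0\cap\mathrm{SL}_3$, and $\mathfrak a^{\mathrm{SL}_3}_{M_0\cap\mathrm{SL}_3}=\mathfrak a_{M_0}^G$ canonically. Let $A$ be the diagonal torus; fix a $W$-invariant inner product on $\mathfrak a_A^G\supset \mathfrak a_{M_0}^G$ and give $\mathfrak a_{M_0}^G$ the Lebesgue measure for which the lattice generated by an orthonormal basis has covolume $1$. For a parabolic subgroup $P=M_0N$ with Levi factor $M_0$, define $H_P:G(F)\to\mathfrak a_{M_0}$ by $\chi(H_P(nmk))=\mathrm{val}(\chi(m))$ for all $\chi\in X^*(M_0)$, $n\in N(F)$, $m\in M_0(F)$, $k\in G(\mathcal O)$. The weight $\mathrm v_{M_0}(g)$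 is the volume of the projection to $\mathfrak a_{M_0}^G$ of the convex hull of the (two) points $H_P(g)$. Arthur's weighted orbital integral is $$J_{M_0}(\gamma)=\int_{T(F)\backslash G(F)}\mathbf 1_{\mathfrak g(\mathcal O)}\big(\mathrm{Ad}(g)^{-1}\gamma\big)\,\mathrm v_{M_0}(g)\,\frac{dg}{dt},$$ with Haar measures normalized by $\mathrm{vol}(G(\mathcal O))=1$ and by giving the maximal compact subgroup $\mathcal O^\times\times\mathcal O_{E_2}^\times$ of $T(F)$ volume $1$. *)

theory Defs
  imports
    "HOL-Analysis.Analysis"
    "HOL-Computational_Algebra.Computational_Algebra"
    "HOL-Library.Function_Algebras"
begin

text \<open>
  \<^typ>\<open>'q fls\<close> is \<open>F = F_q((\<epsilon>))\<close> with \<open>\<epsilon> = fls_X\<close>, \<^typ>\<open>'q fps\<close> is \<open>O\<close>, embedded in \<open>F\<close> by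
  \<^const>\<open>fps_to_fls\<close>.  Algebraic subgroups of \<open>GL_3\<close> are represented by their sets of rational
  points.  The groups \<open>A\<close>, \<open>M_0\<close>, \<open>G\<close>, \<open>SL_3\<close>, \<open>M_0 \<inter> SL_3\<close> to which characters are applied are
  split, connected and rational, so over an infinite field nothing is lost by this.
\<close>

section \<open>Subgroups of \<open>GL_3\<close>\<close>

definition GL3 :: "('k::field^3^3) set" where
  "GL3 = {g. invertible g}"

definition SL3 :: "('k::field^3^3) set" where
  "SL3 = {g. det g = 1}"

definition diag_torus :: "('k::field^3^3) set" where
  "diag_torus = {g \<in> GL3. \<forall>i j. i \<noteq> j \<longrightarrow> g $ i $ j = 0}"

definition M0 :: "('k::field^3^3) set" where
  "M0 = {g \<in> GL3. g $ 1 $ 2 = 0 \<and> g $ 1 $ 3 = 0 \<and> g $ 2 $ 1 = 0 \<and> g $ 3 $ 1 = 0}"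

text \<open>The unipotent radicals of the two parabolic subgroups with Levi factor \<^term>\<open>M0\<close>.\<close>

definition N_upper :: "('k::field^3^3) set" where
  "N_upper = {vector [vector [1, x, y], vector [0, 1, 0], vector [0, 0, 1]] | x y. True}"

definition N_lower :: "('k::field^3^3) set" where
  "N_lower = {vector [vector [1, 0, 0], vector [x, 1, 0], vector [y, 0, 1]] | x y. True}"

definition center_of :: "('k::field^3^3) set \<Rightarrow> ('k^3^3) set" where
  "center_of H = {z \<in> H. \<forall>h\<in>H. z ** h = h ** z}"

definition centralizer :: "'k::field^3^3 \<Rightarrow> ('k^3^3) set" where
  "centralizer x = {g \<in> GL3. g ** x = x ** g}"

definition normalizer :: "('k::field^3^3) set \<Rightarrow> ('k^3^3) set" where
  "normalizer H = {w \<in> GL3. (\<lambda>h. w ** h ** matrix_inv w) ` H = H}"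

section \<open>Characters and the spaces \<open>a_M\<close>\<close>

text \<open>Pointwise real vector space structure on functions; the additive part comes from
  \<^theory>\<open>HOL-Library.Function_Algebras\<close>.\<close>

instantiation "fun" :: (type, real_vector) real_vector
begin

definition scaleR_fun :: "real \<Rightarrow> ('a \<Rightarrow> 'b) \<Rightarrow> 'a \<Rightarrow> 'b" where
  "scaleR_fun c f = (\<lambda>x. c *\<^sub>R f x)"

instance
  by standard (auto simp: scaleR_fun_def fun_eq_iff scaleR_add_left scaleR_add_right)

end

text \<open>The coordinate ring of \<open>GL_3\<close>, as functions on rational points.\<close>

inductive_set regular_functions :: "('k::field^3^3 \<Rightarrow> 'k) set" where
  const: "(\<lambda>_. c) \<in> regular_functions"
| entry: "(\<lambda>g. g $ i $ j) \<in> regular_functions"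
| inv_det: "(\<lambda>g. inverse (det g)) \<in> regular_functions"
| add: "\<lbrakk>f \<in> regular_functions; h \<in> regular_functions\<rbrakk> \<Longrightarrow> (\<lambda>g. f g + h g) \<in> regular_functions"
| mult: "\<lbrakk>f \<in> regular_functions; h \<in> regular_functions\<rbrakk> \<Longrightarrow> (\<lambda>g. f g * h g) \<in> regular_functions"

text \<open>\<open>X\<^sup>*(H)\<close>, written multiplicatively.  Characters are given the value \<open>1\<close> off \<open>H\<close>, so that they
  are determined by their values on \<open>H\<close> and closed under the pointwise product.\<close>

definition chars :: "('k::field^3^3) set \<Rightarrow> ('k^3^3 \<Rightarrow> 'k) set" where
  "chars H = {\<phi>. (\<exists>f\<in>regular_functions. \<forall>g\<in>H. \<phi> g = f g) \<and>
                  (\<forall>g\<in>H. \<phi> g \<noteq> 0) \<and>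
                  (\<forall>g\<in>H. \<forall>h\<in>H. \<phi> (g ** h) = \<phi> g * \<phi> h) \<and>
                  (\<forall>g. g \<notin> H \<longrightarrow> \<phi> g = 1)}"

definition restrict_char :: "('k::field^3^3) set \<Rightarrow> ('k^3^3 \<Rightarrow> 'k) \<Rightarrow> 'k^3^3 \<Rightarrow> 'k" where
  "restrict_char L \<phi> = (\<lambda>g. if g \<in> L then \<phi> g else 1)"

text \<open>\<open>X\<^sub>*(H) = Hom(X\<^sup>*(H), Z)\<close>, as real-valued functions supported on \<open>X\<^sup>*(H)\<close>.\<close>

definition cochars :: "('k::field^3^3) set \<Rightarrow> (('k^3^3 \<Rightarrow> 'k) \<Rightarrow> real) set" where
  "cochars H = {l. (\<forall>\<phi>\<in>chars H. l \<phi> \<in> \<int>) \<and>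
                   (\<forall>\<phi>\<in>chars H. \<forall>\<psi>\<in>chars H. l (\<lambda>g. \<phi> g * \<psi> g) = l \<phi> + l \<psi>) \<and>
                   (\<forall>\<phi>. \<phi> \<notin> chars H \<longrightarrow> l \<phi> = 0)}"

text \<open>As \<open>X\<^sup>*(H)\<close> is free of finite rank, \<open>X\<^sub>*(H) \<otimes> R\<close> is the real span of \<open>X\<^sub>*(H)\<close> in the space of
  functions on characters; \<open>\<phi>(v)\<close> is written \<open>v \<phi>\<close>.\<close>

definition aspace :: "('k::field^3^3) set \<Rightarrow> (('k^3^3 \<Rightarrow> 'k) \<Rightarrow> real) set" where
  "aspace H = span (cochars H)"

definition aspace_G :: "('k::field^3^3) set \<Rightarrow> (('k^3^3 \<Rightarrow> 'k) \<Rightarrow> real) set" where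
  "aspace_G M = {v \<in> aspace M. \<forall>\<phi>\<in>chars GL3. v (restrict_char M \<phi>) = 0}"

text \<open>The inclusion \<open>a_M \<subset> a_L\<close> for Levi subgroups \<open>L \<subset> M\<close>.  It comes from
  \<open>X\<^sub>*(Z(M)) \<otimes> R = a_M\<close> and \<open>X\<^sub>*(Z(M)) \<subset> X\<^sub>*(L)\<close>: the image of \<open>v\<close> restricts to \<open>v\<close> on \<open>X\<^sup>*(M)\<close> and
  kills every character of \<open>L\<close> that is trivial on the centre of \<open>M\<close>.\<close>

definition levi_embed ::
  "('k::field^3^3) set \<Rightarrow> ('k^3^3) set \<Rightarrow> (('k^3^3 \<Rightarrow> 'k) \<Rightarrow> real) \<Rightarrow> ('k^3^3 \<Rightarrow> 'k) \<Rightarrow> real" where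
  "levi_embed M L v = (THE u. u \<in> aspace L \<and>
      (\<forall>\<phi>\<in>chars M. u (restrict_char L \<phi>) = v \<phi>) \<and>
      (\<forall>\<psi>\<in>chars L. (\<forall>z\<in>center_of M. \<psi> z = 1) \<longrightarrow> u \<psi> = 0))"

text \<open>The projection \<open>a_M \<rightarrow> a_M^G\<close> along \<open>a_G \<subset> a_M\<close>.\<close>

definition proj_G ::
  "('k::field^3^3) set \<Rightarrow> (('k^3^3 \<Rightarrow> 'k) \<Rightarrow> real) \<Rightarrow> ('k^3^3 \<Rightarrow> 'k) \<Rightarrow> real" where
  "proj_G M v = (THE u. u \<in> aspace_G M \<and> v - u \<in> levi_embed GL3 M ` aspace GL3)"

section \<open>Inner product and volume on \<open>a_{M_0}^G\<close>\<close>

text \<open>The action of \<open>w \<in> N_G(A)\<close> on \<open>a_A\<close>; it factors through the Weyl group.\<close>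

definition weyl_act ::
  "'k::field^3^3 \<Rightarrow> (('k^3^3 \<Rightarrow> 'k) \<Rightarrow> real) \<Rightarrow> ('k^3^3 \<Rightarrow> 'k) \<Rightarrow> real" where
  "weyl_act w v = (\<lambda>\<phi>. v (\<lambda>t. \<phi> (w ** t ** matrix_inv w)))"

definition inner_product_on :: "'v::real_vector set \<Rightarrow> ('v \<Rightarrow> 'v \<Rightarrow> real) \<Rightarrow> bool" where
  "inner_product_on V B \<longleftrightarrow>
     (\<forall>u\<in>V. \<forall>v\<in>V. B u v = B v u) \<and>
     (\<forall>u\<in>V. \<forall>v\<in>V. \<forall>w\<in>V. \<forall>r s. B (r *\<^sub>R u + s *\<^sub>R v) w = r * B u w + s * B v w) \<and>
     (\<forall>u\<in>V. u \<noteq> 0 \<longrightarrow> B u u > 0)"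

definition weyl_inner_product ::
  "((('k::field^3^3 \<Rightarrow> 'k) \<Rightarrow> real) \<Rightarrow> (('k^3^3 \<Rightarrow> 'k) \<Rightarrow> real) \<Rightarrow> real) \<Rightarrow> bool" where
  "weyl_inner_product B \<longleftrightarrow>
     inner_product_on (aspace_G diag_torus) B \<and>
     (\<forall>w\<in>normalizer diag_torus. \<forall>u\<in>aspace_G diag_torus. \<forall>v\<in>aspace_G diag_torus.
        B (weyl_act w u) (weyl_act w v) = B u v)"

text \<open>Lebesgue measure on the line \<open>a_{M_0}^G\<close>, on which an orthonormal basis consists of a single
  unit vector; the norm is that of \<open>a_A^G \<supset> a_{M_0}^G\<close>.\<close>

definition vol_M0 ::
  "((('k::field^3^3 \<Rightarrow> 'k) \<Rightarrow> real) \<Rightarrow> (('k^3^3 \<Rightarrow> 'k) \<Rightarrow> real) \<Rightarrow> real)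
    \<Rightarrow> (('k^3^3 \<Rightarrow> 'k) \<Rightarrow> real) measure" where
  "vol_M0 B =
     (let e = (SOME u. u \<in> aspace_G M0 \<and>
                 B (levi_embed M0 diag_torus u) (levi_embed M0 diag_torus u) = 1)
      in embed_measure lborel (\<lambda>t. t *\<^sub>R e))"

text \<open>The volume of \<open>V / \<Lambda>\<close>, \<open>V\<close> being the space of \<open>\<mu>\<close>: the common volume of all measurable
  fundamental domains.\<close>

definition covolume :: "'v::real_vector measure \<Rightarrow> 'v set \<Rightarrow> real" where
  "covolume \<mu> \<Lambda> = (THE c. \<forall>D\<in>sets \<mu>.
      (\<forall>v\<in>space \<mu>. \<exists>!l. l \<in> \<Lambda> \<and> v - l \<in> D) \<longrightarrow> measure \<mu> D = c)"

text \<open>The canonical map from \<open>a_{M_0 \<inter> SL_3}\<close> to \<open>a_{M_0}\<close>, dual to restriction of characters; its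
  image is \<open>a_{M_0}^G\<close>.\<close>

definition from_SL3 ::
  "(('k::field^3^3 \<Rightarrow> 'k) \<Rightarrow> real) \<Rightarrow> ('k^3^3 \<Rightarrow> 'k) \<Rightarrow> real" where
  "from_SL3 l = (\<lambda>\<phi>. if \<phi> \<in> chars M0 then l (restrict_char (M0 \<inter> SL3) \<phi>) else 0)"

definition covol_M0 ::
  "((('k::field^3^3 \<Rightarrow> 'k) \<Rightarrow> real) \<Rightarrow> (('k^3^3 \<Rightarrow> 'k) \<Rightarrow> real) \<Rightarrow> real) \<Rightarrow> real" where
  "covol_M0 B = covolume (vol_M0 B) (from_SL3 ` cochars (M0 \<inter> SL3))"

section \<open>Integral structure and weights\<close>

definition gl3_O :: "('q::field fls^3^3) set" where
  "gl3_O = {x. \<forall>i j. x $ i $ j \<in> range fps_to_fls}"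

definition GL3_O :: "('q::field fls^3^3) set" where
  "GL3_O = {g \<in> GL3. g \<in> gl3_O \<and> matrix_inv g \<in> gl3_O}"

definition H_P ::
  "('q::field fls^3^3) set \<Rightarrow> 'q fls^3^3 \<Rightarrow> ('q fls^3^3 \<Rightarrow> 'q fls) \<Rightarrow> real" where
  "H_P N g = (THE v. v \<in> aspace M0 \<and>
      (\<forall>n\<in>N. \<forall>m\<in>M0. \<forall>k\<in>GL3_O. g = n ** m ** k \<longrightarrow>
         (\<forall>\<phi>\<in>chars M0. v \<phi> = real_of_int (fls_subdegree (\<phi> m)))))"

definition weight_M0 ::
  "((('q::field fls^3^3 \<Rightarrow> 'q fls) \<Rightarrow> real) \<Rightarrow> (('q fls^3^3 \<Rightarrow> 'q fls) \<Rightarrow> real) \<Rightarrow> real)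
    \<Rightarrow> 'q fls^3^3 \<Rightarrow> real" where
  "weight_M0 B g =
     measure (vol_M0 B) (proj_G M0 ` (convex hull {H_P N_upper g, H_P N_lower g}))"

section \<open>Haar measures and the weighted orbital integral\<close>

text \<open>Haar measures on the closed subgroup \<open>H\<close> of \<open>GL_3(F)\<close>, whose topology is induced from
  \<^typ>\<open>'q fls^3^3\<close>.  Regularity is automatic, because \<open>H\<close> is locally compact and second countable.\<close>

definition haar_measure :: "('q::finite_field fls^3^3) set \<Rightarrow> ('q fls^3^3) measure \<Rightarrow> bool" where
  "haar_measure H \<mu> \<longleftrightarrow>
     sets \<mu> = sets (restrict_space borel H) \<and>
     emeasure \<mu> H \<noteq> 0 \<and>
     (\<forall>C. compact C \<and> C \<subseteq> H \<longrightarrow> emeasure \<mu> C < \<infinity>) \<and>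
     (\<forall>h\<in>H. \<forall>S\<in>sets \<mu>. emeasure \<mu> ((**) h ` S) = emeasure \<mu> S)"

definition right_cosets :: "('q::finite_field fls^3^3) set \<Rightarrow> ('q fls^3^3) set set" where
  "right_cosets T = {(\<lambda>t. t ** g) ` T | g. g \<in> GL3}"

text \<open>The quotient measure \<open>dg/dt\<close> on the space of cosets \<open>T g\<close>.  The
  preimage in \<open>GL_3(F)\<close> of a set \<open>S\<close> of cosets is \<^term>\<open>\<Union>S\<close>, and \<open>SOME g. g \<in> C\<close> is a
  representative of the coset \<open>C\<close>, on which the inner integral does not depend.\<close>

definition quotient_measure ::
  "('q::finite_field fls^3^3) set \<Rightarrow> ('q fls^3^3) measure \<Rightarrow> ('q fls^3^3) measure
    \<Rightarrow> ('q fls^3^3) set measure \<Rightarrow> bool" where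
  "quotient_measure T \<mu> \<tau> \<nu> \<longleftrightarrow>
     space \<nu> = right_cosets T \<and>
     sets \<nu> = {S. S \<subseteq> right_cosets T \<and> \<Union>S \<in> sets \<mu>} \<and>
     (\<forall>f \<in> borel_measurable \<mu>.
        (\<integral>\<^sup>+ g. f g \<partial>\<mu>) = (\<integral>\<^sup>+ C. (\<integral>\<^sup>+ t. f (t ** (SOME g. g \<in> C)) \<partial>\<tau>) \<partial>\<nu>))"

text \<open>The integrand, as a function on cosets; the expression is invariant under \<open>T(F)\<close>.\<close>

definition orbital_integrand ::
  "((('q::finite_field fls^3^3 \<Rightarrow> 'q fls) \<Rightarrow> real) \<Rightarrow> (('q fls^3^3 \<Rightarrow> 'q fls) \<Rightarrow> real) \<Rightarrow> real)
    \<Rightarrow> 'q fls^3^3 \<Rightarrow> ('q fls^3^3) set \<Rightarrow> real" where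
  "orbital_integrand B \<gamma> C =
     (let g = (SOME g. g \<in> C)
      in indicator gl3_O (matrix_inv g ** \<gamma> ** g) * weight_M0 B g)"

definition J_M0 ::
  "((('q::finite_field fls^3^3 \<Rightarrow> 'q fls) \<Rightarrow> real) \<Rightarrow> (('q fls^3^3 \<Rightarrow> 'q fls) \<Rightarrow> real) \<Rightarrow> real)
    \<Rightarrow> ('q fls^3^3) set measure \<Rightarrow> 'q fls^3^3 \<Rightarrow> real" where
  "J_M0 B \<nu> \<gamma> = (LINT C|\<nu>. orbital_integrand B \<gamma> C)"

section \<open>The element \<open>\<gamma>\<close>\<close>

definition gamma_elt :: "'q::finite_field fps \<Rightarrow> 'q fps \<Rightarrow> 'q fls^3^3" where
  "gamma_elt a b = vector
     [vector [fps_to_fls a, 0, 0],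
      vector [0, 0, fps_to_fls b],
      vector [0, fps_to_fls b * fls_X, 0]]"

text \<open>The maximal compact subgroup \<open>O\<^sup>\<times> \<times> O_{E_2}\<^sup>\<times>\<close> of the centralizer of \<open>\<gamma>\<close>: the element
  \<open>y + z \<epsilon>^{1/2}\<close> of \<open>E_2\<close> corresponds to the lower right block, and it is a unit of \<open>O_{E_2}\<close> iff
  \<open>y\<close> is a unit of \<open>O\<close> and \<open>z \<in> O\<close>.\<close>

definition T_compact :: "('q::finite_field fls^3^3) set" where
  "T_compact = {vector
     [vector [fps_to_fls x, 0, 0],
      vector [0, fps_to_fls y, fps_to_fls z],
      vector [0, fps_to_fls z * fls_X, fps_to_fls y]] | x y z. x dvd 1 \<and> y dvd 1}"

definition val :: "'q::finite_field fps \<Rightarrow> enat" where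
  "val x = (if x = 0 then \<infinity> else enat (subdegree x))"

end

theory Submission
  imports Defs
begin

text \<open>
  A lattice \<open>L\<close> in \<open>F \<oplus> E_2\<close> is given by its projection to \<open>F\<close>, its intersection \<open>L_2\<close> with \<open>E_2\<close>, and an
  extension class \<open>u \<in> E_2 / L_2\<close>.  The two points \<open>H_P(g)\<close> record the valuations of the intersection
  and of the projection of \<open>g O\<^sup>3\<close> to \<open>F\<close>, so the weight is \<open>c\<close> times the least \<open>d\<close> with \<open>\<epsilon>\<^sup>d u \<in> L_2\<close>.

  The valuations of the projection to \<open>F\<close> and of the determinant identify \<open>T(F)\<close> modulo its maximal
  compact subgroup with \<open>Z\<^sup>2\<close>.  Hence the integral over \<open>T(F)\<close>-cosets equals the sum of the weights of
  the \<open>\<gamma>\<close>-stable lattices for which both valuations vanish.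

  Dividing \<open>L_2\<close> by an element of smallest valuation shows \<open>L_2 = x O_j\<close> with
  \<open>O_j = O + \<epsilon>\<^sup>j \<epsilon>^(1/2) O\<close>; it is stable iff \<open>j \<le> n\<close>, and each \<open>j\<close> gives \<open>q\<^sup>j\<close> lattices of the right volume.  The
  admissible classes \<open>u\<close> are the kernel of \<open>\<gamma> - a\<close> on \<open>E_2 / L_2\<close>, a sum of two cyclic modules of
  lengths \<open>e_1 = min m (n - j)\<close> and \<open>e_2\<close> with \<open>e_1 + e_2 = min (2 m) (2 n + 1)\<close>; a unipotent
  substitution over \<open>O\<close> diagonalizes it without changing \<open>d\<close>.  It remains to sum
  \<open>q^j (e_2 q^(e_1 + e_2) - (\<Sum>s<e_2. q^(min s e_1 + s)))\<close> over \<open>j \<le> n\<close>.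
\<close>

text \<open>The definitions select points of function spaces by \<open>THE\<close> and
  \<open>SOME\<close>, so they become computable only once all characters of
  \<open>diag_torus\<close>, \<open>M0\<close> and \<open>GL3\<close> are known; the spaces a_M then
  have explicit coordinates. The weight and c are both inversely proportional to the length of the
  unspecified unit vector, so the weight is c times an integer.

  The two conditions on u have coefficients a, a, eps^(-j) b and eps^(j+1) b up to sign. Their least
  valuation is e_1. The determinant a^2 - eps b^2 is the norm of a - b eps^(1/2) and has valuation
  e_1 + e_2. Its two terms have valuations of opposite parity, so nothing cancels: this is the
  origin of 2 m and 2 n + 1, and of the two cases of the theorem.

  The q^j lattices for a given j correspond to the units of O_(E_2) modulo those of O_j. In the
  final sum q^(min s e_1 + s) is the number of classes u killed by eps^s, for s < e_2, and d is the
  number of s for which eps^s does not kill u.\<close>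

unbundle no Formal_Power_Series.fps_syntax

section \<open>Three by three matrices\<close>

definition mat3 :: "'k::zero \<Rightarrow> 'k \<Rightarrow> 'k \<Rightarrow> 'k \<Rightarrow> 'k \<Rightarrow> 'k \<Rightarrow> 'k \<Rightarrow> 'k \<Rightarrow> 'k \<Rightarrow> 'k^3^3" where
  "mat3 a b c d e f g h i = vector [vector [a, b, c], vector [d, e, f], vector [g, h, i]]"

abbreviation diag3 :: "'k::zero \<Rightarrow> 'k \<Rightarrow> 'k \<Rightarrow> 'k^3^3" where
  "diag3 x y z \<equiv> mat3 x 0 0 0 y 0 0 0 z"

lemma mat3_nth [simp]:
  "mat3 a b c d e f g h i $ 1 $ 1 = a" "mat3 a b c d e f g h i $ 1 $ 2 = b"
  "mat3 a b c d e f g h i $ 1 $ 3 = c" "mat3 a b c d e f g h i $ 2 $ 1 = d"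
  "mat3 a b c d e f g h i $ 2 $ 2 = e" "mat3 a b c d e f g h i $ 2 $ 3 = f"
  "mat3 a b c d e f g h i $ 3 $ 1 = g" "mat3 a b c d e f g h i $ 3 $ 2 = h"
  "mat3 a b c d e f g h i $ 3 $ 3 = i"
  by (simp_all add: mat3_def)

lemma mat3_eta:
  "mat3 (A$1$1) (A$1$2) (A$1$3) (A$2$1) (A$2$2) (A$2$3) (A$3$1) (A$3$2) (A$3$3) = A"
  by (simp add: vec_eq_iff forall_3)

lemma mat3_cases:
  obtains a b c d e f g h i where "A = mat3 a b c d e f g h i"
  by (rule that[OF mat3_eta[symmetric]])

lemma mat3_eq_iff [simp]:
  "mat3 a b c d e f g h i = mat3 a' b' c' d' e' f' g' h' i' \<longleftrightarrow>
    a = a' \<and> b = b' \<and> c = c' \<and> d = d' \<and> e = e' \<and> f = f' \<and> g = g' \<and> h = h' \<and> i = i'"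
  by (auto simp: vec_eq_iff forall_3)

lemma mat3_mult [simp]:
  fixes a :: "'k::semiring_1"
  shows "mat3 a b c d e f g h i ** mat3 a' b' c' d' e' f' g' h' i' =
    mat3 (a*a' + b*d' + c*g') (a*b' + b*e' + c*h') (a*c' + b*f' + c*i')
         (d*a' + e*d' + f*g') (d*b' + e*e' + f*h') (d*c' + e*f' + f*i')
         (g*a' + h*d' + i*g') (g*b' + h*e' + i*h') (g*c' + h*f' + i*i')"
  by (simp add: vec_eq_iff forall_3 matrix_matrix_mult_def sum_3)

lemma det_mat3 [simp]:
  "det (mat3 a b c d e f g h i) = a*(e*i - f*h) - b*(d*i - f*g) + c*(d*h - e*g)"
  by (simp add: det_3 algebra_simps)

lemma mat_one_mat3: "mat 1 = (diag3 1 1 1 :: 'k::zero_neq_one^3^3)"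
  by (simp add: vec_eq_iff forall_3 mat_def)

lemma GL3_iff: "g \<in> GL3 \<longleftrightarrow> det g \<noteq> 0"
  by (simp add: GL3_def invertible_det_nz)

lemma GL3_mult: "g \<in> GL3 \<Longrightarrow> h \<in> GL3 \<Longrightarrow> g ** h \<in> GL3"
  by (simp add: GL3_iff det_mul)

lemma matrix_inv_GL3:
  fixes g :: "'k::field^3^3"
  assumes "g \<in> GL3"
  shows "g ** matrix_inv g = mat 1" "matrix_inv g ** g = mat 1"
proof -
  have "\<exists>h. g ** h = mat 1 \<and> h ** g = mat 1"
    using assms by (simp add: GL3_def invertible_def)
  then have "g ** matrix_inv g = mat 1 \<and> matrix_inv g ** g = mat 1"
    unfolding matrix_inv_def by (rule someI_ex)
  then show "g ** matrix_inv g = mat 1" "matrix_inv g ** g = mat 1" by auto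
qed

lemma matrix_inv_in_GL3: "g \<in> GL3 \<Longrightarrow> matrix_inv g \<in> GL3"
  unfolding GL3_def using matrix_inv_GL3[of g] by (auto simp: GL3_def invertible_def)

lemma matrix_inv_unique:
  fixes g :: "'k::field^3^3"
  assumes "g ** h = mat 1"
  shows "matrix_inv g = h"
proof -
  have "g \<in> GL3" using assms by (simp add: GL3_def invertible_right_inverse) blast
  then have "matrix_inv g ** (g ** h) = h"
    by (simp add: matrix_mul_assoc matrix_inv_GL3)
  then show ?thesis using assms by simp
qed

lemma matrix_inv_mult:
  fixes g :: "'k::field^3^3"
  assumes "g \<in> GL3" "h \<in> GL3"
  shows "matrix_inv (g ** h) = matrix_inv h ** matrix_inv g"
proof (rule matrix_inv_unique)
  have "g ** h ** (matrix_inv h ** matrix_inv g) = g ** (h ** matrix_inv h) ** matrix_inv g"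
    by (simp add: matrix_mul_assoc)
  then show "g ** h ** (matrix_inv h ** matrix_inv g) = mat 1"
    using assms by (simp add: matrix_inv_GL3)
qed

lemma matrix_inv_inv:
  fixes g :: "'k::field^3^3"
  assumes "g \<in> GL3"
  shows "matrix_inv (matrix_inv g) = g"
  using assms by (intro matrix_inv_unique) (simp add: matrix_inv_GL3)

lemma det_matrix_inv:
  fixes g :: "'k::field^3^3"
  assumes "g \<in> GL3"
  shows "det (matrix_inv g) = inverse (det g)"
proof -
  have "det g * det (matrix_inv g) = 1"
    using matrix_inv_GL3(1)[OF assms] by (metis det_mul det_I)
  then show ?thesis by (metis inverse_unique)
qed

section \<open>Characters\<close>

text \<open>Laurent polynomial functions on the nonzero elements. The value at 0 is left free
  because one-parameter subgroups leave GL_3 there.\<close>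

definition laurent_fun :: "('k::field \<Rightarrow> 'k) \<Rightarrow> bool" where
  "laurent_fun f \<longleftrightarrow> (\<exists>p N. \<forall>x. x \<noteq> 0 \<longrightarrow> f x * x ^ N = poly p x)"

lemma laurent_fun_poly: "laurent_fun (poly p)"
  unfolding laurent_fun_def by (rule exI[of _ p], rule exI[of _ 0]) simp

lemma laurent_fun_cong:
  assumes "laurent_fun f" "\<And>x. x \<noteq> 0 \<Longrightarrow> g x = f x"
  shows "laurent_fun g"
  using assms unfolding laurent_fun_def by simp

lemma laurent_fun_const: "laurent_fun (\<lambda>x. c)"
  by (rule laurent_fun_cong[OF laurent_fun_poly[of "[:c:]"]]) simp

lemma laurent_fun_ident: "laurent_fun (\<lambda>x. x)"
  by (rule laurent_fun_cong[OF laurent_fun_poly[of "[:0, 1:]"]]) simp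

lemma laurent_fun_inverse: "laurent_fun inverse"
  unfolding laurent_fun_def by (rule exI[of _ "[:1:]"], rule exI[of _ 1]) simp

lemma laurent_fun_add:
  assumes "laurent_fun f" "laurent_fun g"
  shows "laurent_fun (\<lambda>x. f x + g x)"
proof -
  obtain p N q M where *: "\<And>x. x \<noteq> 0 \<Longrightarrow> f x * x ^ N = poly p x"
      "\<And>x. x \<noteq> 0 \<Longrightarrow> g x * x ^ M = poly q x"
    using assms unfolding laurent_fun_def by metis
  have "(f x + g x) * x ^ (N + M) = poly (p * monom 1 M + q * monom 1 N) x" if "x \<noteq> 0" for x
    by (simp add: poly_monom *[OF that, symmetric] power_add algebra_simps)
  then show ?thesis unfolding laurent_fun_def by blast
qed

lemma laurent_fun_mult:
  assumes "laurent_fun f" "laurent_fun g"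
  shows "laurent_fun (\<lambda>x. f x * g x)"
proof -
  obtain p N q M where *: "\<And>x. x \<noteq> 0 \<Longrightarrow> f x * x ^ N = poly p x"
      "\<And>x. x \<noteq> 0 \<Longrightarrow> g x * x ^ M = poly q x"
    using assms unfolding laurent_fun_def by metis
  have "(f x * g x) * x ^ (N + M) = poly (p * q) x" if "x \<noteq> 0" for x
    by (simp add: *[OF that, symmetric] power_add algebra_simps)
  then show ?thesis unfolding laurent_fun_def by blast
qed

text \<open>Restricts a regular function to a curve \<open>G\<close>. The inverse determinant is a
  separate assumption because Laurent polynomials are not closed under inversion.\<close>

lemma laurent_fun_regular:
  assumes "f \<in> regular_functions"
    and "\<And>i j. laurent_fun (\<lambda>x. G x $ i $ j)" "laurent_fun (\<lambda>x. inverse (det (G x)))"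
  shows "laurent_fun (\<lambda>x. f (G x))"
  using assms(1)
  by induction (simp_all add: laurent_fun_const laurent_fun_add laurent_fun_mult assms(2,3))

lemma poly_eq_if_eq_nonzero:
  fixes p q :: "'k::field poly"
  assumes "infinite (UNIV :: 'k set)" "\<And>x. x \<noteq> 0 \<Longrightarrow> poly p x = poly q x"
  shows "p = q"
proof (rule ccontr)
  assume "p \<noteq> q"
  then have "finite {x. poly (p - q) x = 0}" by (intro poly_roots_finite) simp
  then have "finite (insert 0 {x. poly (p - q) x = 0})" by simp
  moreover have "insert 0 {x. poly (p - q) x = 0} = UNIV" using assms(2) by auto
  ultimately show False using assms(1) by argo
qed

text \<open>Clearing the denominator leaves a polynomial with p(c x) = p(c) p(x). Comparing leading
  coefficients gives p(c) = c^(deg p), so p is a monomial.\<close>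

lemma multiplicative_laurent_fun:
  fixes \<psi> :: "'k::field \<Rightarrow> 'k"
  assumes inf: "infinite (UNIV :: 'k set)" and L: "laurent_fun \<psi>"
    and mult: "\<And>x y. x \<noteq> 0 \<Longrightarrow> y \<noteq> 0 \<Longrightarrow> \<psi> (x * y) = \<psi> x * \<psi> y"
    and nz: "\<psi> 1 \<noteq> 0"
  shows "\<exists>k::int. \<forall>x. x \<noteq> 0 \<longrightarrow> \<psi> x = x powi k"
proof -
  obtain p N where p: "\<And>x. x \<noteq> 0 \<Longrightarrow> \<psi> x * x ^ N = poly p x"
    using L unfolding laurent_fun_def by metis
  have "poly p 1 \<noteq> 0" using p[of 1] nz by simp
  then have "p \<noteq> 0" by auto
  have "pcompose p [:0, c:] = smult (poly p c) p" if c: "c \<noteq> 0" for c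
    using inf
    by (rule poly_eq_if_eq_nonzero)
       (use p c mult in \<open>simp add: poly_pcompose p[symmetric] power_mult_distrib mult_ac\<close>)
  then have "coeff (pcompose p [:0, c:]) (degree p) = poly p c * coeff p (degree p)" if "c \<noteq> 0" for c
    using that by simp
  then have pc: "poly p c = c ^ degree p" if "c \<noteq> 0" for c
    using that \<open>p \<noteq> 0\<close> by (simp add: coeff_pcompose_linear)
  have "\<psi> x = x powi (int (degree p) - int N)" if "x \<noteq> 0" for x
    using p[OF that] pc[OF that] that by (simp add: power_int_diff field_simps)
  then show ?thesis by blast
qed

section \<open>General facts on characters of subgroups of GL_3\<close>

lemma charsD:
  assumes "\<phi> \<in> chars H"
  shows "\<exists>f\<in>regular_functions. \<forall>g\<in>H. \<phi> g = f g"
    "g \<in> H \<Longrightarrow> \<phi> g \<noteq> 0" "g \<in> H \<Longrightarrow> h \<in> H \<Longrightarrow> \<phi> (g ** h) = \<phi> g * \<phi> h" "g \<notin> H \<Longrightarrow> \<phi> g = 1"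
  using assms unfolding chars_def mem_Collect_eq by blast+

lemma charsI:
  assumes "f \<in> regular_functions" "\<And>g. g \<in> H \<Longrightarrow> \<phi> g = f g"
    "\<And>g. g \<in> H \<Longrightarrow> \<phi> g \<noteq> 0" "\<And>g h. g \<in> H \<Longrightarrow> h \<in> H \<Longrightarrow> \<phi> (g ** h) = \<phi> g * \<phi> h"
    "\<And>g. g \<notin> H \<Longrightarrow> \<phi> g = 1"
  shows "\<phi> \<in> chars H"
  using assms unfolding chars_def mem_Collect_eq by blast

lemma chars_eqI:
  assumes "\<phi> \<in> chars H" "\<psi> \<in> chars H" "\<And>g. g \<in> H \<Longrightarrow> \<phi> g = \<psi> g"
  shows "\<phi> = \<psi>"
  using assms(3) charsD(4)[OF assms(1)] charsD(4)[OF assms(2)] by fastforce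

lemma chars_mult:
  assumes "\<phi> \<in> chars H" "\<psi> \<in> chars H"
  shows "(\<lambda>g. \<phi> g * \<psi> g) \<in> chars H"
proof -
  obtain f h where "f \<in> regular_functions" "\<forall>g\<in>H. \<phi> g = f g" "h \<in> regular_functions" "\<forall>g\<in>H. \<psi> g = h g"
    using assms charsD(1) by metis
  then show ?thesis
    using charsD(2-4)[OF assms(1)] charsD(2-4)[OF assms(2)]
    by (intro charsI[of "\<lambda>g. f g * h g"] regular_functions.mult) (simp_all add: mult_ac)
qed

lemma restrict_char_in:
  assumes "\<phi> \<in> chars M" "L \<subseteq> M" "\<And>g h. g \<in> L \<Longrightarrow> h \<in> L \<Longrightarrow> g ** h \<in> L"
  shows "restrict_char L \<phi> \<in> chars L"
proof -
  obtain f where "f \<in> regular_functions" "\<forall>g\<in>M. \<phi> g = f g"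
    using assms charsD(1) by metis
  then show ?thesis
    using charsD(2)[OF assms(1)] charsD(3)[OF assms(1), symmetric] assms(2,3)
    by (intro charsI[of f]) (simp_all add: restrict_char_def subset_iff)
qed

lemma diag_torus_iff: "mat3 a b c d e f g h i \<in> diag_torus \<longleftrightarrow>
    b = 0 \<and> c = 0 \<and> d = 0 \<and> f = 0 \<and> g = 0 \<and> h = 0 \<and> a \<noteq> 0 \<and> e \<noteq> 0 \<and> i \<noteq> 0"
  by (auto simp: diag_torus_def GL3_iff forall_3)

lemma M0_iff: "mat3 a b c d e f g h i \<in> M0 \<longleftrightarrow>
    b = 0 \<and> c = 0 \<and> d = 0 \<and> g = 0 \<and> a \<noteq> 0 \<and> e * i - f * h \<noteq> 0"
  by (auto simp: M0_def GL3_iff)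

lemma diag_torus_cases:
  assumes "g \<in> diag_torus"
  obtains x y z where "g = diag3 x y z" "x \<noteq> 0" "y \<noteq> 0" "z \<noteq> 0"
  using assms by (cases g rule: mat3_cases) (auto simp: diag_torus_iff)

lemma M0_cases:
  assumes "g \<in> M0"
  obtains a e f h i where "g = mat3 a 0 0 0 e f 0 h i" "a \<noteq> 0" "e * i - f * h \<noteq> 0"
  using assms by (cases g rule: mat3_cases) (auto simp: M0_iff)

lemma diag_torus_subset: "diag_torus \<subseteq> M0" "M0 \<subseteq> GL3" "diag_torus \<subseteq> GL3"
  by (auto simp: diag_torus_def M0_def)

lemma M0_mult:
  assumes "g \<in> M0" "h \<in> M0"
  shows "g ** h \<in> M0"
proof -
  have "det (g ** h) \<noteq> 0" using assms by (simp add: M0_def GL3_iff det_mul)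
  then show ?thesis using assms
    by (auto simp: M0_def GL3_iff matrix_matrix_mult_def sum_3)
qed

lemma char_on_diag:
  fixes \<phi> :: "'k::field^3^3 \<Rightarrow> 'k"
  assumes inf: "infinite (UNIV :: 'k set)" and \<phi>: "\<phi> \<in> chars H" and H: "diag_torus \<subseteq> H"
  shows "\<exists>i j k::int. \<forall>x y z. x \<noteq> 0 \<and> y \<noteq> 0 \<and> z \<noteq> 0 \<longrightarrow>
    \<phi> (diag3 x y z) = x powi i * y powi j * z powi k"
proof -
  obtain f where f: "f \<in> regular_functions" "\<And>g. g \<in> H \<Longrightarrow> \<phi> g = f g"
    using charsD(1)[OF \<phi>] by metis
  have inH: "diag3 x y z \<in> H" if "x \<noteq> 0" "y \<noteq> 0" "z \<noteq> 0" for x y z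
    using that H by (auto simp: diag_torus_iff)
  have mult: "\<phi> (diag3 (x*x') (y*y') (z*z')) = \<phi> (diag3 x y z) * \<phi> (diag3 x' y' z')"
    if "x \<noteq> 0" "y \<noteq> 0" "z \<noteq> 0" "x' \<noteq> 0" "y' \<noteq> 0" "z' \<noteq> 0" for x y z x' y' z'
    using charsD(3)[OF \<phi> inH inH, of x y z x' y' z'] that by simp
  have one: "\<phi> (diag3 1 1 1) \<noteq> 0" by (rule charsD(2)[OF \<phi> inH]) auto

  \<comment> \<open>Stated for a triple of functions so that one argument covers the three
    coordinate subgroups.\<close>
  have one_param: "\<exists>k::int. \<forall>x. x \<noteq> 0 \<longrightarrow> \<phi> (diag3 (a x) (b x) (c x)) = x powi k"
    if L: "laurent_fun a" "laurent_fun b" "laurent_fun c" "laurent_fun (\<lambda>x. inverse (a x * b x * c x))"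
      and nz: "\<And>x. x \<noteq> 0 \<Longrightarrow> a x \<noteq> 0 \<and> b x \<noteq> 0 \<and> c x \<noteq> 0"
      and m: "\<And>x y. a (x * y) = a x * a y" "\<And>x y. b (x * y) = b x * b y" "\<And>x y. c (x * y) = c x * c y"
    for a b c
  proof (rule multiplicative_laurent_fun[OF inf])
    have "laurent_fun (\<lambda>x. f (diag3 (a x) (b x) (c x)))"
    proof (rule laurent_fun_regular[OF f(1)])
      show "laurent_fun (\<lambda>x. diag3 (a x) (b x) (c x) $ i $ j)" for i j
        using exhaust_3[of i] exhaust_3[of j] L laurent_fun_const[of 0] by auto
      show "laurent_fun (\<lambda>x. inverse (det (diag3 (a x) (b x) (c x))))"
        using L(4) by (simp add: mult.assoc)
    qed
    then show "laurent_fun (\<lambda>x. \<phi> (diag3 (a x) (b x) (c x)))"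
      by (rule laurent_fun_cong) (simp add: f(2) inH nz)
  qed (use nz in \<open>auto simp: m mult inH charsD(2)[OF \<phi>]\<close>)
  obtain i j k :: int where
    "\<And>x. x \<noteq> 0 \<Longrightarrow> \<phi> (diag3 x 1 1) = x powi i"
    "\<And>x. x \<noteq> 0 \<Longrightarrow> \<phi> (diag3 1 x 1) = x powi j"
    "\<And>x. x \<noteq> 0 \<Longrightarrow> \<phi> (diag3 1 1 x) = x powi k"
    using one_param[of "\<lambda>x. x" "\<lambda>x. 1" "\<lambda>x. 1"] one_param[of "\<lambda>x. 1" "\<lambda>x. x" "\<lambda>x. 1"]
      one_param[of "\<lambda>x. 1" "\<lambda>x. 1" "\<lambda>x. x"]
    by (auto simp: laurent_fun_ident laurent_fun_const laurent_fun_inverse)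
  moreover have "\<phi> (diag3 x y z) = \<phi> (diag3 x 1 1) * \<phi> (diag3 1 y 1) * \<phi> (diag3 1 1 z)"
    if "x \<noteq> 0" "y \<noteq> 0" "z \<noteq> 0" for x y z
    using mult[of x 1 1 1 y 1] mult[of x y 1 1 1 z] that by simp
  ultimately show ?thesis by metis
qed

text \<open>Applied with \<open>u\<close> a commutator; the product form avoids inverses.\<close>

lemma char_eq_one:
  assumes "\<phi> \<in> chars H" "d \<in> H" "e \<in> H" "u \<in> H" "u ** e \<in> H" "d ** e = (u ** e) ** d"
  shows "\<phi> u = 1"
proof -
  have "\<phi> d * \<phi> e = \<phi> u * \<phi> e * \<phi> d"
    using assms charsD(3)[OF assms(1)] by metis
  then show ?thesis using charsD(2)[OF assms(1)] assms(2,3) by simp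
qed

lemma char_sandwich:
  assumes "\<phi> \<in> chars H" "u \<in> H" "g \<in> H" "v \<in> H" "g ** v \<in> H" "\<phi> u = 1" "\<phi> v = 1"
  shows "\<phi> (u ** (g ** v)) = \<phi> g"
  using charsD(3)[OF assms(1,2,5)] charsD(3)[OF assms(1,3,4)] assms(6,7) by simp

lemma char_conj_eq:
  assumes "\<phi> \<in> chars H" "w \<in> H" "d \<in> H" "d' \<in> H" "w ** d = d' ** w"
  shows "\<phi> d = \<phi> d'"
proof -
  have "\<phi> w * \<phi> d = \<phi> d' * \<phi> w"
    using assms charsD(3)[OF assms(1)] by metis
  then show ?thesis using charsD(2)[OF assms(1,2)] by simp
qed

text \<open>Otherwise x^|i-j| - 1 would vanish at every nonzero x, which a nonzero polynomial over
  an infinite field cannot do.\<close>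

lemma powi_eq_imp_eq:
  fixes i j :: int
  assumes inf: "infinite (UNIV :: 'k::field set)" and "\<And>x::'k. x \<noteq> 0 \<Longrightarrow> x powi i = x powi j"
  shows "i = j"
proof (rule ccontr)
  assume "i \<noteq> j"
  define n where "n = nat \<bar>i - j\<bar>"
  have n: "n > 0" using \<open>i \<noteq> j\<close> by (simp add: n_def)
  have one: "x ^ n = 1" if "x \<noteq> 0" for x :: 'k
  proof -
    have "x powi (i - j) = 1" "x powi (j - i) = 1"
      using assms(2)[OF that] that by (simp_all add: power_int_diff)
    then show ?thesis
      by (cases "i \<le> j") (auto simp: n_def power_int_def)
  qed
  have "monom (1::'k) n = [:1:]"
    by (rule poly_eq_if_eq_nonzero[OF inf]) (simp add: poly_monom one)
  then have "degree (monom (1::'k) n) = degree ([:1:] :: 'k poly)" by simp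
  then show False using n by (simp add: degree_monom_eq)
qed

lemma regular_diff:
  assumes "f \<in> regular_functions" "h \<in> regular_functions"
  shows "(\<lambda>g. f g - h g) \<in> regular_functions"
  using regular_functions.add[OF assms(1) regular_functions.mult[OF regular_functions.const assms(2)], of "-1"]
  by simp

lemma regular_power: "f \<in> regular_functions \<Longrightarrow> (\<lambda>g. f g ^ n) \<in> regular_functions"
  by (induction n) (auto intro: regular_functions.const regular_functions.mult)

text \<open>The only inverse among the generators is that of the determinant, so a regular function
  inverting \<open>f\<close> on \<open>H\<close> has to be supplied: below it is the inverse
  determinant times the complementary factor of the determinant.\<close>

lemma regular_powi:
  assumes "f \<in> regular_functions" "f' \<in> regular_functions" "\<And>g. g \<in> H \<Longrightarrow> f' g = inverse (f g)"
  shows "\<exists>h\<in>regular_functions. \<forall>g\<in>H. h g = f g powi k"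
proof (cases "k \<ge> 0")
  case True
  then show ?thesis
    by (intro bexI[of _ "\<lambda>g. f g ^ nat k"]) (auto simp: power_int_def assms regular_power)
next
  case False
  then show ?thesis
    by (intro bexI[of _ "\<lambda>g. f' g ^ nat (- k)"]) (auto simp: power_int_def assms regular_power)
qed

lemma regular_det: "det \<in> regular_functions"
  unfolding det_3[abs_def]
  by (intro regular_functions.add regular_functions.mult regular_diff regular_functions.entry)

definition det2 :: "'k::field^3^3 \<Rightarrow> 'k" where
  "det2 g = g$2$2 * g$3$3 - g$2$3 * g$3$2"

lemma det2_mat3 [simp]: "det2 (mat3 a b c d e f g h i) = e * i - f * h"
  by (simp add: det2_def)

lemma regular_det2: "det2 \<in> regular_functions"
  unfolding det2_def[abs_def]
  by (intro regular_functions.mult regular_diff regular_functions.entry)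

lemma det_M0: "g \<in> M0 \<Longrightarrow> det g = g$1$1 * det2 g"
  by (elim M0_cases) simp

lemma M0_nonzero: "g \<in> M0 \<Longrightarrow> g$1$1 \<noteq> 0" "g \<in> M0 \<Longrightarrow> det2 g \<noteq> 0"
  by (auto elim!: M0_cases)

lemma M0_mult_nth: "g \<in> M0 \<Longrightarrow> h \<in> M0 \<Longrightarrow> (g ** h)$1$1 = g$1$1 * h$1$1"
  "g \<in> M0 \<Longrightarrow> h \<in> M0 \<Longrightarrow> det2 (g ** h) = det2 g * det2 h"
  by (auto elim!: M0_cases simp: algebra_simps)

section \<open>The characters of the diagonal torus, M_0 and GL_3\<close>

definition chi_diag :: "int \<Rightarrow> int \<Rightarrow> int \<Rightarrow> 'k::field^3^3 \<Rightarrow> 'k" where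
  "chi_diag i j k = (\<lambda>g. if g \<in> diag_torus then g$1$1 powi i * g$2$2 powi j * g$3$3 powi k else 1)"

definition chi_M0 :: "int \<Rightarrow> int \<Rightarrow> 'k::field^3^3 \<Rightarrow> 'k" where
  "chi_M0 i j = (\<lambda>g. if g \<in> M0 then g$1$1 powi i * det2 g powi j else 1)"

definition chi_GL3 :: "int \<Rightarrow> 'k::field^3^3 \<Rightarrow> 'k" where
  "chi_GL3 k = (\<lambda>g. if g \<in> GL3 then det g powi k else 1)"

lemma chi_diag_in: "chi_diag i j k \<in> chars (diag_torus :: ('k::field^3^3) set)"
proof -
  have *: "\<exists>h\<in>regular_functions. \<forall>g\<in>diag_torus :: ('k^3^3) set. h g = (g$a$a) powi k" for a k
  proof (rule regular_powi[where f = "\<lambda>g. g$a$a"])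
    let ?f = "\<lambda>g. inverse (det g) * (if a = 1 then g$2$2 * g$3$3 else if a = 2 then g$1$1 * g$3$3 else g$1$1 * g$2$2)"
    show "?f g = inverse (g$a$a)" if "g \<in> diag_torus" for g
      using that exhaust_3[of a] by (auto elim!: diag_torus_cases simp: field_simps)
    show "?f \<in> regular_functions"
      by (cases "a = 1"; cases "a = 2"; simp; intro regular_functions.intros)
  qed (rule regular_functions.entry)
  obtain f1 f2 f3 :: "'k^3^3 \<Rightarrow> 'k" where "f1 \<in> regular_functions" "\<forall>g\<in>diag_torus. f1 g = (g$1$1) powi i"
    "f2 \<in> regular_functions" "\<forall>g\<in>diag_torus. f2 g = (g$2$2) powi j"
    "f3 \<in> regular_functions" "\<forall>g\<in>diag_torus. f3 g = (g$3$3) powi k"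
    using * by metis
  then show ?thesis
    by (intro charsI[of "\<lambda>g. f1 g * f2 g * f3 g"] regular_functions.mult)
       (auto simp: chi_diag_def diag_torus_iff power_int_mult_distrib elim!: diag_torus_cases)
qed

lemma chi_M0_in: "chi_M0 i j \<in> chars (M0 :: ('k::field^3^3) set)"
proof -
  have "\<exists>h\<in>regular_functions. \<forall>g\<in>M0 :: ('k^3^3) set. h g = (g$1$1) powi i"
    by (rule regular_powi[where f' = "\<lambda>g. det2 g * inverse (det g)"])
       (auto intro: regular_functions.intros regular_det2 simp: det_M0 M0_nonzero)
  moreover have "\<exists>h\<in>regular_functions. \<forall>g\<in>M0 :: ('k^3^3) set. h g = det2 g powi j"
    by (rule regular_powi[where f' = "\<lambda>g. g$1$1 * inverse (det g)"])
       (auto intro: regular_functions.intros regular_det2 simp: det_M0 M0_nonzero)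
  ultimately obtain f1 f2 :: "'k^3^3 \<Rightarrow> 'k" where "f1 \<in> regular_functions" "\<forall>g\<in>M0. f1 g = (g$1$1) powi i"
    "f2 \<in> regular_functions" "\<forall>g\<in>M0. f2 g = det2 g powi j"
    by metis
  then show ?thesis
    by (intro charsI[of "\<lambda>g. f1 g * f2 g"] regular_functions.mult)
       (simp_all add: chi_M0_def M0_mult M0_nonzero M0_mult_nth power_int_mult_distrib)
qed

lemma chi_GL3_in: "chi_GL3 k \<in> chars (GL3 :: ('k::field^3^3) set)"
proof -
  have "\<exists>h\<in>regular_functions. \<forall>g\<in>GL3 :: ('k^3^3) set. h g = det g powi k"
    by (rule regular_powi[where f' = "\<lambda>g. inverse (det g)"])
       (auto intro: regular_functions.intros regular_det)
  then obtain f :: "'k^3^3 \<Rightarrow> 'k" where "f \<in> regular_functions" "\<forall>g\<in>GL3. f g = det g powi k"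
    by metis
  then show ?thesis
    by (intro charsI[of f])
       (simp_all add: chi_GL3_def GL3_mult, simp_all add: GL3_iff det_mul power_int_mult_distrib)
qed

lemma chars_diag_torus:
  fixes \<phi> :: "'k::field^3^3 \<Rightarrow> 'k"
  assumes inf: "infinite (UNIV :: 'k set)" and \<phi>: "\<phi> \<in> chars diag_torus"
  shows "\<exists>i j k. \<phi> = chi_diag i j k"
proof -
  obtain i j k where ijk: "\<forall>x y z. x \<noteq> 0 \<and> y \<noteq> 0 \<and> z \<noteq> 0 \<longrightarrow>
    \<phi> (diag3 x y z) = x powi i * y powi j * z powi k"
    using char_on_diag[OF inf \<phi>] by blast
  have "\<phi> = chi_diag i j k"
    by (rule chars_eqI[OF \<phi> chi_diag_in])
       (auto elim!: diag_torus_cases simp: ijk chi_diag_def diag_torus_iff)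
  then show ?thesis by blast
qed

lemma exists_not_0_1:
  assumes inf: "infinite (UNIV :: 'k::field set)"
  shows "\<exists>t::'k. t \<noteq> 0 \<and> t \<noteq> 1"
proof (rule ccontr)
  assume "\<not> ?thesis"
  then have "UNIV = {0::'k, 1}" by auto
  then show False using inf by (metis finite.emptyI finite.insertI)
qed

text \<open>A character is 1 on root subgroups, because these consist of commutators, and takes
  equal values on elements conjugate by the transposition matrix. Hence its values on the diagonal
  torus determine it on the big cell L D U, and translation by \<open>U 1\<close> moves the rest of
  \<open>M0\<close> into that cell.\<close>

lemma chars_M0:
  fixes \<phi> :: "'k::field^3^3 \<Rightarrow> 'k"
  assumes inf: "infinite (UNIV :: 'k set)" and \<phi>: "\<phi> \<in> chars M0"
  shows "\<exists>i j. \<phi> = chi_M0 i j"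
proof -
  obtain t :: 'k where t: "t \<noteq> 0" "t \<noteq> 1"
    using exists_not_0_1[OF inf] by blast
  obtain i j k where ijk: "\<forall>x y z. x \<noteq> 0 \<and> y \<noteq> 0 \<and> z \<noteq> 0 \<longrightarrow>
    \<phi> (diag3 x y z) = x powi i * y powi j * z powi k"
    using char_on_diag[OF inf \<phi> diag_torus_subset(1)] by blast
  define U where "U = (\<lambda>s::'k. mat3 1 0 0 0 1 s 0 0 1)"
  define L where "L = (\<lambda>s::'k. mat3 1 0 0 0 1 0 0 s 1)"
  have UM: "U s \<in> M0" "L s \<in> M0" for s by (simp_all add: U_def L_def M0_iff)
  \<comment> \<open>\<open>U s\<close> is the commutator of diag(1, t, 1) with \<open>U r\<close>,
    where (t - 1) r = s.\<close>
  have U1: "\<phi> (U s) = 1" for s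
    by (rule char_eq_one[OF \<phi>, of "diag3 1 t 1" "U (s / (t - 1))"])
       (use t in \<open>auto simp: U_def M0_iff field_simps\<close>)
  have L1: "\<phi> (L s) = 1" for s
    by (rule char_eq_one[OF \<phi>, of "diag3 1 1 t" "L (s / (t - 1))"])
       (use t in \<open>auto simp: L_def M0_iff field_simps\<close>)
  have "\<phi> (diag3 1 x 1) = \<phi> (diag3 1 1 x)" if "x \<noteq> 0" for x
    by (rule char_conj_eq[OF \<phi>, of "mat3 1 0 0 0 0 1 0 1 0"]) (use that in \<open>auto simp: M0_iff\<close>)
  then have "x powi j = x powi k" if "x \<noteq> 0" for x :: 'k
    using that ijk[rule_format, of 1 x 1] ijk[rule_format, of 1 1 x] by simp
  then have jk: "j = k" by (rule powi_eq_imp_eq[OF inf])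
  have main: "\<phi> g = g$1$1 powi i * det2 g powi j" if g: "g \<in> M0" "g$2$2 \<noteq> 0" for g
  proof -
    from g(1) obtain a e f h l where geq: "g = mat3 a 0 0 0 e f 0 h l" "a \<noteq> 0" "e * l - f * h \<noteq> 0"
      by (rule M0_cases)
    have e: "e \<noteq> 0" using g geq by simp
    have "g = L (h / e) ** (diag3 a e ((e * l - f * h) / e) ** U (f / e))"
      using e by (simp add: geq L_def U_def field_simps)
    moreover have d: "diag3 a e ((e * l - f * h) / e) \<in> M0"
      using e geq by (simp add: M0_iff)
    ultimately have "\<phi> g = \<phi> (diag3 a e ((e * l - f * h) / e))"
      using char_sandwich[OF \<phi> UM(2) d UM(1) M0_mult[OF d UM(1)] L1 U1] by metis
    also have "\<dots> = a powi i * e powi j * ((e * l - f * h) / e) powi j"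
      using ijk geq e jk by simp
    also have "\<dots> = a powi i * (e * l - f * h) powi j"
      using e by (simp add: mult.assoc power_int_mult_distrib[symmetric])
    finally show ?thesis using geq by simp
  qed
  have "\<phi> g = g$1$1 powi i * det2 g powi j" if g: "g \<in> M0" for g
  proof (cases "g$2$2 = 0")
    case True
    from g obtain a e f h l where geq: "g = mat3 a 0 0 0 e f 0 h l" "a \<noteq> 0" "e * l - f * h \<noteq> 0"
      by (rule M0_cases)
    have "e = 0" using True geq by simp
    then have "h \<noteq> 0" using geq by auto
    have "\<phi> (U 1 ** g) = (U 1 ** g)$1$1 powi i * det2 (U 1 ** g) powi j"
      by (rule main[OF M0_mult[OF UM(1) g]]) (use \<open>h \<noteq> 0\<close> \<open>e = 0\<close> in \<open>simp add: geq U_def\<close>)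
    moreover have "\<phi> (U 1 ** g) = \<phi> g" using charsD(3)[OF \<phi> UM(1) g] U1 by simp
    moreover have "(U 1 ** g)$1$1 = g$1$1" "det2 (U 1 ** g) = det2 g"
      by (simp_all add: geq U_def algebra_simps)
    ultimately show ?thesis by simp
  qed (use main g in blast)
  then have "\<phi> = chi_M0 i j"
    by (intro chars_eqI[OF \<phi> chi_M0_in]) (simp add: chi_M0_def)
  then show ?thesis by blast
qed

text \<open>The scheme of \<open>chars_M0\<close> with \<open>M0\<close> in place of the diagonal
  torus and the cell L M_0 U. The two remaining exponents agree because conjugation by a permutation
  matrix exchanges the first two diagonal entries.\<close>

lemma chars_GL3:
  fixes \<phi> :: "'k::field^3^3 \<Rightarrow> 'k"
  assumes inf: "infinite (UNIV :: 'k set)" and \<phi>: "\<phi> \<in> chars GL3"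
  shows "\<exists>k. \<phi> = chi_GL3 k"
proof -
  obtain t :: 'k where t: "t \<noteq> 0" "t \<noteq> 1"
    using exists_not_0_1[OF inf] by blast
  obtain i j where ij: "restrict_char M0 \<phi> = chi_M0 i j"
    using chars_M0[OF inf restrict_char_in[OF \<phi> diag_torus_subset(2) M0_mult]] by blast
  have \<phi>M: "\<phi> g = g$1$1 powi i * det2 g powi j" if "g \<in> M0" for g
    using fun_cong[OF ij, of g] that by (simp add: restrict_char_def chi_M0_def)
  define U where "U = (\<lambda>r s::'k. mat3 1 r s 0 1 0 0 0 1)"
  define L where "L = (\<lambda>r s::'k. mat3 1 0 0 r 1 0 s 0 1)"
  have UM: "U r s \<in> GL3" "L r s \<in> GL3" for r s by (simp_all add: U_def L_def GL3_iff)
  have U1: "\<phi> (U r s) = 1" for r s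
    by (rule char_eq_one[OF \<phi>, of "diag3 t 1 1" "U (r / (t - 1)) (s / (t - 1))"])
       (use t in \<open>auto simp: U_def GL3_iff field_simps\<close>)
  have L1: "\<phi> (L r s) = 1" for r s
    by (rule char_eq_one[OF \<phi>, of "diag3 1 t t" "L (r / (t - 1)) (s / (t - 1))"])
       (use t in \<open>auto simp: L_def GL3_iff field_simps\<close>)
  have "\<phi> (diag3 x 1 1) = \<phi> (diag3 1 x 1)" if "x \<noteq> 0" for x
    by (rule char_conj_eq[OF \<phi>, of "mat3 0 1 0 1 0 0 0 0 1"]) (use that in \<open>auto simp: GL3_iff\<close>)
  then have "x powi i = x powi j" if "x \<noteq> 0" for x :: 'k
    using that \<phi>M[of "diag3 x 1 1"] \<phi>M[of "diag3 1 x 1"] by (simp add: M0_iff)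
  then have eq: "i = j" by (rule powi_eq_imp_eq[OF inf])
  have main: "\<phi> g = det g powi i" if g: "g \<in> GL3" "g$1$1 \<noteq> 0" for g
  proof -
    obtain a b c d e f h k l where geq: "g = mat3 a b c d e f h k l"
      by (rule mat3_cases)
    have a: "a \<noteq> 0" using g geq by simp
    let ?m = "mat3 a 0 0 0 (e - d * b / a) (f - d * c / a) 0 (k - h * b / a) (l - h * c / a)"
    have dec: "g = L (d / a) (h / a) ** (?m ** U (b / a) (c / a))"
      using a by (simp add: geq L_def U_def)
    have "det g = det (L (d / a) (h / a)) * (det ?m * det (U (b / a) (c / a)))"
      unfolding dec det_mul ..
    also have "\<dots> = det ?m" by (simp add: L_def U_def)
    finally have det: "det g = det ?m" .
    then have "?m \<in> M0" using g a by (simp add: GL3_iff M0_iff)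
    moreover have "?m \<in> GL3" using det g by (simp add: GL3_iff)
    ultimately have "\<phi> g = \<phi> ?m"
      using char_sandwich[OF \<phi> UM(2) _ UM(1) GL3_mult[OF _ UM(1)] L1 U1] dec by metis
    also have "\<dots> = det ?m powi i"
      using \<phi>M[OF \<open>?m \<in> M0\<close>] by (simp add: eq power_int_mult_distrib)
    finally show ?thesis using det by simp
  qed
  have "\<phi> g = det g powi i" if g: "g \<in> GL3" for g
  proof (cases "g$1$1 = 0")
    case True
    obtain a b c d e f h k l where geq: "g = mat3 a b c d e f h k l"
      by (rule mat3_cases)
    have "a = 0" using True geq by simp
    then have "d \<noteq> 0 \<or> h \<noteq> 0" using g geq by (auto simp: GL3_iff)
    \<comment> \<open>Adding r times row 2 and s times row 3 to row 1 produces a nonzero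
      pivot.\<close>
    then obtain r s where rs: "r * d + s * h \<noteq> 0"
      by (metis add_0 add.right_neutral mult_zero_left mult_1)
    have "\<phi> (U r s ** g) = det (U r s ** g) powi i"
      by (rule main[OF GL3_mult[OF UM(1) g]]) (use rs \<open>a = 0\<close> in \<open>simp add: geq U_def\<close>)
    moreover have "\<phi> (U r s ** g) = \<phi> g" using charsD(3)[OF \<phi> UM(1) g] U1 by simp
    moreover have "det (U r s ** g) = det g"
      by (simp add: det_mul U_def)
    ultimately show ?thesis by simp
  qed (use main g in blast)
  then have "\<phi> = chi_GL3 i"
    by (intro chars_eqI[OF \<phi> chi_GL3_in]) (simp add: chi_GL3_def)
  then show ?thesis by blast
qed

text \<open>On SL_3 the entry \<open>g$1$1\<close> is the inverse of \<open>det2 g\<close>, so the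
  restriction of a character of \<open>M0\<close> depends only on j - i.\<close>

lemma det2_powi_SL3:
  assumes "g \<in> M0" "det g = 1"
  shows "g$1$1 powi i * det2 g powi j = det2 g powi (j - i)"
proof -
  have "g$1$1 * det2 g = 1" using assms by (simp add: det_M0)
  then have "g$1$1 = inverse (det2 g)" by (metis inverse_unique mult.commute)
  then have "g$1$1 powi i = det2 g powi (- i)" by (simp add: power_int_inverse power_int_minus)
  then show ?thesis using M0_nonzero(2)[OF assms(1)] by (simp add: power_int_add[symmetric])
qed

type_synonym 'q functional = "('q fls^3^3 \<Rightarrow> 'q fls) \<Rightarrow> real"

abbreviation ord :: "'q::zero fls \<Rightarrow> int" where "ord \<equiv> fls_subdegree"

section \<open>The spaces \<open>a_M\<close> in coordinates\<close>

lemma infinite_UNIV_fls: "infinite (UNIV :: 'q::field fls set)"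
proof
  assume "finite (UNIV :: 'q fls set)"
  then have "finite (range (\<lambda>n::nat. (fls_X :: 'q fls) ^ n))" by (rule finite_subset[rotated]) simp
  moreover have "inj (\<lambda>n::nat. (fls_X :: 'q fls) ^ n)"
  proof (rule injI)
    fix n m :: nat assume "(fls_X :: 'q fls) ^ n = fls_X ^ m"
    then have "ord ((fls_X :: 'q fls) ^ n) = ord (fls_X ^ m :: 'q fls)" by simp
    then show "n = m" by simp
  qed
  ultimately show False by (simp add: finite_image_iff)
qed

lemma int_additive_real:
  fixes f :: "int \<Rightarrow> real"
  assumes add: "\<And>a b. f (a + b) = f a + f b"
  shows "f a = of_int a * f 1"
proof -
  have f0: "f 0 = 0" using add[of 0 0] by simp
  have nat: "f (int n) = of_nat n * f 1" for n
    by (induction n) (simp_all add: f0 add algebra_simps)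
  have "f (- a) = - f a" for a using add[of a "- a"] f0 by simp
  then show ?thesis
    using nat[of "nat a"] nat[of "nat (- a)"] by (cases "a \<ge> 0") (auto simp: of_nat_nat)
qed

lemma cocharsD:
  assumes "l \<in> cochars H"
  shows "\<phi> \<in> chars H \<Longrightarrow> l \<phi> \<in> \<int>"
    "\<phi> \<in> chars H \<Longrightarrow> \<psi> \<in> chars H \<Longrightarrow> l (\<lambda>g. \<phi> g * \<psi> g) = l \<phi> + l \<psi>" "\<phi> \<notin> chars H \<Longrightarrow> l \<phi> = 0"
  using assms unfolding cochars_def by blast+

lemma aspace_induct [consumes 1, case_names zero add scale cochar]:
  assumes "v \<in> aspace H" "P (\<lambda>_. 0)"
    "\<And>u w. P u \<Longrightarrow> P w \<Longrightarrow> P (\<lambda>\<phi>. u \<phi> + w \<phi>)" "\<And>c u. P u \<Longrightarrow> P (\<lambda>\<phi>. c * u \<phi>)"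
    "\<And>l. l \<in> cochars H \<Longrightarrow> P l"
  shows "P v"
proof -
  have "subspace {v. P v}"
    using assms(2-4) by (auto simp: subspace_def plus_fun_def zero_fun_def scaleR_fun_def)
  then have "span (cochars H) \<subseteq> {v. P v}"
    using assms(5) by (intro span_minimal) auto
  then show ?thesis using assms(1) by (auto simp: aspace_def)
qed

lemma aspace_additive:
  assumes "v \<in> aspace H" "\<phi> \<in> chars H" "\<psi> \<in> chars H"
  shows "v (\<lambda>g. \<phi> g * \<psi> g) = v \<phi> + v \<psi>"
  using assms(1)
  by (induction rule: aspace_induct) (simp_all add: algebra_simps cocharsD(2) assms(2,3))

lemma aspace_support:
  assumes "v \<in> aspace H" "\<phi> \<notin> chars H"
  shows "v \<phi> = 0"
  using assms(1) by (induction rule: aspace_induct) (simp_all add: cocharsD(3) assms(2))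

lemma subspace_aspace: "subspace (aspace H)"
  by (simp add: aspace_def)

text \<open>Three exponents are allowed so that the same lemma serves \<open>M0\<close> and
  \<open>GL3\<close>, with \<open>chi\<close> constant in the surplus exponents.\<close>

lemma aspace_expand:
  fixes chi :: "int \<Rightarrow> int \<Rightarrow> int \<Rightarrow> 'k::field^3^3 \<Rightarrow> 'k"
  assumes v: "v \<in> aspace H" and chi: "\<And>i j k. chi i j k \<in> chars H"
    "\<And>i j k i' j' k'. (\<lambda>g. chi i j k g * chi i' j' k' g) = chi (i + i') (j + j') (k + k')"
  shows "v (chi i j k) = of_int i * v (chi 1 0 0) + of_int j * v (chi 0 1 0) + of_int k * v (chi 0 0 1)"
proof -
  have *: "v (chi (i + i') (j + j') (k + k')) = v (chi i j k) + v (chi i' j' k')" for i j k i' j' k'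
    using aspace_additive[OF v chi(1) chi(1), of i j k i' j' k'] by (simp add: chi(2))
  have "v (chi i j k) = v (chi i 0 0) + v (chi 0 j 0) + v (chi 0 0 k)"
    using *[of i 0 0 j 0 0] *[of i 0 j 0 0 k] by simp
  moreover have "v (chi i 0 0) = of_int i * v (chi 1 0 0)"
    using *[of _ _ 0 0 0 0] by (intro int_additive_real[of "\<lambda>i. v (chi i 0 0)"]) simp
  moreover have "v (chi 0 j 0) = of_int j * v (chi 0 1 0)"
    using *[of 0 0 _ _ 0 0] by (intro int_additive_real[of "\<lambda>i. v (chi 0 i 0)"]) simp
  moreover have "v (chi 0 0 k) = of_int k * v (chi 0 0 1)"
    using *[of 0 0 0 0] by (intro int_additive_real[of "\<lambda>i. v (chi 0 0 i)"]) simp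
  ultimately show ?thesis by simp
qed

text \<open>The image of t under the Harish-Chandra map of H. It supplies the coordinate vectors,
  the lattice points and the values of \<open>H_P\<close>.\<close>

definition val_at :: "('q::field fls^3^3) set \<Rightarrow> 'q fls^3^3 \<Rightarrow> 'q functional" where
  "val_at H t = (\<lambda>\<phi>. if \<phi> \<in> chars H then real_of_int (ord (\<phi> t)) else 0)"

lemma val_at_cochars:
  assumes "t \<in> H"
  shows "val_at H t \<in> cochars H"
  unfolding cochars_def
  using assms charsD(2)[of _ H t] by (auto simp: val_at_def chars_mult)

lemma val_at_aspace: "t \<in> H \<Longrightarrow> val_at H t \<in> aspace H"
  using val_at_cochars span_base unfolding aspace_def by blast

lemma chi_mult:
  "(\<lambda>g. chi_diag i j k g * chi_diag i' j' k' g) = chi_diag (i + i') (j + j') (k + k')"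
  "(\<lambda>g. chi_M0 i j g * chi_M0 i' j' g) = chi_M0 (i + i') (j + j')"
  "(\<lambda>g. chi_GL3 i g * chi_GL3 i' g) = chi_GL3 (i + i')"
  by (auto simp: fun_eq_iff chi_diag_def chi_M0_def chi_GL3_def power_int_add M0_nonzero GL3_iff
      elim!: diag_torus_cases)

lemma chi_restrict:
  "restrict_char M0 (chi_GL3 k) = chi_M0 k k"
  "restrict_char diag_torus (chi_M0 i j) = chi_diag i j j"
  using diag_torus_subset
  by (auto simp: fun_eq_iff restrict_char_def chi_diag_def chi_M0_def chi_GL3_def det_M0 M0_iff
      power_int_mult_distrib elim!: diag_torus_cases)

lemma chi_diag3:
  assumes "x \<noteq> 0" "y \<noteq> 0" "z \<noteq> 0"
  shows "chi_diag i j k (diag3 x y z) = x powi i * y powi j * z powi k"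
    "chi_M0 i j (diag3 x y z) = x powi i * (y * z) powi j"
    "chi_GL3 i (diag3 x y z) = (x * (y * z)) powi i"
  using assms by (simp_all add: chi_diag_def chi_M0_def chi_GL3_def diag_torus_iff M0_iff GL3_iff)

definition vec_diag :: "real \<Rightarrow> real \<Rightarrow> real \<Rightarrow> 'q::finite_field functional" where
  "vec_diag x y z = x *\<^sub>R val_at diag_torus (diag3 fls_X 1 1) + y *\<^sub>R val_at diag_torus (diag3 1 fls_X 1)
    + z *\<^sub>R val_at diag_torus (diag3 1 1 fls_X)"

text \<open>The coordinates are the values on the first diagonal entry and on the determinant of the
  lower block; \<open>diag3 1 fls_X 1\<close> has lower block of determinant eps.\<close>

definition vec_M0 :: "real \<Rightarrow> real \<Rightarrow> 'q::finite_field functional" where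
  "vec_M0 x y = x *\<^sub>R val_at M0 (diag3 fls_X 1 1) + y *\<^sub>R val_at M0 (diag3 1 fls_X 1)"

definition vec_GL3 :: "real \<Rightarrow> 'q::finite_field functional" where
  "vec_GL3 x = x *\<^sub>R val_at GL3 (diag3 fls_X 1 1)"

lemma vec_aspace: "vec_diag x y z \<in> aspace diag_torus" "vec_M0 x y \<in> aspace M0" "vec_GL3 x \<in> aspace GL3"
  unfolding vec_diag_def vec_M0_def vec_GL3_def
  by (intro subspace_add[OF subspace_aspace] subspace_scale[OF subspace_aspace] val_at_aspace;
      simp add: diag_torus_iff M0_iff GL3_iff)+

lemma vec_chi:
  "vec_diag x y z (chi_diag i j k) = of_int i * x + of_int j * y + of_int k * z"
  "vec_M0 x y (chi_M0 i j) = of_int i * x + of_int j * y"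
  "vec_GL3 x (chi_GL3 i) = of_int i * x"
  by (simp_all add: vec_diag_def vec_M0_def vec_GL3_def plus_fun_def scaleR_fun_def val_at_def
      chi_diag_in chi_M0_in chi_GL3_in chi_diag3 fls_subdegree_power_int del: fls_X_power_int)

lemma aspace_eqI:
  assumes "v \<in> aspace H" "w \<in> aspace H" "\<And>\<phi>. \<phi> \<in> chars H \<Longrightarrow> v \<phi> = w \<phi>"
  shows "v = w"
  using assms(3) aspace_support[OF assms(1)] aspace_support[OF assms(2)] by fastforce

lemma aspace_eq_vec:
  fixes v :: "'q::finite_field functional"
  shows "v \<in> aspace diag_torus \<Longrightarrow> v = vec_diag (v (chi_diag 1 0 0)) (v (chi_diag 0 1 0)) (v (chi_diag 0 0 1))"
    "v \<in> aspace M0 \<Longrightarrow> v = vec_M0 (v (chi_M0 1 0)) (v (chi_M0 0 1))"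
    "v \<in> aspace GL3 \<Longrightarrow> v = vec_GL3 (v (chi_GL3 1))"
proof -
  assume v: "v \<in> aspace diag_torus"
  show "v = vec_diag (v (chi_diag 1 0 0)) (v (chi_diag 0 1 0)) (v (chi_diag 0 0 1))"
  proof (rule aspace_eqI[OF v vec_aspace(1)])
    fix \<phi> :: "'q fls^3^3 \<Rightarrow> 'q fls" assume "\<phi> \<in> chars diag_torus"
    then obtain i j k where "\<phi> = chi_diag i j k" using chars_diag_torus[OF infinite_UNIV_fls] by blast
    then show "v \<phi> = vec_diag (v (chi_diag 1 0 0)) (v (chi_diag 0 1 0)) (v (chi_diag 0 0 1)) \<phi>"
      using aspace_expand[OF v, of chi_diag i j k] by (simp add: chi_diag_in chi_mult vec_chi)
  qed
next
  assume v: "v \<in> aspace M0"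
  show "v = vec_M0 (v (chi_M0 1 0)) (v (chi_M0 0 1))"
  proof (rule aspace_eqI[OF v vec_aspace(2)])
    fix \<phi> :: "'q fls^3^3 \<Rightarrow> 'q fls" assume "\<phi> \<in> chars M0"
    then obtain i j where "\<phi> = chi_M0 i j" using chars_M0[OF infinite_UNIV_fls] by blast
    then show "v \<phi> = vec_M0 (v (chi_M0 1 0)) (v (chi_M0 0 1)) \<phi>"
      using aspace_expand[OF v, of "\<lambda>i j k. chi_M0 i j" i j 0] by (simp add: chi_M0_in chi_mult vec_chi)
  qed
next
  assume v: "v \<in> aspace GL3"
  show "v = vec_GL3 (v (chi_GL3 1))"
  proof (rule aspace_eqI[OF v vec_aspace(3)])
    fix \<phi> :: "'q fls^3^3 \<Rightarrow> 'q fls" assume "\<phi> \<in> chars GL3"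
    then obtain i where "\<phi> = chi_GL3 i" using chars_GL3[OF infinite_UNIV_fls] by blast
    then show "v \<phi> = vec_GL3 (v (chi_GL3 1)) \<phi>"
      using aspace_expand[OF v, of "\<lambda>i j k. chi_GL3 i" i 0 0] by (simp add: chi_GL3_in chi_mult vec_chi)
  qed
qed

lemma vec_eq_iffs:
  "vec_diag x y z = vec_diag x' y' z' \<longleftrightarrow> x = x' \<and> y = y' \<and> z = z'"
  "vec_M0 x y = vec_M0 x' y' \<longleftrightarrow> x = x' \<and> y = y'"
proof -
  have "x = x' \<and> y = y' \<and> z = z'" if e: "vec_diag x y z = vec_diag x' y' z'"
    using fun_cong[OF e, of "chi_diag 1 0 0"] fun_cong[OF e, of "chi_diag 0 1 0"]
      fun_cong[OF e, of "chi_diag 0 0 1"] by (simp add: vec_chi)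
  then show "vec_diag x y z = vec_diag x' y' z' \<longleftrightarrow> x = x' \<and> y = y' \<and> z = z'" by blast
  have "x = x' \<and> y = y'" if e: "vec_M0 x y = vec_M0 x' y'"
    using fun_cong[OF e, of "chi_M0 1 0"] fun_cong[OF e, of "chi_M0 0 1"] by (simp add: vec_chi)
  then show "vec_M0 x y = vec_M0 x' y' \<longleftrightarrow> x = x' \<and> y = y'" by blast
qed

lemma vec_linear:
  "c *\<^sub>R vec_diag x y z = vec_diag (c * x) (c * y) (c * z)"
  "c *\<^sub>R vec_M0 x y = vec_M0 (c * x) (c * y)"
  "vec_M0 x y + vec_M0 x' y' = vec_M0 (x + x') (y + y')"
  "vec_M0 x y - vec_M0 x' y' = vec_M0 (x - x') (y - y')"
  by (simp_all add: vec_diag_def vec_M0_def algebra_simps)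

lemma vec_diag_zero: "vec_diag 0 0 0 = 0"
  by (simp add: vec_diag_def)

lemma val_at_M0:
  fixes m :: "'q::finite_field fls^3^3"
  assumes "m \<in> M0"
  shows "val_at M0 m = vec_M0 (of_int (ord (m$1$1))) (of_int (ord (det2 m)))"
  by (subst aspace_eq_vec(2)[OF val_at_aspace[OF assms]])
     (simp add: val_at_def chi_M0_in, simp add: chi_M0_def assms)

section \<open>Centres, embeddings and projections of the spaces a_M\<close>

lemma scalar_in_center_GL3:
  assumes "x \<noteq> 0"
  shows "diag3 x x x \<in> center_of GL3"
proof -
  have "diag3 x x x ** h = h ** diag3 x x x" for h
    by (cases h rule: mat3_cases) (simp add: mult.commute)
  then show ?thesis using assms by (simp add: center_of_def GL3_iff)
qed

lemma center_GL3_scalar: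
  assumes "z \<in> center_of GL3"
  obtains x where "z = diag3 x x x" "x \<noteq> 0"
proof -
  have c: "z ** h = h ** z" if "h \<in> GL3" for h using assms that by (auto simp: center_of_def)
  obtain a b c' d e f g h i where z: "z = mat3 a b c' d e f g h i" by (rule mat3_cases)
  have "z = diag3 a a a"
    using c[of "mat3 1 1 0 0 1 0 0 0 1"] c[of "mat3 1 0 1 0 1 0 0 0 1"] c[of "mat3 1 0 0 1 1 0 0 0 1"]
      c[of "mat3 1 0 0 0 1 0 1 0 1"]
    by (simp add: z GL3_iff)
  moreover have "a \<noteq> 0" using assms calculation by (auto simp: center_of_def GL3_iff)
  ultimately show ?thesis using that by blast
qed

lemma center_M0_diag:
  assumes "z \<in> center_of M0"
  obtains x y where "z = diag3 x y y" "x \<noteq> 0" "y \<noteq> 0"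
proof -
  have c: "z ** h = h ** z" if "h \<in> M0" for h using assms that by (auto simp: center_of_def)
  have "z \<in> M0" using assms by (simp add: center_of_def)
  then obtain a e f h i where z: "z = mat3 a 0 0 0 e f 0 h i" "a \<noteq> 0" by (rule M0_cases)
  have "z = diag3 a e e"
    using c[of "mat3 1 0 0 0 1 1 0 0 1"] c[of "mat3 1 0 0 0 1 0 0 1 1"]
    by (simp add: z M0_iff)
  moreover have "e \<noteq> 0" using \<open>z \<in> M0\<close> calculation by (auto simp: M0_iff)
  ultimately show ?thesis using that z(2) by blast
qed

lemma diag_in_center_M0: "x \<noteq> 0 \<Longrightarrow> y \<noteq> 0 \<Longrightarrow> diag3 x y y \<in> center_of M0"
  by (auto simp: center_of_def M0_iff mult.commute elim!: M0_cases)

text \<open>The character \<open>chi_M0 (-2) 1\<close> is trivial on scalar matrices, so an image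
  (x, y) satisfies y = 2 x, while restriction of the determinant prescribes x + y. Hence the factors
  1/3 and 2/3.\<close>

lemma levi_embed_GL3_M0:
  fixes v :: "'q::finite_field functional"
  assumes "v \<in> aspace GL3"
  shows "levi_embed GL3 M0 v = vec_M0 (v (chi_GL3 1) / 3) (2 * v (chi_GL3 1) / 3)"
  unfolding levi_embed_def
proof (rule the_equality, intro conjI ballI impI)
  let ?l = "v (chi_GL3 1)"
  have v: "v = vec_GL3 ?l" using aspace_eq_vec(3)[OF assms] .
  show "vec_M0 (?l / 3) (2 * ?l / 3) \<in> aspace M0" by (rule vec_aspace)
  fix \<phi> :: "'q fls^3^3 \<Rightarrow> 'q fls" assume "\<phi> \<in> chars GL3"
  then obtain k where "\<phi> = chi_GL3 k" using chars_GL3[OF infinite_UNIV_fls] by blast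
  then show "vec_M0 (?l / 3) (2 * ?l / 3) (restrict_char M0 \<phi>) = v \<phi>"
    by (subst v) (simp add: chi_restrict vec_chi)
next
  let ?l = "v (chi_GL3 1)"
  fix \<psi> :: "'q fls^3^3 \<Rightarrow> 'q fls" assume "\<psi> \<in> chars M0" and triv: "\<forall>z\<in>center_of GL3. \<psi> z = 1"
  then obtain i j where ij: "\<psi> = chi_M0 i j" using chars_M0[OF infinite_UNIV_fls] by blast
  have "\<psi> (diag3 fls_X fls_X fls_X) = 1"
    using triv scalar_in_center_GL3[of "fls_X :: 'q fls"] by simp
  then have "ord (chi_M0 i j (diag3 fls_X fls_X (fls_X :: 'q fls))) = 0" by (simp add: ij)
  then have "i + 2 * j = 0"
    by (simp add: chi_diag3 fls_subdegree_power_int del: fls_X_power_int)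
  then have "i = -2 * j" by simp
  then show "vec_M0 (?l / 3) (2 * ?l / 3) \<psi> = 0"
    by (simp add: ij vec_chi)
next
  let ?l = "v (chi_GL3 1)"
  fix u :: "'q functional"
  assume *: "u \<in> aspace M0 \<and> (\<forall>\<phi>\<in>chars GL3. u (restrict_char M0 \<phi>) = v \<phi>) \<and>
    (\<forall>\<psi>\<in>chars M0. (\<forall>z\<in>center_of GL3. \<psi> z = 1) \<longrightarrow> u \<psi> = 0)"
  obtain x y where u: "u = vec_M0 x y" using aspace_eq_vec(2) * by blast
  have "u (restrict_char M0 (chi_GL3 1)) = ?l" using * chi_GL3_in by blast
  then have "x + y = ?l" by (simp add: u chi_restrict vec_chi)
  moreover have "\<forall>z\<in>center_of GL3. chi_M0 (-2) 1 z = 1"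
    by (auto elim!: center_GL3_scalar simp: chi_diag3 power_int_minus power2_eq_square field_simps)
  then have "u (chi_M0 (-2) 1) = 0" using * chi_M0_in by blast
  then have "y = 2 * x" by (simp add: u vec_chi)
  ultimately show "u = vec_M0 (?l / 3) (2 * ?l / 3)"
    by (simp add: u vec_eq_iffs)
qed

text \<open>\<open>chi_diag 0 1 (-1)\<close> is trivial on the centre of \<open>M0\<close>, so the
  two lower coordinates are equal and share the value r on \<open>det2\<close>.\<close>

lemma levi_embed_M0_diag:
  fixes v :: "'q::finite_field functional"
  shows "levi_embed M0 diag_torus (vec_M0 p r :: 'q functional) = vec_diag p (r / 2) (r / 2)"
  unfolding levi_embed_def
proof (rule the_equality, intro conjI ballI impI)
  show "(vec_diag p (r / 2) (r / 2) :: 'q functional) \<in> aspace diag_torus" by (rule vec_aspace)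
  fix \<phi> :: "'q fls^3^3 \<Rightarrow> 'q fls" assume "\<phi> \<in> chars M0"
  then obtain i j where "\<phi> = chi_M0 i j" using chars_M0[OF infinite_UNIV_fls] by blast
  then show "vec_diag p (r / 2) (r / 2) (restrict_char diag_torus \<phi>) = vec_M0 p r \<phi>"
    by (simp add: chi_restrict vec_chi)
next
  fix \<psi> :: "'q fls^3^3 \<Rightarrow> 'q fls"
  assume "\<psi> \<in> chars diag_torus" and triv: "\<forall>z\<in>center_of M0. \<psi> z = 1"
  then obtain i j k where ij: "\<psi> = chi_diag i j k" using chars_diag_torus[OF infinite_UNIV_fls] by blast
  have "\<psi> (diag3 fls_X 1 1) = 1" "\<psi> (diag3 1 fls_X fls_X) = 1"
    using triv diag_in_center_M0[of "fls_X :: 'q fls" 1] diag_in_center_M0[of "1 :: 'q fls" fls_X] by simp_all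
  then have "ord (chi_diag i j k (diag3 fls_X 1 (1 :: 'q fls))) = 0"
    "ord (chi_diag i j k (diag3 1 fls_X (fls_X :: 'q fls))) = 0" by (simp_all add: ij)
  then have "i = 0" "j = - k"
    by (simp_all add: chi_diag3 fls_subdegree_power_int del: fls_X_power_int)
  then show "vec_diag p (r / 2) (r / 2) \<psi> = 0"
    by (simp add: ij vec_chi)
next
  fix u :: "'q functional"
  assume *: "u \<in> aspace diag_torus \<and> (\<forall>\<phi>\<in>chars M0. u (restrict_char diag_torus \<phi>) = vec_M0 p r \<phi>) \<and>
    (\<forall>\<psi>\<in>chars diag_torus. (\<forall>z\<in>center_of M0. \<psi> z = 1) \<longrightarrow> u \<psi> = 0)"
  obtain x y z where u: "u = vec_diag x y z" using aspace_eq_vec(1) * by blast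
  have "u (restrict_char diag_torus (chi_M0 1 0)) = p" "u (restrict_char diag_torus (chi_M0 0 1)) = r"
    using * chi_M0_in[of 1 0] chi_M0_in[of 0 1] by (auto simp: vec_chi)
  then have "x = p" "y + z = r" by (simp_all add: u chi_restrict vec_chi)
  moreover have "\<forall>z\<in>center_of M0. chi_diag 0 1 (-1) z = 1"
    by (auto elim!: center_M0_diag simp: chi_diag3 power_int_minus)
  then have "u (chi_diag 0 1 (-1)) = 0" using * chi_diag_in by blast
  then have "y = z" by (simp add: u vec_chi)
  ultimately show "u = vec_diag p (r / 2) (r / 2)"
    by (simp add: u vec_eq_iffs)
qed

lemma aspace_G_M0: "v \<in> aspace_G M0 \<longleftrightarrow> (\<exists>x. v = vec_M0 x (- x))"
proof
  assume "v \<in> aspace_G M0"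
  then have "v \<in> aspace M0" "v (restrict_char M0 (chi_GL3 1)) = 0"
    using chi_GL3_in by (auto simp: aspace_G_def)
  moreover from this(1) obtain x y where v: "v = vec_M0 x y" using aspace_eq_vec(2) by blast
  ultimately have "y = - x" by (simp add: chi_restrict vec_chi)
  then show "\<exists>x. v = vec_M0 x (- x)" using v by blast
next
  assume "\<exists>x. v = vec_M0 x (- x)"
  then obtain x where "v = vec_M0 x (- x)" by blast
  then show "v \<in> aspace_G M0"
    by (auto simp: aspace_G_def vec_aspace chi_restrict vec_chi dest!: chars_GL3[OF infinite_UNIV_fls])
qed

lemma vec_diag_in_aspace_G:
  assumes "x + y + z = 0"
  shows "(vec_diag x y z :: 'q::finite_field functional) \<in> aspace_G diag_torus"
proof -
  have "restrict_char diag_torus (chi_GL3 k) = (chi_diag k k k :: 'q fls^3^3 \<Rightarrow> 'q fls)" for k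
    using diag_torus_subset
    by (auto simp: fun_eq_iff restrict_char_def chi_diag_def chi_GL3_def power_int_mult_distrib GL3_iff
        elim!: diag_torus_cases)
  moreover have "of_int k * x + of_int k * y + of_int k * z = 0" for k
    using assms by (simp add: distrib_left[symmetric])
  ultimately show ?thesis
    by (auto simp: aspace_G_def vec_aspace vec_chi dest!: chars_GL3[OF infinite_UNIV_fls])
qed

text \<open>The component in a_G is the multiple of (1/3, 2/3) with the same coordinate sum, so the
  projection subtracts (x + y) / 3 from x and leaves coordinate sum 0.\<close>

lemma proj_G_M0:
  "proj_G M0 (vec_M0 x y :: 'q::finite_field functional)
    = vec_M0 (x - (x + y) / 3) (- (x - (x + y) / 3))"
  unfolding proj_G_def
proof (rule the_equality, intro conjI)
  let ?u = "vec_M0 (x - (x + y) / 3) (- (x - (x + y) / 3)) :: 'q functional"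
  show "?u \<in> aspace_G M0" unfolding aspace_G_M0 by blast
  have "vec_M0 x y - ?u = levi_embed GL3 M0 (vec_GL3 (x + y))"
    by (simp add: levi_embed_GL3_M0 vec_aspace vec_chi vec_linear vec_eq_iffs field_simps)
  then show "vec_M0 x y - ?u \<in> levi_embed GL3 M0 ` aspace GL3"
    using vec_aspace(3) by blast
next
  fix u :: "'q functional"
  assume *: "u \<in> aspace_G M0 \<and> vec_M0 x y - u \<in> levi_embed GL3 M0 ` aspace GL3"
  then obtain p where u: "u = vec_M0 p (- p)" by (auto simp: aspace_G_M0)
  from * obtain w where "w \<in> aspace GL3" "vec_M0 x y - u = levi_embed GL3 M0 w" by blast
  then have "vec_M0 (x - p) (y + p) = (vec_M0 (w (chi_GL3 1) / 3) (2 * w (chi_GL3 1) / 3)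
      :: 'q functional)"
    by (simp add: u levi_embed_GL3_M0 vec_linear)
  then have "x - p = w (chi_GL3 1) / 3" "y + p = 2 * w (chi_GL3 1) / 3"
    unfolding vec_eq_iffs by blast+
  then have "p = x - (x + y) / 3" by argo
  then show "u = vec_M0 (x - (x + y) / 3) (- (x - (x + y) / 3))" by (simp add: u)
qed

section \<open>Volumes on \<open>a_{M_0}^G\<close>\<close>

lemma sqrt_unit_exists:
  assumes "b > (0::real)" shows "\<exists>x. x * x * b = 1"
  by (rule exI[of _ "1 / sqrt b"]) (use assms in simp)

text \<open>On a line B is determined by one positive number, so unit vectors exist. Which of them
  \<open>SOME\<close> picks is left open: covolume and weight both scale by 1 / |x|.\<close>

lemma vol_M0_eq:
  fixes B :: "'q::finite_field functional \<Rightarrow> 'q functional \<Rightarrow> real"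
  assumes "weyl_inner_product B"
  obtains x where "x \<noteq> 0" "vol_M0 B = embed_measure lborel (\<lambda>t. t *\<^sub>R vec_M0 x (- x))"
proof -
  have B: "inner_product_on (aspace_G diag_torus) B" using assms by (simp add: weyl_inner_product_def)
  define d where "d = (vec_diag 1 (-1/2) (-1/2) :: 'q functional)"
  have d: "d \<in> aspace_G diag_torus" unfolding d_def by (rule vec_diag_in_aspace_G) simp
  have "d \<noteq> 0" using vec_eq_iffs(1)[of 1 "-1/2" "-1/2" 0 0 0] unfolding d_def vec_diag_zero by simp
  have sc: "r *\<^sub>R d \<in> aspace_G diag_torus" for r
    unfolding d_def vec_linear by (rule vec_diag_in_aspace_G) simp
  let ?V = "aspace_G diag_torus :: 'q functional set"
  have B_lin: "\<forall>u\<in>?V. \<forall>v\<in>?V. \<forall>w\<in>?V. \<forall>r s. B (r *\<^sub>R u + s *\<^sub>R v) w = r * B u w + s * B v w"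
    using B unfolding inner_product_on_def by (elim conjE)
  have B_sym: "\<forall>u\<in>?V. \<forall>v\<in>?V. B u v = B v u"
    using B unfolding inner_product_on_def by (elim conjE)
  have B_pos: "\<forall>u\<in>?V. u \<noteq> 0 \<longrightarrow> B u u > 0"
    using B unfolding inner_product_on_def by (elim conjE)
  have pos: "B d d > 0" using B_pos d \<open>d \<noteq> 0\<close> by blast
  have lin: "B (r *\<^sub>R d) w = r * B d w" if "w \<in> ?V" for r w
    using B_lin[rule_format, OF d d that, of r 0] by simp
  have sym: "B d (r *\<^sub>R d) = B (r *\<^sub>R d) d" for r
    by (rule B_sym[rule_format, OF d sc])
  have quad: "B (r *\<^sub>R d) (r *\<^sub>R d) = r * r * B d d" for r
    unfolding lin[OF sc] sym lin[OF d] by (rule mult.assoc[symmetric])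
  have emb: "levi_embed M0 diag_torus (vec_M0 r (- r)) = r *\<^sub>R d" for r
    by (simp add: levi_embed_M0_diag d_def vec_linear)
  define e where "e = (SOME u. u \<in> aspace_G M0 \<and>
                 B (levi_embed M0 diag_torus u) (levi_embed M0 diag_torus u) = 1)"
  have "\<exists>u. u \<in> aspace_G M0 \<and> B (levi_embed M0 diag_torus u) (levi_embed M0 diag_torus u) = 1"
  proof -
    obtain x where "x * x * B d d = 1" using sqrt_unit_exists[OF pos] by blast
    then have "B (levi_embed M0 diag_torus (vec_M0 x (- x))) (levi_embed M0 diag_torus (vec_M0 x (- x))) = 1"
      by (simp only: emb quad)
    then show ?thesis using aspace_G_M0 by blast
  qed
  then have e: "e \<in> aspace_G M0 \<and> B (levi_embed M0 diag_torus e) (levi_embed M0 diag_torus e) = 1"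
    unfolding e_def by (rule someI_ex)
  then obtain x where x: "e = vec_M0 x (- x)" by (auto simp: aspace_G_M0)
  have "x * x * B d d = 1" using e unfolding x emb quad by blast
  then have "x \<noteq> 0" by auto
  moreover have "vol_M0 B = embed_measure lborel (\<lambda>t. t *\<^sub>R vec_M0 x (- x))"
    by (simp add: vol_M0_def e_def[symmetric] x)
  ultimately show ?thesis using that by blast
qed

text \<open>\<open>from_SL3\<close> evaluates a cocharacter only at restrictions of characters of
  \<open>M0\<close>, and these are the powers of the restriction of \<open>det2\<close>. A
  cocharacter therefore enters only through one integer.\<close>

lemma cochars_M0_SL3:
  "from_SL3 ` cochars (M0 \<inter> SL3) = range (\<lambda>k::int. vec_M0 (of_int k) (- of_int k)
     :: 'q::finite_field functional)"
proof -
  let ?H = "M0 \<inter> SL3 :: ('q fls^3^3) set"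
  have multH: "g ** h \<in> ?H" if "g \<in> ?H" "h \<in> ?H" for g h
    using that by (auto simp: M0_mult SL3_def det_mul)
  define \<delta> where "\<delta> k = restrict_char ?H (chi_M0 0 k)" for k
  have \<delta>_in: "\<delta> k \<in> chars ?H" for k
    unfolding \<delta>_def by (rule restrict_char_in[OF chi_M0_in _ multH]) auto
  have \<delta>_mult: "(\<lambda>g. \<delta> i g * \<delta> j g) = \<delta> (i + j)" for i j
    using fun_cong[OF chi_mult(2)[of 0 i 0 j]] by (auto simp: \<delta>_def restrict_char_def fun_eq_iff)
  have res: "restrict_char ?H (chi_M0 i j) = \<delta> (j - i)" for i j
  proof
    fix g show "restrict_char ?H (chi_M0 i j) g = \<delta> (j - i) g"
    proof (cases "g \<in> ?H")
      case True
      then show ?thesis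
        using det2_powi_SL3[of g i j] by (simp add: \<delta>_def restrict_char_def chi_M0_def SL3_def)
    qed (auto simp: \<delta>_def restrict_char_def)
  qed
  have from_eq: "from_SL3 l = vec_M0 (- l (\<delta> 1)) (l (\<delta> 1))" if l: "l \<in> cochars ?H" for l
  proof
    fix \<phi> :: "'q fls^3^3 \<Rightarrow> 'q fls"
    show "from_SL3 l \<phi> = vec_M0 (- l (\<delta> 1)) (l (\<delta> 1)) \<phi>"
    proof (cases "\<phi> \<in> chars M0")
      case True
      then obtain i j where ij: "\<phi> = chi_M0 i j" using chars_M0[OF infinite_UNIV_fls] by blast
      have "l (\<delta> k) = of_int k * l (\<delta> 1)" for k
        using cocharsD(2)[OF l \<delta>_in \<delta>_in] by (intro int_additive_real[of "\<lambda>k. l (\<delta> k)"]) (simp add: \<delta>_mult)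
      then have "l (\<delta> (j - i)) = of_int (j - i) * l (\<delta> 1)" .
      then show ?thesis
        by (simp add: from_SL3_def ij chi_M0_in res vec_chi algebra_simps)
    qed (simp add: from_SL3_def aspace_support[OF vec_aspace(2)])
  qed
  show ?thesis
  proof (intro equalityI subsetI)
    fix v assume "v \<in> from_SL3 ` cochars ?H"
    then obtain l where l: "l \<in> cochars ?H" "v = from_SL3 l" by blast
    have "l (\<delta> 1) \<in> \<int>" using cocharsD(1)[OF l(1) \<delta>_in] .
    then obtain k where "l (\<delta> 1) = of_int k" by (auto elim: Ints_cases)
    then have "v = vec_M0 (of_int (- k)) (- of_int (- k))" using from_eq[OF l(1)] l(2) by simp
    then show "v \<in> range (\<lambda>k::int. vec_M0 (of_int k) (- of_int k))" by blast
  next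
    fix v :: "'q functional"
    assume "v \<in> range (\<lambda>k::int. vec_M0 (of_int k) (- of_int k))"
    then obtain k :: int where v: "v = vec_M0 (of_int k) (- of_int k)" by blast
    \<comment> \<open>This element has determinant 1 and first entry eps^k, so its valuation
      cocharacter realizes k.\<close>
    let ?t = "diag3 (fls_X powi k) (fls_X powi (- k)) 1 :: 'q fls^3^3"
    have t: "?t \<in> ?H" by (simp add: M0_iff SL3_def power_int_minus del: fls_X_power_int)
    have "ord (\<delta> 1 ?t) = - k"
      using t by (simp add: \<delta>_def restrict_char_def chi_M0_def fls_subdegree_power_int del: fls_X_power_int)
    then have "from_SL3 (val_at ?H ?t) = v"
      unfolding from_eq[OF val_at_cochars[OF t]] v by (simp add: val_at_def \<delta>_in)
    then show "v \<in> from_SL3 ` cochars ?H" using val_at_cochars[OF t] by blast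
  qed
qed

section \<open>Fundamental domains of a lattice on a line\<close>

lemma floor_divide_unique:
  assumes "s > (0::real)"
  shows "of_int k * s \<le> t \<and> t < (of_int k + 1) * s \<longleftrightarrow> k = \<lfloor>t / s\<rfloor>"
proof -
  have "k = \<lfloor>t / s\<rfloor> \<longleftrightarrow> of_int k \<le> t / s \<and> t / s < of_int k + 1"
    using floor_eq_iff[of "t / s" k] by auto
  then show ?thesis using assms by (simp add: pos_le_divide_eq pos_divide_less_eq)
qed

text \<open>Cut \<open>A\<close> along the intervals [k s, (k + 1) s) and translate every piece into
  [0, s). The domain property says that the translates tile [0, s), and translation preserves
  Lebesgue measure.\<close>

lemma lborel_fundamental_domain:
  fixes A :: "real set"
  assumes A: "A \<in> sets lborel" and s: "s > 0" and dom: "\<And>t. \<exists>!k::int. t - of_int k * s \<in> A"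
  shows "emeasure lborel A = ennreal s"
proof -
  define X where "X k = A \<inter> {of_int k * s..<(of_int k + 1) * s}" for k :: int
  define Y where "Y k = (\<lambda>t. t + of_int k * s) -` A \<inter> {0..<s}" for k :: int
  have floor: "of_int k * s \<le> t \<and> t < (of_int k + 1) * s \<longleftrightarrow> k = \<lfloor>t / s\<rfloor>" for k :: int and t
    using s by (rule floor_divide_unique)
  have XA: "(\<Union>k. X k) = A" by (auto simp: X_def floor)
  have "disjoint_family X" by (auto simp: disjoint_family_on_def X_def floor)
  have Xs: "X k \<in> sets lborel" for k using A by (simp add: X_def)
  have Ys: "Y k \<in> sets lborel" for k
    using measurable_sets[of "\<lambda>t. t + of_int k * s" borel borel A] A by (simp add: Y_def)
  have YI: "(\<Union>k. Y k) = {0..<s}"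
  proof -
    have "\<exists>k::int. t + of_int k * s \<in> A" for t
    proof -
      obtain k :: int where "t - of_int k * s \<in> A" using dom[of t] by blast
      then show ?thesis by (intro exI[of _ "- k"]) simp
    qed
    then show ?thesis by (auto simp: Y_def)
  qed
  have "disjoint_family Y"
  proof (clarsimp simp: disjoint_family_on_def Y_def)
    fix k l :: int assume "k \<noteq> l"
    have False if "t + of_int k * s \<in> A" "t + of_int l * s \<in> A" for t
    proof -
      have "a = b" if "t - of_int a * s \<in> A" "t - of_int b * s \<in> A" for a b :: int
        using dom[of t] that by blast
      from this[of "- k" "- l"] show ?thesis using that \<open>k \<noteq> l\<close> by simp
    qed
    then show "(\<lambda>t. t + of_int k * s) -` A \<inter> {0..<s} \<inter> ((\<lambda>t. t + of_int l * s) -` A \<inter> {0..<s}) = {}"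
      by auto
  qed
  have XY: "emeasure lborel (X k) = emeasure lborel (Y k)" for k
  proof -
    have "emeasure lborel (X k) = emeasure (distr lborel borel (\<lambda>t. of_int k * s + t)) (X k)"
      by (subst lborel_distr_plus) simp
    also have "\<dots> = emeasure lborel ((\<lambda>t. of_int k * s + t) -` X k \<inter> space lborel)"
      using Xs[of k] by (intro emeasure_distr) auto
    also have "(\<lambda>t. of_int k * s + t) -` X k \<inter> space lborel = Y k"
      by (auto simp: X_def Y_def algebra_simps)
    finally show ?thesis .
  qed
  have "emeasure lborel A = (\<integral>\<^sup>+k. emeasure lborel (X k) \<partial>count_space UNIV)"
    unfolding XA[symmetric] using Xs \<open>disjoint_family X\<close> by (intro emeasure_UN_countable) auto
  also have "\<dots> = (\<integral>\<^sup>+k. emeasure lborel (Y k) \<partial>count_space UNIV)" by (simp add: XY)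
  also have "\<dots> = emeasure lborel {0..<s}"
    unfolding YI[symmetric] using Ys \<open>disjoint_family Y\<close> by (intro emeasure_UN_countable[symmetric]) auto
  also have "\<dots> = ennreal s" using s by simp
  finally show ?thesis .
qed

lemma ex1_range:
  assumes "inj h"
  shows "(\<exists>!l. l \<in> range h \<and> P l) \<longleftrightarrow> (\<exists>!k. P (h k))"
  using injD[OF assms] by blast

lemma range_scaleR_abs:
  "range (\<lambda>k::int. (of_int k / x) *\<^sub>R e) = range (\<lambda>k::int. (of_int k / \<bar>x\<bar>) *\<^sub>R e)"
proof (cases "x \<ge> 0")
  case False
  then have "(\<lambda>k::int. (of_int k / x) *\<^sub>R e) = (\<lambda>k::int. (of_int k / \<bar>x\<bar>) *\<^sub>R e) \<circ> uminus"
    by (auto simp: fun_eq_iff)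
  then show ?thesis by (simp only: image_comp[symmetric] surj_uminus)
qed simp

lemma covolume_line:
  fixes e :: "'v::real_vector"
  assumes e: "e \<noteq> 0" and x: "x \<noteq> 0"
  shows "covolume (embed_measure lborel (\<lambda>t. t *\<^sub>R e)) (range (\<lambda>k::int. (of_int k / x) *\<^sub>R e)) = 1 / \<bar>x\<bar>"
proof -
  let ?f = "\<lambda>t::real. t *\<^sub>R e" and ?\<Lambda> = "range (\<lambda>k::int. (of_int k / \<bar>x\<bar>) *\<^sub>R e)"
  let ?\<mu> = "embed_measure lborel (\<lambda>t. t *\<^sub>R e)"
  have inj: "inj ?f" using e by (auto simp: inj_def)
  have mem: "t *\<^sub>R e \<in> ?f ` A \<longleftrightarrow> t \<in> A" for t A using e by auto
  have dom: "(\<forall>v\<in>space ?\<mu>. \<exists>!l. l \<in> ?\<Lambda> \<and> v - l \<in> ?f ` A) \<longleftrightarrow> (\<forall>t. \<exists>!k::int. t - of_int k * (1 / \<bar>x\<bar>) \<in> A)" for A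
  proof -
    have inj': "inj (\<lambda>k::int. (of_int k / \<bar>x\<bar>) *\<^sub>R e)" using e x by (auto simp: inj_def)
    have "t *\<^sub>R e - (of_int k / \<bar>x\<bar>) *\<^sub>R e \<in> ?f ` A \<longleftrightarrow> t - of_int k * (1 / \<bar>x\<bar>) \<in> A" for k :: int and t
      using mem[of "t - of_int k / \<bar>x\<bar>" A] by (simp add: scaleR_diff_left)
    then have "(\<exists>!l. l \<in> ?\<Lambda> \<and> t *\<^sub>R e - l \<in> ?f ` A) \<longleftrightarrow> (\<exists>!k::int. t - of_int k * (1 / \<bar>x\<bar>) \<in> A)" for t
      unfolding ex1_range[OF inj'] by simp
    then show ?thesis by (simp add: space_embed_measure)
  qed
  have meas: "measure ?\<mu> (?f ` A) = 1 / \<bar>x\<bar>" if "A \<in> sets lborel" "\<forall>t. \<exists>!k::int. t - of_int k * (1 / \<bar>x\<bar>) \<in> A" for A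
  proof -
    have "emeasure ?\<mu> (?f ` A) = emeasure lborel (?f -` (?f ` A) \<inter> space lborel)"
      using inj that by (intro emeasure_embed_measure) (auto simp: in_sets_embed_measure)
    also have "?f -` (?f ` A) \<inter> space lborel = A" using inj by (simp add: inj_vimage_image_eq)
    also have "emeasure lborel A = ennreal (1 / \<bar>x\<bar>)"
      using that x by (intro lborel_fundamental_domain) auto
    finally show ?thesis by (simp add: measure_def)
  qed
  \<comment> \<open>One domain has to be exhibited: if there were none, the condition in
    \<open>covolume\<close> would hold for every c.\<close>
  have ex: "\<forall>t. \<exists>!k::int. t - of_int k * (1 / \<bar>x\<bar>) \<in> {0..<1 / \<bar>x\<bar>}"
  proof
    fix t
    have "t - of_int k * (1 / \<bar>x\<bar>) \<in> {0..<1 / \<bar>x\<bar>} \<longleftrightarrow> k = \<lfloor>t / (1 / \<bar>x\<bar>)\<rfloor>" for k :: int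
      using x floor_divide_unique[of "1 / \<bar>x\<bar>" k t] by (auto simp: add_divide_distrib)
    then show "\<exists>!k::int. t - of_int k * (1 / \<bar>x\<bar>) \<in> {0..<1 / \<bar>x\<bar>}" by simp
  qed
  show ?thesis
    unfolding covolume_def range_scaleR_abs[of x]
  proof (rule the_equality, intro ballI impI)
    fix D assume "D \<in> sets ?\<mu>" and D: "\<forall>v\<in>space ?\<mu>. \<exists>!l. l \<in> ?\<Lambda> \<and> v - l \<in> D"
    then obtain A where A: "A \<in> sets lborel" "D = ?f ` A" using sets_embed_measure[OF inj] by auto
    show "measure ?\<mu> D = 1 / \<bar>x\<bar>" using meas[OF A(1) D[unfolded A(2) dom]] A(2) by simp
  next
    fix c assume c: "\<forall>D\<in>sets ?\<mu>. (\<forall>v\<in>space ?\<mu>. \<exists>!l. l \<in> ?\<Lambda> \<and> v - l \<in> D) \<longrightarrow> measure ?\<mu> D = c"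
    let ?D = "{0..<1 / \<bar>x\<bar>}"
    have "?f ` ?D \<in> sets ?\<mu>" by (intro in_sets_embed_measure) simp
    then have "measure ?\<mu> (?f ` ?D) = c" by (rule c[rule_format, OF _ dom[THEN iffD2, OF ex, rule_format]])
    then show "c = 1 / \<bar>x\<bar>" using meas[OF _ ex] by simp
  qed
qed

lemma weight_M0_eq:
  fixes B :: "'q::finite_field functional \<Rightarrow> 'q functional \<Rightarrow> real"
  assumes B: "weyl_inner_product B"
    and g: "H_P N_upper g = vec_M0 p r" "H_P N_lower g = vec_M0 p' r'" "p + r = p' + r'"
  shows "weight_M0 B g = covol_M0 B * \<bar>p - p'\<bar>"
proof -
  obtain x where x: "x \<noteq> 0" and vol: "vol_M0 B = embed_measure lborel (\<lambda>t. t *\<^sub>R vec_M0 x (- x))"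
    using vol_M0_eq[OF B] .
  define e where "e = (vec_M0 x (- x) :: 'q functional)"
  have e: "e \<noteq> 0" using x vec_eq_iffs(2)[of x "- x" 0 0] by (auto simp: e_def vec_M0_def)
  have inj: "inj (\<lambda>t. t *\<^sub>R e)" using e by (auto simp: inj_def)
  have be: "vec_M0 y (- y) = (y / x) *\<^sub>R e" for y using x by (simp add: e_def vec_linear)
  have "covol_M0 B = covolume (embed_measure lborel (\<lambda>t. t *\<^sub>R e)) (range (\<lambda>k::int. (of_int k / x) *\<^sub>R e))"
    unfolding covol_M0_def cochars_M0_SL3 vol e_def[symmetric] by (simp only: be)
  then have covol: "covol_M0 B = 1 / \<bar>x\<bar>" using covolume_line[OF e x] by simp
  \<comment> \<open>\<open>s\<close> is the first coordinate of the a_G component. Both ends of the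
    segment have the same coordinate sum, so \<open>s\<close> is common to all its points and the
    projection is a translation in the first coordinate.\<close>
  define s where "s = (p + r) / 3"
  have "proj_G M0 ((1 - u) *\<^sub>R vec_M0 p r + u *\<^sub>R vec_M0 p' r') = (((1 - u) * (p - s) + u * (p' - s)) / x) *\<^sub>R e" for u
  proof -
    let ?p = "(1 - u) * p + u * p'" and ?r = "(1 - u) * r + u * r'"
    have "?p + ?r = (1 - u) * (p + r) + u * (p' + r')" by (simp add: algebra_simps)
    also have "\<dots> = p + r" unfolding g(3)[symmetric] by (simp add: algebra_simps)
    finally have "(?p + ?r) / 3 = s" by (simp add: s_def)
    then have "proj_G M0 (vec_M0 ?p ?r) = vec_M0 (?p - s) (- (?p - s))"
      unfolding proj_G_M0 by (simp only:)
    moreover have "?p - s = (1 - u) * (p - s) + u * (p' - s)" by (simp add: algebra_simps)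
    ultimately show ?thesis by (simp only: vec_linear be[symmetric])
  qed
  then have "proj_G M0 ` closed_segment (vec_M0 p r) (vec_M0 p' r')
      = (\<lambda>t. t *\<^sub>R e) ` closed_segment ((p - s) / x) ((p' - s) / x)"
    by (force simp: closed_segment_def image_iff add_divide_distrib)
  then have img: "proj_G M0 ` (convex hull {H_P N_upper g, H_P N_lower g})
      = (\<lambda>t. t *\<^sub>R e) ` closed_segment ((p - s) / x) ((p' - s) / x)"
    by (simp add: g segment_convex_hull)
  have "emeasure (vol_M0 B) ((\<lambda>t. t *\<^sub>R e) ` closed_segment ((p - s) / x) ((p' - s) / x))
     = emeasure lborel ((\<lambda>t. t *\<^sub>R e) -` ((\<lambda>t. t *\<^sub>R e) ` closed_segment ((p - s) / x) ((p' - s) / x)) \<inter> space lborel)"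
    unfolding vol e_def[symmetric] using inj
    by (intro emeasure_embed_measure in_sets_embed_measure) auto
  also have "\<dots> = emeasure lborel (closed_segment ((p - s) / x) ((p' - s) / x))"
    using inj by (simp add: inj_vimage_image_eq)
  also have "\<dots> = ennreal \<bar>(p - s) / x - (p' - s) / x\<bar>"
    by (simp add: closed_segment_eq_real_ivl)
  also have "(p - s) / x - (p' - s) / x = (p - p') / x" by (simp add: diff_divide_distrib)
  finally show ?thesis
    unfolding weight_M0_def img by (simp add: measure_def covol)
qed

section \<open>Valuations and the Iwasawa decomposition\<close>

text \<open>Valuation at least k with the valuation of 0 infinite, whereas
  \<open>fls_subdegree 0\<close> is 0.\<close>

definition val_ge :: "int \<Rightarrow> 'q::field fls \<Rightarrow> bool" where
  "val_ge k f \<longleftrightarrow> f = 0 \<or> k \<le> ord f"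

lemma val_ge_nth: "val_ge k f \<longleftrightarrow> (\<forall>i<k. fls_nth f i = 0)"
proof
  assume "val_ge k f" then show "\<forall>i<k. fls_nth f i = 0" by (auto simp: val_ge_def)
next
  assume "\<forall>i<k. fls_nth f i = 0" then show "val_ge k f"
    unfolding val_ge_def using fls_subdegree_geI by blast
qed

lemma val_ge_zero [simp]: "val_ge k 0" by (simp add: val_ge_def)
lemma val_ge_one [simp]: "val_ge k 1 \<longleftrightarrow> k \<le> 0" by (simp add: val_ge_def)
lemma val_ge_X [simp]: "val_ge k fls_X \<longleftrightarrow> k \<le> 1" by (simp add: val_ge_def)
lemma val_ge_add: "val_ge k f \<Longrightarrow> val_ge k g \<Longrightarrow> val_ge k (f + g)" by (simp add: val_ge_nth)
lemma val_ge_diff: "val_ge k f \<Longrightarrow> val_ge k g \<Longrightarrow> val_ge k (f - g)" by (simp add: val_ge_nth)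
lemma val_ge_uminus [simp]: "val_ge k (- f) \<longleftrightarrow> val_ge k f" by (simp add: val_ge_nth)
lemma val_ge_mono: "val_ge k f \<Longrightarrow> l \<le> k \<Longrightarrow> val_ge l f" by (auto simp: val_ge_def)

lemma val_ge_mult: "val_ge j f \<Longrightarrow> val_ge k g \<Longrightarrow> val_ge (j + k) (f * g)"
  by (cases "f = 0"; cases "g = 0") (auto simp: val_ge_def)

lemma val_ge_mult0: "val_ge 0 f \<Longrightarrow> val_ge k g \<Longrightarrow> val_ge k (f * g)"
  using val_ge_mult[of 0 f k g] by simp

lemma val_ge_mult_left:
  assumes "c \<noteq> 0"
  shows "val_ge k (c * f) \<longleftrightarrow> val_ge (k - ord c) f"
  using assms by (cases "f = 0") (auto simp: val_ge_def)

lemma val_ge_mult_right: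
  assumes "c \<noteq> 0"
  shows "val_ge k (f * c) \<longleftrightarrow> val_ge (k - ord c) f"
  using assms by (cases "f = 0") (auto simp: val_ge_def)

lemma val_ge_divide:
  assumes "c \<noteq> 0"
  shows "val_ge k (f / c) \<longleftrightarrow> val_ge (k + ord c) f"
  using assms by (cases "f = 0") (auto simp: val_ge_def fls_divide_subdegree)

lemma val_ge_fps [simp]: "val_ge 0 (fps_to_fls f)"
  by (simp add: val_ge_def fls_subdegree_fls_to_fps)

lemma range_fps_to_fls: "f \<in> range fps_to_fls \<longleftrightarrow> val_ge 0 f"
proof
  assume "val_ge 0 f"
  then have "ord f \<ge> 0" by (auto simp: val_ge_def)
  then have "fps_to_fls (fls_regpart f) = f" by simp
  then show "f \<in> range fps_to_fls" by (metis rangeI)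
qed auto

lemma val_ge_0E:
  assumes "val_ge 0 f" obtains p where "f = fps_to_fls p"
  using assms range_fps_to_fls[of f] by blast

definition ep :: "int \<Rightarrow> 'q::field fls" where "ep k = fls_X_intpow k"

lemma ep_nonzero [simp]: "ep k \<noteq> 0" by (simp add: ep_def)
lemma ep_subdegree [simp]: "ord (ep k) = k" by (simp add: ep_def)
lemma ep_mult: "ep j * ep k = ep (j + k)" by (simp add: ep_def fls_X_intpow_times_fls_X_intpow)
lemma ep_0 [simp]: "ep 0 = 1" by (simp add: ep_def)

lemma gl3_O_iff: "g \<in> gl3_O \<longleftrightarrow> (\<forall>i j. val_ge 0 (g$i$j))"
  by (simp add: gl3_O_def range_fps_to_fls)

lemma gl3_O_mat3: "mat3 a b c d e f g h i \<in> gl3_O \<longleftrightarrow>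
    val_ge 0 a \<and> val_ge 0 b \<and> val_ge 0 c \<and> val_ge 0 d \<and> val_ge 0 e \<and> val_ge 0 f \<and>
    val_ge 0 g \<and> val_ge 0 h \<and> val_ge 0 i"
  by (auto simp: gl3_O_iff forall_3)

lemma gl3_O_mult: "g \<in> gl3_O \<Longrightarrow> h \<in> gl3_O \<Longrightarrow> g ** h \<in> gl3_O"
  by (auto simp: gl3_O_iff matrix_matrix_mult_def sum_3 intro!: val_ge_add val_ge_mult0)

lemma gl3_O_det: "g \<in> gl3_O \<Longrightarrow> val_ge 0 (det g)"
  by (cases g rule: mat3_cases) (auto simp: gl3_O_mat3 intro!: val_ge_add val_ge_diff val_ge_mult0)

text \<open>If g and its inverse are integral, both determinants have nonnegative valuation.
  Conversely, by Cramer's rule the inverse is the adjugate divided by the determinant.\<close>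

lemma GL3_O_iff:
  fixes g :: "'q::field fls^3^3"
  shows "g \<in> GL3_O \<longleftrightarrow> g \<in> gl3_O \<and> det g \<noteq> 0 \<and> ord (det g) = 0"
proof
  assume g: "g \<in> GL3_O"
  then have *: "g \<in> GL3" "g \<in> gl3_O" "matrix_inv g \<in> gl3_O" by (auto simp: GL3_O_def)
  then have d: "det g \<noteq> 0" by (simp add: GL3_iff)
  have "ord (det g) \<ge> 0" using gl3_O_det[OF *(2)] d by (simp add: val_ge_def)
  moreover have "- ord (det g) \<ge> 0"
    using gl3_O_det[OF *(3)] d by (simp add: val_ge_def det_matrix_inv[OF *(1)])
  ultimately show "g \<in> gl3_O \<and> det g \<noteq> 0 \<and> ord (det g) = 0"
    using d * by simp
next
  assume *: "g \<in> gl3_O \<and> det g \<noteq> 0 \<and> ord (det g) = 0"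
  obtain a b c d e f p h i where g: "g = mat3 a b c d e f p h i" by (rule mat3_cases)
  define D where "D = det g"
  have D: "D \<noteq> 0" "val_ge 0 (inverse D)" using * by (auto simp: D_def val_ge_def)
  have v: "val_ge 0 a" "val_ge 0 b" "val_ge 0 c" "val_ge 0 d" "val_ge 0 e" "val_ge 0 f"
    "val_ge 0 p" "val_ge 0 h" "val_ge 0 i" using * by (auto simp: g gl3_O_mat3)
  define I where "I = inverse D"
  have I: "I * (a*(e*i - f*h) - b*(d*i - f*p) + c*(d*h - e*p)) = 1"
    using D by (simp add: I_def D_def g)
  let ?h = "mat3 ((e*i-f*h)*I) ((c*h-b*i)*I) ((b*f-c*e)*I)
      ((f*p-d*i)*I) ((a*i-c*p)*I) ((c*d-a*f)*I)
      ((d*h-e*p)*I) ((b*p-a*h)*I) ((a*e-b*d)*I)"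
  have "g ** ?h = mat 1"
    unfolding g mat_one_mat3 mat3_mult mat3_eq_iff by (intro conjI; (rule trans[OF _ I])?; simp add: algebra_simps)
  then have "matrix_inv g = ?h" by (rule matrix_inv_unique)
  moreover have "?h \<in> gl3_O"
    unfolding gl3_O_mat3 using v D(2) unfolding I_def[symmetric] by (intro conjI val_ge_mult0 val_ge_diff)
  ultimately show "g \<in> GL3_O" using * by (simp add: GL3_O_def GL3_iff)
qed

lemma GL3_O_subset: "GL3_O \<subseteq> GL3" "GL3_O \<subseteq> gl3_O"
  by (auto simp: GL3_O_def)

lemma GL3_O_mult: "g \<in> GL3_O \<Longrightarrow> h \<in> GL3_O \<Longrightarrow> g ** h \<in> GL3_O"
  by (auto simp: GL3_O_iff gl3_O_mult det_mul)

lemma GL3_O_inv: "g \<in> GL3_O \<Longrightarrow> matrix_inv g \<in> GL3_O"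
  by (auto simp: GL3_O_def matrix_inv_in_GL3 matrix_inv_inv)

lemma GL3_O_one: "mat 1 \<in> (GL3_O :: ('q::field fls^3^3) set)"
  by (simp add: mat_one_mat3 GL3_O_iff gl3_O_mat3)

section \<open>Duality by the inverse transpose\<close>

lemma transpose_mat3: "transpose (mat3 a b c d e f g h i) = mat3 a d g b e h c f i"
  by (simp add: vec_eq_iff forall_3 transpose_def)

text \<open>The inverse transpose exchanges \<open>N_upper\<close> and \<open>N_lower\<close>,
  preserves \<open>M0\<close> and \<open>GL3_O\<close>, and inverts the first entry on
  \<open>M0\<close>. It carries statements about one parabolic subgroup to the other.\<close>

definition dual :: "'k::field^3^3 \<Rightarrow> 'k^3^3" where
  "dual g = transpose (matrix_inv g)"

lemma dual_in_GL3: "g \<in> GL3 \<Longrightarrow> dual g \<in> GL3"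
  using matrix_inv_in_GL3[of g] by (simp add: dual_def GL3_iff)

lemma dual_mult: "g \<in> GL3 \<Longrightarrow> h \<in> GL3 \<Longrightarrow> dual (g ** h) = dual g ** dual h"
  by (simp add: dual_def matrix_inv_mult matrix_transpose_mul)

lemma dual_dual:
  assumes "g \<in> GL3" shows "dual (dual g) = g"
proof -
  have "transpose (matrix_inv g) ** transpose g = mat 1"
    by (simp add: matrix_transpose_mul[symmetric] matrix_inv_GL3[OF assms])
  then have "matrix_inv (transpose (matrix_inv g)) = transpose g" by (rule matrix_inv_unique)
  then show ?thesis by (simp add: dual_def)
qed

lemma dual_eqI: "g ** transpose h = mat 1 \<Longrightarrow> dual g = h"
  by (metis dual_def matrix_inv_unique transpose_transpose)

lemma det_dual: "g \<in> GL3 \<Longrightarrow> det (dual g) = inverse (det g)"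
  by (simp add: dual_def det_matrix_inv)

lemma dual_GL3_O:
  fixes g :: "'q::field fls^3^3"
  assumes "g \<in> GL3_O" shows "dual g \<in> GL3_O"
proof -
  have "g \<in> GL3" "matrix_inv g \<in> gl3_O" using assms by (auto simp: GL3_O_def)
  then have "dual g \<in> gl3_O" by (simp add: dual_def gl3_O_iff transpose_def)
  then show ?thesis using assms \<open>g \<in> GL3\<close> by (simp add: GL3_O_iff det_dual)
qed

lemma dual_M0:
  assumes "m \<in> M0" shows "dual m \<in> M0" "dual m $ 1 $ 1 = inverse (m $ 1 $ 1)"
proof -
  from assms obtain a e f h i where m: "m = mat3 a 0 0 0 e f 0 h i" and nz: "a \<noteq> 0" "e * i - f * h \<noteq> 0"
    by (rule M0_cases)
  define D where "D = inverse (e * i - f * h)"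
  have D: "D * (e * i - f * h) = 1" using nz by (simp add: D_def)
  have dm: "dual m = mat3 (inverse a) 0 0 0 (i * D) (- h * D) 0 (- f * D) (e * D)"
    by (rule dual_eqI) (use nz D in \<open>simp add: m transpose_mat3 mat_one_mat3, algebra\<close>)
  show "dual m $ 1 $ 1 = inverse (m $ 1 $ 1)" by (simp only: dm) (simp add: m)
  have "dual m \<in> GL3" using assms diag_torus_subset(2) dual_in_GL3 by blast
  then show "dual m \<in> M0" by (simp add: M0_def dm)
qed

lemma N_lower_iff: "n \<in> N_lower \<longleftrightarrow> (\<exists>x y. n = mat3 1 0 0 x 1 0 y 0 1)"
  by (simp add: N_lower_def mat3_def)

lemma N_upper_iff: "n \<in> N_upper \<longleftrightarrow> (\<exists>x y. n = mat3 1 x y 0 1 0 0 0 1)"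
  by (simp add: N_upper_def mat3_def)

lemma dual_N: "n \<in> N_upper \<Longrightarrow> dual n \<in> N_lower" "n \<in> N_lower \<Longrightarrow> dual n \<in> N_upper"
proof -
  have "dual (mat3 1 x y 0 1 0 0 0 1) = mat3 1 0 0 (- x) 1 0 (- y) 0 1" for x y :: 'a
    by (rule dual_eqI) (simp add: transpose_mat3 mat_one_mat3)
  then show "n \<in> N_upper \<Longrightarrow> dual n \<in> N_lower" by (auto simp: N_upper_iff N_lower_iff)
  have "dual (mat3 1 0 0 x 1 0 y 0 1) = mat3 1 (- x) (- y) 0 1 0 0 0 1" for x y :: 'a
    by (rule dual_eqI) (simp add: transpose_mat3 mat_one_mat3)
  then show "n \<in> N_lower \<Longrightarrow> dual n \<in> N_upper" by (auto simp: N_upper_iff N_lower_iff)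
qed

lemma N_GL3: "n \<in> N_upper \<Longrightarrow> n \<in> GL3" "n \<in> N_lower \<Longrightarrow> n \<in> GL3"
  "n \<in> N_upper \<Longrightarrow> det n = 1" "n \<in> N_lower \<Longrightarrow> det n = 1"
  by (auto simp: N_upper_iff N_lower_iff GL3_iff)

section \<open>Valuations of the first row and the Iwasawa decomposition\<close>

definition vmin :: "'q::field fls^3 \<Rightarrow> int" where
  "vmin v = Min ((\<lambda>j. ord (v$j)) ` {j. v$j \<noteq> 0})"

text \<open>The valuation of the projection of the lattice g O^3 to the first coordinate.\<close>

definition rowv :: "'q::field fls^3^3 \<Rightarrow> int" where "rowv g = vmin (g$1)"

text \<open>The first row of \<open>dual g\<close> is the first column of the inverse of g, so
  \<open>- colv g\<close> is the valuation of the intersection of g O^3 with the first coordinate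
  axis.\<close>

definition colv :: "'q::field fls^3^3 \<Rightarrow> int" where "colv g = rowv (dual g)"

lemma row_nonzero:
  assumes "g \<in> GL3" shows "\<exists>j. g$1$j \<noteq> 0"
proof (rule ccontr)
  assume "\<not> ?thesis"
  then have "det g = 0" by (cases g rule: mat3_cases) (simp add: forall_3)
  then show False using assms by (simp add: GL3_iff)
qed

lemma rowv_le_iff:
  assumes "g \<in> GL3"
  shows "k \<le> rowv g \<longleftrightarrow> (\<forall>j. val_ge k (g$1$j))"
proof -
  have "k \<le> rowv g \<longleftrightarrow> (\<forall>j. g$1$j \<noteq> 0 \<longrightarrow> k \<le> ord (g$1$j))"
    unfolding rowv_def vmin_def using row_nonzero[OF assms] by (subst Min_ge_iff) auto
  then show ?thesis by (auto simp: val_ge_def)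
qed

lemma rowv_attained:
  assumes "g \<in> GL3"
  shows "\<exists>j. g$1$j \<noteq> 0 \<and> ord (g$1$j) = rowv g"
proof -
  have "rowv g \<in> (\<lambda>j. ord (g$1$j)) ` {j. g$1$j \<noteq> 0}"
    unfolding rowv_def vmin_def using row_nonzero[OF assms] by (intro Min_in) auto
  then show ?thesis by auto
qed

lemma rowv_right_le:
  assumes "g \<in> GL3" "k \<in> GL3_O"
  shows "rowv g \<le> rowv (g ** k)"
proof -
  have "val_ge (rowv g) (g$1$j)" for j using rowv_le_iff[OF assms(1)] by blast
  moreover have "val_ge 0 (k$i$j)" for i j using assms(2) by (simp add: GL3_O_iff gl3_O_iff)
  ultimately have "val_ge (rowv g) (g$1$i * k$i$j)" for i j
    by (metis val_ge_mult add.right_neutral)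
  then have "val_ge (rowv g) ((g ** k)$1$j)" for j
    by (auto simp: matrix_matrix_mult_def sum_3 intro!: val_ge_add)
  then show ?thesis
    using rowv_le_iff[of "g ** k"] GL3_mult assms GL3_O_subset by blast
qed

lemma rowv_right:
  fixes g :: "'q::field fls^3^3"
  assumes "g \<in> GL3" "k \<in> GL3_O"
  shows "rowv (g ** k) = rowv g"
proof -
  have k: "k \<in> GL3" using assms GL3_O_subset by blast
  have "g ** k ** matrix_inv k = g"
    by (simp add: matrix_mul_assoc[symmetric] matrix_inv_GL3[OF k])
  then have "rowv (g ** k) \<le> rowv g"
    using rowv_right_le[OF GL3_mult[OF assms(1) k] GL3_O_inv[OF assms(2)]] by simp
  then show ?thesis using rowv_right_le[OF assms] by simp
qed

lemma rowv_left:
  fixes g :: "'q::field fls^3^3"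
  assumes "g \<in> GL3" "m \<in> GL3" "m$1$1 \<noteq> 0" "m$1$2 = 0" "m$1$3 = 0"
  shows "rowv (m ** g) = ord (m$1$1) + rowv g"
proof -
  have "(m ** g)$1$j = m$1$1 * g$1$j" for j
    using assms by (simp add: matrix_matrix_mult_def sum_3)
  then have *: "k \<le> rowv (m ** g) \<longleftrightarrow> k - ord (m$1$1) \<le> rowv g" for k
    using assms by (simp add: rowv_le_iff GL3_mult val_ge_mult_left)
  from *[of "rowv (m ** g)"] *[of "ord (m$1$1) + rowv g"] show ?thesis by simp
qed

lemma rowv_one: "rowv (mat 1 :: 'q::field fls^3^3) = 0"
proof -
  have "(mat 1 :: 'q fls^3^3) \<in> GL3" by (simp add: GL3_iff)
  from rowv_le_iff[OF this] have "k \<le> rowv (mat 1 :: 'q fls^3^3) \<longleftrightarrow> k \<le> 0" for k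
    by (auto simp: mat_one_mat3 forall_3)
  from this[of 0] this[of "rowv (mat 1 :: 'q fls^3^3)"] show ?thesis by simp
qed

lemma colv_right:
  assumes "g \<in> GL3" "k \<in> GL3_O"
  shows "colv (g ** k) = colv g"
  using assms GL3_O_subset by (auto simp: colv_def dual_mult dual_in_GL3 dual_GL3_O rowv_right subset_iff)

lemma colv_left:
  assumes "g \<in> GL3" "m \<in> M0"
  shows "colv (m ** g) = colv g - ord (m$1$1)"
proof -
  have "m \<in> GL3" using assms diag_torus_subset by blast
  have "dual m \<in> M0" "dual m $ 1 $ 1 = inverse (m$1$1)" using dual_M0[OF assms(2)] by auto
  moreover from this have "dual m \<in> GL3" "dual m$1$1 \<noteq> 0" "dual m$1$2 = 0" "dual m$1$3 = 0"
    using M0_nonzero[OF \<open>dual m \<in> M0\<close>] by (auto simp: M0_def)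
  ultimately show ?thesis
    using assms \<open>m \<in> GL3\<close> by (simp add: colv_def dual_mult rowv_left dual_in_GL3)
qed

text \<open>The entry of least valuation is the pivot: the quotients of the row by it are integral,
  so the column operations lie in \<open>GL3_O\<close>. The three matrices also move the pivot to
  the first position.\<close>

lemma row_reduction:
  fixes g :: "'q::field fls^3^3"
  assumes "g \<in> GL3"
  shows "\<exists>k\<in>GL3_O. (g ** k)$1$2 = 0 \<and> (g ** k)$1$3 = 0"
proof -
  obtain x y z where row: "g$1$1 = x" "g$1$2 = y" "g$1$3 = z" by blast
  obtain j where j: "g$1$j \<noteq> 0" "ord (g$1$j) = rowv g" using rowv_attained[OF assms] by blast
  have all: "val_ge (rowv g) (g$1$i)" for i using rowv_le_iff[OF assms] by blast
  have q: "val_ge 0 (g$1$i / g$1$j)" for i using all j by (simp add: val_ge_divide)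
  consider "j = 1" | "j = 2" | "j = 3" using exhaust_3 by blast
  then show ?thesis
  proof cases
    case 1
    have "mat3 1 (- y / x) (- z / x) 0 1 0 0 0 1 \<in> GL3_O"
      using q[of 2] q[of 3] by (simp add: 1 row GL3_O_iff gl3_O_mat3)
    then show ?thesis
      using j(1) by (rule_tac bexI) (auto simp: 1 row matrix_matrix_mult_def sum_3)
  next
    case 2
    have "mat3 0 1 0 1 (- x / y) (- z / y) 0 0 1 \<in> GL3_O"
      using q[of 1] q[of 3] by (simp add: 2 row GL3_O_iff gl3_O_mat3)
    then show ?thesis
      using j(1) by (rule_tac bexI) (auto simp: 2 row matrix_matrix_mult_def sum_3)
  next
    case 3
    have "mat3 0 1 0 0 0 1 1 (- x / z) (- y / z) \<in> GL3_O"
      using q[of 1] q[of 2] by (simp add: 3 row GL3_O_iff gl3_O_mat3)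
    then show ?thesis
      using j(1) by (rule_tac bexI) (auto simp: 3 row matrix_matrix_mult_def sum_3)
  qed
qed

lemma iwasawa_lower:
  fixes g :: "'q::field fls^3^3"
  assumes "g \<in> GL3"
  obtains n m k where "n \<in> N_lower" "m \<in> M0" "k \<in> GL3_O" "g = n ** m ** k"
proof -
  obtain k where k: "k \<in> GL3_O" "(g ** k)$1$2 = 0" "(g ** k)$1$3 = 0"
    using row_reduction[OF assms] by blast
  then have kG: "k \<in> GL3" using GL3_O_subset by blast
  obtain a b c d e f p h i where gk: "g ** k = mat3 a b c d e f p h i" by (rule mat3_cases)
  have bc: "b = 0" "c = 0" using k gk by simp_all
  have det: "a * (e * i - f * h) \<noteq> 0"
    using GL3_mult[OF assms kG] by (simp add: GL3_iff gk bc)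
  let ?n = "mat3 1 0 0 (d / a) 1 0 (p / a) 0 1" and ?m = "mat3 a 0 0 0 e f 0 h i"
  have nm: "g ** k = ?n ** ?m" using det by (simp add: gk bc)
  have "g = g ** (k ** matrix_inv k)" by (simp add: matrix_inv_GL3[OF kG])
  also have "\<dots> = ?n ** ?m ** matrix_inv k" by (simp add: matrix_mul_assoc nm del: mat3_mult)
  finally have "g = ?n ** ?m ** matrix_inv k" .
  moreover have "?n \<in> N_lower" by (auto simp: N_lower_iff)
  moreover have "?m \<in> M0" using det by (simp add: M0_iff)
  ultimately show ?thesis using that GL3_O_inv[OF k(1)] by blast
qed

text \<open>Left multiplication by \<open>N_lower\<close> and right multiplication by
  \<open>GL3_O\<close> change neither \<open>rowv\<close> nor the valuation of the determinant, so
  both can be computed on m. This makes the valuations of m independent of the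
  decomposition.\<close>

lemma lower_decomposition:
  fixes g :: "'q::finite_field fls^3^3"
  assumes "n \<in> N_lower" "m \<in> M0" "k \<in> GL3_O" "g = n ** m ** k"
  shows "ord (m$1$1) = rowv g" "ord (det2 m) = ord (det g) - rowv g"
proof -
  note * = assms
  have G: "n \<in> GL3" "m \<in> GL3" using * N_GL3 diag_torus_subset by blast+
  have "rowv g = rowv (n ** m)" using * G by (simp add: rowv_right GL3_mult)
  also have "\<dots> = rowv m" using * G by (subst rowv_left) (auto simp: N_lower_iff)
  also have "\<dots> = rowv (m ** mat 1)" by simp
  also have "\<dots> = ord (m$1$1)"
    using *(2) G M0_nonzero[OF *(2)] by (subst rowv_left) (auto simp: M0_def rowv_one GL3_iff)
  finally show r: "ord (m$1$1) = rowv g" ..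
  have "det g = det m * det k" using * N_GL3(4)[OF *(1)] by (simp add: det_mul)
  then have "ord (det g) = ord (det m)"
    using *(3) G by (simp add: GL3_O_iff GL3_iff)
  also have "\<dots> = rowv g + ord (det2 m)"
    using M0_nonzero[OF *(2)] by (simp add: det_M0[OF *(2)] r)
  finally show "ord (det2 m) = ord (det g) - rowv g" by simp
qed

lemma dual_decomposition:
  fixes g :: "'q::finite_field fls^3^3"
  assumes "n \<in> GL3" "m \<in> M0" "k \<in> GL3_O" "g = n ** m ** k"
  shows "dual g = dual n ** dual m ** dual k"
proof -
  have "m \<in> GL3" "k \<in> GL3" using assms diag_torus_subset(2) GL3_O_subset(1) by blast+
  then show ?thesis using assms by (simp add: dual_mult GL3_mult)
qed

lemma iwasawa_upper:
  fixes g :: "'q::finite_field fls^3^3"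
  assumes "g \<in> GL3"
  obtains n m k where "n \<in> N_upper" "m \<in> M0" "k \<in> GL3_O" "g = n ** m ** k"
proof -
  obtain n m k where *: "n \<in> N_lower" "m \<in> M0" "k \<in> GL3_O" "dual g = n ** m ** k"
    using iwasawa_lower[OF dual_in_GL3[OF assms]] .
  have "g = dual n ** dual m ** dual k"
    using dual_decomposition[OF N_GL3(2)[OF *(1)] *(2-4)] by (simp add: dual_dual assms)
  then show ?thesis using that dual_N(2) dual_M0(1) dual_GL3_O * by metis
qed

lemma upper_decomposition:
  fixes g :: "'q::finite_field fls^3^3"
  assumes "n \<in> N_upper" "m \<in> M0" "k \<in> GL3_O" "g = n ** m ** k"
  shows "ord (m$1$1) = - colv g" "ord (det2 m) = ord (det g) + colv g"
proof -
  have m: "m \<in> GL3" using assms diag_torus_subset by blast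
  have "ord (dual m $ 1 $ 1) = rowv (dual g)"
    by (rule lower_decomposition(1)[OF dual_N(1) dual_M0(1) dual_GL3_O dual_decomposition])
       (use assms N_GL3 in auto)
  then show r: "ord (m$1$1) = - colv g"
    using M0_nonzero[OF assms(2)] by (simp add: colv_def dual_M0[OF assms(2)])
  have "det g = det m * det k" using N_GL3(3)[OF assms(1)] assms(4) by (simp add: det_mul)
  then have "ord (det g) = ord (det m)"
    using assms(3) m by (simp add: GL3_O_iff GL3_iff)
  also have "\<dots> = - colv g + ord (det2 m)"
    using M0_nonzero[OF assms(2)] by (simp add: det_M0[OF assms(2)] r)
  finally show "ord (det2 m) = ord (det g) + colv g" by simp
qed

text \<open>\<open>ex\<close> makes the point in the definition of \<open>H_P\<close> unique, and
  \<open>val\<close> makes one point work for all decompositions.\<close>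

lemma H_P_eqI:
  fixes g :: "'q::finite_field fls^3^3"
  assumes ex: "\<exists>n\<in>N. \<exists>m\<in>M0. \<exists>k\<in>GL3_O. g = n ** m ** k"
    and val: "\<And>n m k. n \<in> N \<Longrightarrow> m \<in> M0 \<Longrightarrow> k \<in> GL3_O \<Longrightarrow> g = n ** m ** k \<Longrightarrow>
      ord (m$1$1) = i \<and> ord (det2 m) = j"
  shows "H_P N g = vec_M0 (of_int i) (of_int j)"
  unfolding H_P_def
proof (rule the_equality)
  show "vec_M0 (of_int i) (of_int j) \<in> aspace M0 \<and>
     (\<forall>n\<in>N. \<forall>m\<in>M0. \<forall>k\<in>GL3_O. g = n ** m ** k \<longrightarrow>
        (\<forall>\<phi>\<in>chars M0. vec_M0 (of_int i) (of_int j) \<phi> = real_of_int (ord (\<phi> m))))"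
  proof (intro conjI ballI impI vec_aspace)
    fix n m k :: "'q fls^3^3" and \<phi> :: "'q fls^3^3 \<Rightarrow> 'q fls"
    assume *: "n \<in> N" "m \<in> M0" "k \<in> GL3_O" "g = n ** m ** k" "\<phi> \<in> chars M0"
    have "vec_M0 (of_int i) (of_int j) = val_at M0 m"
      using val[OF *(1-4)] by (simp add: val_at_M0[OF *(2)])
    then show "vec_M0 (of_int i) (of_int j) \<phi> = real_of_int (ord (\<phi> m))"
      using *(5) by (simp add: val_at_def)
  qed
next
  fix v :: "'q functional"
  assume v: "v \<in> aspace M0 \<and> (\<forall>n\<in>N. \<forall>m\<in>M0. \<forall>k\<in>GL3_O. g = n ** m ** k \<longrightarrow>
        (\<forall>\<phi>\<in>chars M0. v \<phi> = real_of_int (ord (\<phi> m))))"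
  obtain n m k where *: "n \<in> N" "m \<in> M0" "k \<in> GL3_O" "g = n ** m ** k" using ex by blast
  have "v \<phi> = val_at M0 m \<phi>" for \<phi>
    using v * aspace_support[of v M0 \<phi>] by (auto simp: val_at_def)
  then have "v = val_at M0 m" by blast
  then show "v = vec_M0 (of_int i) (of_int j)"
    using val[OF *] by (simp add: val_at_M0[OF *(2)])
qed

text \<open>Both points have the valuation of det g as coordinate sum, so only their first
  coordinates enter: the valuations of the intersection with F and of the projection to F.\<close>

lemma weight_M0_rowv_colv:
  fixes B :: "'q::finite_field functional \<Rightarrow> 'q functional \<Rightarrow> real"
  assumes B: "weyl_inner_product B" and g: "g \<in> GL3"
  shows "weight_M0 B g = covol_M0 B * \<bar>real_of_int (- colv g - rowv g)\<bar>"
proof -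
  have "H_P N_lower g = vec_M0 (of_int (rowv g)) (of_int (ord (det g) - rowv g))"
    by (rule H_P_eqI) (use iwasawa_lower[OF g] lower_decomposition in blast)+
  moreover have "H_P N_upper g = vec_M0 (of_int (- colv g)) (of_int (ord (det g) + colv g))"
    by (rule H_P_eqI) (use iwasawa_upper[OF g] upper_decomposition in blast)+
  ultimately show ?thesis
    using weight_M0_eq[OF B, of g] by simp
qed

section \<open>The torus and the quotient measure\<close>

lemma subdegree_diff_distinct:
  fixes A C :: "'q::field fls"
  assumes "A \<noteq> 0" "C \<noteq> 0" "ord A \<noteq> ord C"
  shows "A - C \<noteq> 0" "ord (A - C) = min (ord A) (ord C)"
proof -
  show "A - C \<noteq> 0" using assms by auto
  show "ord (A - C) = min (ord A) (ord C)"
    using assms fls_subdegree_diff_eq1[of A C] fls_subdegree_diff_eq2[of C A] by (cases "ord A < ord C") auto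
qed

text \<open>The two summands have valuations of different parity, so nothing cancels.\<close>

lemma norm_E2:
  fixes y z :: "'q::field fls"
  assumes "y \<noteq> 0 \<or> z \<noteq> 0"
  shows "y * y - z * (z * fls_X) \<noteq> 0"
    "2 * k \<le> ord (y * y - z * (z * fls_X)) \<longleftrightarrow> val_ge k y \<and> val_ge k z"
    "2 * k + 1 \<le> ord (y * y - z * (z * fls_X)) \<longleftrightarrow> val_ge (k + 1) y \<and> val_ge k z"
proof -
  let ?N = "y * y - z * (z * fls_X)"
  have "?N \<noteq> 0 \<and> (2 * k \<le> ord ?N \<longleftrightarrow> val_ge k y \<and> val_ge k z) \<and>
    (2 * k + 1 \<le> ord ?N \<longleftrightarrow> val_ge (k + 1) y \<and> val_ge k z)"
  proof (cases "y = 0 \<or> z = 0")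
    case True
    then show ?thesis using assms by (auto simp: val_ge_def)
  next
    case False
    then have s: "ord (y * y) = 2 * ord y"
      "ord (z * (z * fls_X)) = 2 * ord z + 1" by auto
    then have "ord (y * y) \<noteq> ord (z * (z * fls_X))" by presburger
    from subdegree_diff_distinct[OF _ _ this] False
    have "?N \<noteq> 0" "ord ?N = min (2 * ord y) (2 * ord z + 1)"
      by (auto simp: s)
    then show ?thesis using False by (auto simp: val_ge_def)
  qed
  then show "?N \<noteq> 0" "2 * k \<le> ord ?N \<longleftrightarrow> val_ge k y \<and> val_ge k z"
    "2 * k + 1 \<le> ord ?N \<longleftrightarrow> val_ge (k + 1) y \<and> val_ge k z" by auto
qed

text \<open>\<open>tmat x y z\<close> is the element \<open>(x, y + z \<epsilon>^(1/2))\<close> of \<open>F\<^sup>\<times> \<times> E_2\<^sup>\<times>\<close>, in the basis \<open>\<epsilon>^(1/2), 1\<close>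
  of \<open>E_2\<close>.\<close>

definition tmat :: "'q::field fls \<Rightarrow> 'q fls \<Rightarrow> 'q fls \<Rightarrow> 'q fls^3^3" where
  "tmat x y z = mat3 x 0 0 0 y z 0 (z * fls_X) y"

definition torus :: "('q::field fls^3^3) set" where
  "torus = {tmat x y z | x y z. x \<noteq> 0 \<and> (y \<noteq> 0 \<or> z \<noteq> 0)}"

lemma gamma_mat3: "gamma_elt a b =
    mat3 (fps_to_fls a) 0 0 0 0 (fps_to_fls b) 0 (fps_to_fls b * fls_X) 0"
  by (simp add: gamma_elt_def mat3_def)

lemma torus_M0: "torus \<subseteq> (M0 :: ('q::field fls^3^3) set)"
proof
  fix t :: "'q fls^3^3" assume "t \<in> torus"
  then obtain x y z where "t = tmat x y z" "x \<noteq> 0" "y \<noteq> 0 \<or> z \<noteq> 0" by (auto simp: torus_def)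
  then show "t \<in> M0" using norm_E2(1)[of y z] by (simp add: tmat_def M0_iff)
qed

lemma torus_GL3: "torus \<subseteq> GL3"
  using torus_M0 diag_torus_subset by blast

lemma tmat_in_torus: "x \<noteq> 0 \<Longrightarrow> y \<noteq> 0 \<or> z \<noteq> 0 \<Longrightarrow> tmat x y z \<in> torus"
  unfolding torus_def by blast

lemma torus_cases:
  assumes "t \<in> torus"
  obtains x y z where "t = tmat x y z" "x \<noteq> 0" "y \<noteq> 0 \<or> z \<noteq> 0"
  using assms unfolding torus_def by blast

lemma centralizer_gamma:
  fixes a b :: "'q::finite_field fps"
  assumes b: "b \<noteq> 0"
  shows "centralizer (gamma_elt a b) = torus"
proof (intro equalityI subsetI)
  fix t :: "'q fls^3^3" assume "t \<in> torus"
  then have "t \<in> GL3" "\<exists>x y z. t = tmat x y z" using torus_GL3 by (auto simp: torus_def)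
  then show "t \<in> centralizer (gamma_elt a b)"
    by (auto simp: centralizer_def gamma_mat3 tmat_def)
next
  fix t assume t: "t \<in> centralizer (gamma_elt a b)"
  define A where "A = fps_to_fls a"
  define \<beta> where "\<beta> = fps_to_fls b"
  have \<beta>: "\<beta> \<noteq> 0" using b by (simp add: \<beta>_def)
  obtain x p q r y z s w v where tm: "t = mat3 x p q r y z s w v" by (rule mat3_cases)
  have eqs: "q * (\<beta> * fls_X) = A * p" "p * \<beta> = A * q" "r * A = \<beta> * s" "s * A = \<beta> * fls_X * r"
    "z * (\<beta> * fls_X) = \<beta> * w" "y * \<beta> = \<beta> * v"
    using t by (simp_all add: centralizer_def gamma_mat3 tm A_def[symmetric] \<beta>_def[symmetric])
  \<comment> \<open>The scalar a is not an eigenvalue of the lower block: the characteristic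
    polynomial of the block takes at a the value of the norm of a - b eps^(1/2). This kills the
    off-diagonal blocks of t.\<close>
  have N: "A * A - \<beta> * (\<beta> * fls_X) \<noteq> 0" using \<beta> norm_E2(1) by blast
  have "p * (A * A - \<beta> * (\<beta> * fls_X)) = A * (A * p - q * (\<beta> * fls_X)) + \<beta> * fls_X * (A * q - p * \<beta>)"
    by (simp add: algebra_simps)
  then have p: "p = 0" using eqs N by simp
  have "r * (A * A - \<beta> * (\<beta> * fls_X)) = A * (r * A - \<beta> * s) + \<beta> * (s * A - \<beta> * fls_X * r)"
    by (simp add: algebra_simps)
  then have r: "r = 0" using eqs N by simp
  have "q = 0" "s = 0" "w = z * fls_X" "v = y" using eqs \<beta> p r by auto
  then have te: "t = tmat x y z" by (simp add: tm tmat_def p r)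
  have "det t \<noteq> 0" using t by (simp add: centralizer_def GL3_iff)
  then have "x \<noteq> 0" "y \<noteq> 0 \<or> z \<noteq> 0" by (auto simp: te tmat_def)
  then show "t \<in> torus" unfolding te by (rule tmat_in_torus)
qed

lemma torus_mult:
  assumes "s \<in> torus" "t \<in> torus" shows "s ** t \<in> torus"
proof -
  obtain x y z x' y' z' where st: "s = tmat x y z" "t = tmat x' y' z'" "x \<noteq> 0" "x' \<noteq> 0"
    using assms by (auto elim!: torus_cases)
  have m: "s ** t = tmat (x * x') (y * y' + z * (z' * fls_X)) (y * z' + z * y')"
    by (simp add: st tmat_def algebra_simps)
  have "s ** t \<in> GL3" using assms torus_GL3 GL3_mult by blast
  then have "det (s ** t) \<noteq> 0" by (simp add: GL3_iff)
  then have "y * y' + z * (z' * fls_X) \<noteq> 0 \<or> y * z' + z * y' \<noteq> 0"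
    unfolding m by (auto simp: tmat_def)
  then show ?thesis unfolding m using st by (intro tmat_in_torus) auto
qed

lemma torus_inv:
  assumes "t \<in> torus" shows "matrix_inv t \<in> torus"
proof -
  obtain x y z where t: "t = tmat x y z" "x \<noteq> 0" "y \<noteq> 0 \<or> z \<noteq> 0" using assms by (rule torus_cases)
  define N where "N = y * y - z * (z * fls_X)"
  have N: "N \<noteq> 0" using norm_E2(1)[OF t(3)] by (simp add: N_def)
  define I where "I = inverse N"
  have I: "I * (y * y - z * (z * fls_X)) = 1" using N by (simp add: I_def N_def)
  have I': "I * (y * y) = 1 + fls_X * (I * (z * z))" using I by (simp add: algebra_simps)
  \<comment> \<open>The inverse in E_2 is the conjugate y - z eps^(1/2) divided by the norm.\<close>
  have "t ** tmat (inverse x) (y * I) (- z * I) = mat 1"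
    unfolding t tmat_def mat_one_mat3 mat3_mult mat3_eq_iff
    using t(2) by (simp add: algebra_simps I')
  then have "matrix_inv t = tmat (inverse x) (y * I) (- z * I)" by (rule matrix_inv_unique)
  then show ?thesis using t(2,3) N by (auto simp: I_def intro!: tmat_in_torus)
qed

lemma torus_one: "mat 1 \<in> torus"
  using tmat_in_torus[of 1 1 0] by (simp add: tmat_def mat_one_mat3)

lemma unit_fps_iff:
  fixes x :: "'q::field fps"
  shows "x dvd 1 \<longleftrightarrow> fps_to_fls x \<noteq> 0 \<and> ord (fps_to_fls x) = 0"
proof -
  have "x dvd 1 \<longleftrightarrow> fps_nth x 0 \<noteq> 0" by (simp add: fps_is_unit_iff)
  also have "\<dots> \<longleftrightarrow> x \<noteq> 0 \<and> subdegree x = 0"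
    by (metis fps_nonzero_subdegree_nonzeroI nth_subdegree_zero_iff subdegree_eq_0_iff fps_zero_nth)
  finally show ?thesis unfolding fls_subdegree_fls_to_fps fps_to_fls_eq_0_iff of_nat_eq_0_iff .
qed

text \<open>An element of E_2 is a unit of its ring of integers iff its norm has valuation 0. Thus
  the compact subgroup is cut out by the two valuations that \<open>slice\<close>
  normalizes.\<close>

lemma T_compact_iff:
  fixes t :: "'q::finite_field fls^3^3"
  shows "t \<in> T_compact \<longleftrightarrow> t \<in> torus \<and> ord (t$1$1) = 0 \<and> ord (det t) = 0"
proof -
  have det: "ord (det (tmat x y z)) = ord x + ord (y * y - z * (z * fls_X))"
    if "x \<noteq> 0" "y \<noteq> 0 \<or> z \<noteq> 0" for x y z :: "'q fls"
    using that norm_E2(1)[OF that(2)] by (simp add: tmat_def)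
  have unit: "ord (y * y - z * (z * fls_X)) = 0 \<longleftrightarrow> y \<noteq> 0 \<and> ord y = 0 \<and> val_ge 0 z"
    if "y \<noteq> 0 \<or> z \<noteq> 0" for y z :: "'q fls"
    using norm_E2(2)[OF that, of 0] norm_E2(3)[OF that, of 0] by (auto simp: val_ge_def)
  let ?P = "\<lambda>x y z. t = tmat x y z \<and> x \<noteq> 0 \<and> ord x = 0 \<and>
      y \<noteq> 0 \<and> ord y = 0 \<and> val_ge 0 z"
  have "t \<in> T_compact \<longleftrightarrow> (\<exists>x y z. ?P x y z)"
  proof
    assume "t \<in> T_compact"
    then show "\<exists>x y z. ?P x y z"
      unfolding T_compact_def unit_fps_iff mat3_def[symmetric] tmat_def[symmetric] using val_ge_fps by blast
  next
    assume "\<exists>x y z. ?P x y z"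
    then obtain x y z where *: "?P x y z" by blast
    then have "val_ge 0 x" "val_ge 0 y" "val_ge 0 z" by (simp_all add: val_ge_def)
    then obtain x' y' z' where "x = fps_to_fls x'" "y = fps_to_fls y'" "z = fps_to_fls z'"
      by (metis val_ge_0E)
    then show "t \<in> T_compact"
      unfolding T_compact_def unit_fps_iff mat3_def[symmetric] tmat_def[symmetric] using * by blast
  qed
  also have "\<dots> \<longleftrightarrow> t \<in> torus \<and> ord (t$1$1) = 0 \<and> ord (det t) = 0" (is "_ \<longleftrightarrow> ?Q")
  proof
    assume "\<exists>x y z. ?P x y z"
    then obtain x y z where *: "?P x y z" by blast
    then have "ord (det t) = 0" using det[of x y z] unit[of y z] by simp
    moreover have "t$1$1 = x" using * by (simp add: tmat_def)
    ultimately show ?Q using * tmat_in_torus by metis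
  next
    assume *: ?Q
    then obtain x y z where t: "t = tmat x y z" "x \<noteq> 0" "y \<noteq> 0 \<or> z \<noteq> 0" by (blast elim: torus_cases)
    have "ord x = 0" using * by (simp add: t tmat_def)
    then show "\<exists>x y z. ?P x y z" using * t det[OF t(2,3)] unit[OF t(3)] by auto
  qed
  finally show ?thesis .
qed

text \<open>E_2 is ramified: powers of eps have norms of even valuation, and eps^(1/2) supplies the
  odd ones.\<close>

lemma torus_valuations_surj:
  "\<exists>t\<in>(torus :: ('q::field fls^3^3) set). ord (t$1$1) = i \<and> ord (det t) = j"
proof -
  let ?l = "j - i"
  have "\<exists>y z :: 'q fls. (y \<noteq> 0 \<or> z \<noteq> 0) \<and> ord (y * y - z * (z * fls_X)) = ?l"
  proof (cases "even ?l")
    case True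
    then show ?thesis by (intro exI[of _ "ep (?l div 2)"] exI[of _ 0]) (auto simp: ep_mult)
  next
    case False
    have "ord (0 * 0 - ep (?l div 2) * (ep (?l div 2) * fls_X) :: 'q fls) = 2 * (?l div 2) + 1"
      by simp
    also have "\<dots> = ?l" using False by presburger
    finally show ?thesis by (intro exI[of _ 0] exI[of _ "ep (?l div 2)"]) simp
  qed
  then obtain y z :: "'q fls" where yz: "y \<noteq> 0 \<or> z \<noteq> 0" "ord (y * y - z * (z * fls_X)) = ?l"
    by blast
  have "ord (det (tmat (ep i) y z)) = j" "tmat (ep i) y z $ 1 $ 1 = ep i"
    using yz norm_E2(1)[OF yz(1)] by (simp_all add: tmat_def)
  then show ?thesis using tmat_in_torus[of "ep i" y z] yz by (intro bexI[of _ "tmat (ep i) y z"]) auto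
qed

text \<open>A fundamental domain for \<open>T(F)\<close> modulo its maximal compact subgroup: integrating over it
  replaces the quotient measure, and no stabilizers of lattices occur.\<close>

definition slice :: "('q::field fls^3^3) set" where
  "slice = {g \<in> GL3. rowv g = 0 \<and> ord (det g) = 0}"

lemma torus_action:
  assumes t: "t \<in> torus" and g: "g \<in> GL3"
  shows "t ** g \<in> GL3" "rowv (t ** g) = ord (t$1$1) + rowv g"
    "ord (det (t ** g)) = ord (det t) + ord (det g)"
    "colv (t ** g) = colv g - ord (t$1$1)"
proof -
  have tG: "t \<in> GL3" "t \<in> M0" using t torus_GL3 torus_M0 by blast+
  show "t ** g \<in> GL3" using tG g GL3_mult by blast
  show "rowv (t ** g) = ord (t$1$1) + rowv g"
    using tG M0_nonzero[OF tG(2)] by (intro rowv_left[OF g]) (auto simp: M0_def)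
  show "ord (det (t ** g)) = ord (det t) + ord (det g)"
    using tG g by (simp add: det_mul GL3_iff)
  show "colv (t ** g) = colv g - ord (t$1$1)" using colv_left[OF g tG(2)] .
qed

text \<open>The torus shifts \<open>rowv\<close> and the valuation of the determinant by its own two
  valuations, so the t that move g into \<open>slice\<close> form one coset of
  \<open>T_compact\<close>, a set of measure 1.\<close>

lemma slice_fiber:
  fixes g :: "'q::finite_field fls^3^3"
  assumes g: "g \<in> GL3"
  shows "\<exists>t0\<in>torus. t0 ** g \<in> slice \<and> {t \<in> torus. t ** g \<in> slice} = (**) t0 ` T_compact"
proof -
  obtain t0 :: "'q fls^3^3" where t0: "t0 \<in> torus" "ord (t0$1$1) = - rowv g"
    "ord (det t0) = - ord (det g)" using torus_valuations_surj by blast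
  have iff: "t ** g \<in> slice \<longleftrightarrow> ord (t$1$1) = - rowv g \<and> ord (det t) = - ord (det g)"
    if "t \<in> torus" for t
    using torus_action[OF that g] by (auto simp: slice_def)
  have "{t \<in> torus. t ** g \<in> slice} = (**) t0 ` T_compact"
  proof (intro equalityI subsetI)
    fix t assume "t \<in> {t \<in> torus. t ** g \<in> slice}"
    then have t: "t \<in> torus" "ord (t$1$1) = - rowv g" "ord (det t) = - ord (det g)"
      using iff by auto
    have t0G: "t0 \<in> GL3" "matrix_inv t0 \<in> torus" "matrix_inv t0 \<in> M0" "t \<in> M0" "t0 \<in> M0"
      using t0 t torus_GL3 torus_M0 torus_inv by blast+
    let ?s = "matrix_inv t0 ** t"
    have st: "t = t0 ** ?s" by (simp add: matrix_mul_assoc matrix_inv_GL3[OF t0G(1)])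
    have s: "?s \<in> torus" using torus_mult t0G t by blast
    then have "?s \<in> M0" using torus_M0 by blast
    have "t$1$1 = t0$1$1 * ?s$1$1" using st M0_mult_nth(1)[OF t0G(5) \<open>?s \<in> M0\<close>] by simp
    moreover have "det t = det t0 * det ?s" using st by (metis det_mul)
    ultimately have "ord (?s$1$1) = 0" "ord (det ?s) = 0"
      using t t0 M0_nonzero(1)[OF t0G(5)] M0_nonzero(1)[OF \<open>?s \<in> M0\<close>] t0G(1) s torus_GL3
      by (auto simp: GL3_iff subset_iff)
    then have "?s \<in> T_compact" using s by (simp add: T_compact_iff)
    then show "t \<in> (**) t0 ` T_compact" using st by blast
  next
    fix t assume "t \<in> (**) t0 ` T_compact"
    then obtain s where s: "s \<in> T_compact" "t = t0 ** s" by blast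
    then have s': "s \<in> torus" "ord (s$1$1) = 0" "ord (det s) = 0"
      by (auto simp: T_compact_iff)
    have "s \<in> M0" "t0 \<in> M0" "s \<in> GL3" "t0 \<in> GL3" using s' t0 torus_M0 torus_GL3 by blast+
    then have "ord (t$1$1) = ord (t0$1$1)" "ord (det t) = ord (det t0)"
      using s' by (simp_all add: s M0_mult_nth M0_nonzero det_mul GL3_iff)
    moreover have "t \<in> torus" using s s' t0 torus_mult by blast
    ultimately show "t \<in> {t \<in> torus. t ** g \<in> slice}" using iff t0 by simp
  qed
  then show ?thesis using t0 iff by blast
qed

lemma slice_right:
  assumes "g \<in> slice" "k \<in> GL3_O" shows "g ** k \<in> slice"
proof -
  have "k \<in> GL3" using assms GL3_O_subset by blast
  then show ?thesis using assms
    by (auto simp: slice_def rowv_right GL3_mult det_mul GL3_O_iff GL3_iff)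
qed

text \<open>\<open>emeasure\<close> vanishes off \<open>sets\<close>, so a set of measure 1 is
  measurable. The normalizations thus yield measurability of the compact groups and of their
  translates.\<close>

lemma emeasure_haar_translate:
  assumes "haar_measure H \<mu>" "emeasure \<mu> S = 1" "h \<in> H"
  shows "emeasure \<mu> ((**) h ` S) = 1" "(**) h ` S \<in> sets \<mu>"
proof -
  have "S \<in> sets \<mu>" using assms(2) emeasure_notin_sets by fastforce
  then show *: "emeasure \<mu> ((**) h ` S) = 1" using assms unfolding haar_measure_def by metis
  show "(**) h ` S \<in> sets \<mu>" using * emeasure_notin_sets by fastforce
qed

lemma haar_space: "haar_measure H \<mu> \<Longrightarrow> space \<mu> = H"
  unfolding haar_measure_def using sets_eq_imp_space_eq[of \<mu> "restrict_space borel H"]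
  by (simp add: space_restrict_space)

text \<open>The quotient formula is applied to F cut off to \<open>slice\<close>. On the group this
  is a combination of cosets of \<open>GL3_O\<close>, each of measure 1, which gives the sum over R.
  On a T-coset the inner integral is F times the measure of one coset of \<open>T_compact\<close>,
  hence F.\<close>

lemma quotient_integral:
  fixes F :: "'q::finite_field fls^3^3 \<Rightarrow> real"
  assumes \<mu>: "haar_measure GL3 \<mu>" "emeasure \<mu> GL3_O = 1"
    and \<tau>: "haar_measure torus \<tau>" "emeasure \<tau> T_compact = 1"
    and quot: "quotient_measure torus \<mu> \<tau> \<nu>"
    and F0: "\<And>g. g \<in> GL3 \<Longrightarrow> F g \<ge> 0"
    and FT: "\<And>t g. t \<in> torus \<Longrightarrow> g \<in> GL3 \<Longrightarrow> F (t ** g) = F g"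
    and FK: "\<And>g k. g \<in> GL3 \<Longrightarrow> k \<in> GL3_O \<Longrightarrow> F (g ** k) = F g"
    and R: "finite R" "R \<subseteq> slice"
    and disj: "\<And>r r' k. r \<in> R \<Longrightarrow> r' \<in> R \<Longrightarrow> k \<in> GL3_O \<Longrightarrow> r' = r ** k \<Longrightarrow> r' = r"
    and cover: "\<And>g. g \<in> slice \<Longrightarrow> F g \<noteq> 0 \<Longrightarrow> \<exists>r\<in>R. \<exists>k\<in>GL3_O. g = r ** k"
  shows "integrable \<nu> (\<lambda>C. F (SOME g. g \<in> C)) \<and> (LINT C|\<nu>. F (SOME g. g \<in> C)) = (\<Sum>r\<in>R. F r)"
proof -
  define K where "K = (GL3_O :: ('q fls^3^3) set)"
  define G where "G = (\<lambda>C. F (SOME g. g \<in> C))"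
  have sp\<mu>: "space \<mu> = GL3" and sp\<tau>: "space \<tau> = torus" using haar_space \<mu> \<tau> by blast+
  have sp\<nu>: "space \<nu> = right_cosets torus"
    using quot unfolding quotient_measure_def by (elim conjE)
  have sets\<nu>: "sets \<nu> = {S. S \<subseteq> right_cosets torus \<and> \<Union>S \<in> sets \<mu>}"
    using quot unfolding quotient_measure_def by (elim conjE)
  have fub: "\<forall>f\<in>borel_measurable \<mu>.
        (\<integral>\<^sup>+ g. f g \<partial>\<mu>) = (\<integral>\<^sup>+ C. (\<integral>\<^sup>+ t. f (t ** (SOME g. g \<in> C)) \<partial>\<tau>) \<partial>\<nu>)"
    using quot unfolding quotient_measure_def by (elim conjE)
  have RG: "r \<in> GL3" if "r \<in> R" for r using R that by (auto simp: slice_def)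
  have tr: "emeasure \<mu> ((**) g ` K) = 1" "(**) g ` K \<in> sets \<mu>" if "g \<in> GL3" for g
    using emeasure_haar_translate[OF \<mu> that] by (simp_all add: K_def)
  have slice_cover: "\<exists>t\<in>torus. t ** g \<in> slice" if "g \<in> GL3" for g :: "'q fls^3^3"
    using slice_fiber[OF that] by blast
  have coset: "\<exists>h\<in>GL3. C = (\<lambda>t. t ** h) ` torus" if "C \<in> right_cosets torus" for C :: "('q fls^3^3) set"
    using that unfolding right_cosets_def by blast
  have coset_GL3: "g \<in> GL3" if "C \<in> right_cosets torus" "g \<in> C" for C and g :: "'q fls^3^3"
    using coset[OF that(1)] that(2) torus_action(1) by blast
  have rep_in: "(SOME g. g \<in> C) \<in> C" if C: "C \<in> right_cosets torus" for C :: "('q fls^3^3) set"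
  proof -
    obtain h where h: "C = (\<lambda>t. t ** h) ` torus" using coset[OF C] by blast
    have "mat 1 ** h \<in> C" using torus_one unfolding h by (rule imageI)
    then show ?thesis by (rule someI)
  qed
  have rep: "(SOME g. g \<in> C) \<in> GL3" if "C \<in> right_cosets torus" for C :: "('q fls^3^3) set"
    using coset_GL3[OF that rep_in[OF that]] .
  have rep_F: "F g = G C" if C: "C \<in> right_cosets torus" and "g \<in> C" for C g
  proof -
    obtain h where h: "h \<in> GL3" "C = (\<lambda>t. t ** h) ` torus" using coset[OF C] by blast
    have "F g' = F h" if "g' \<in> C" for g' using that h FT by auto
    then show ?thesis using rep_in[OF C] that(2) by (simp add: G_def)
  qed
  have cover': "\<exists>r k. r \<in> R \<and> k \<in> K \<and> g = r ** k \<and> F g = F r" if gs: "g \<in> slice" "F g \<noteq> 0" for g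
  proof -
    obtain r k where "r \<in> R" "k \<in> GL3_O" "g = r ** k" using cover[OF gs] by blast
    then show ?thesis using FK[OF RG] unfolding K_def by blast
  qed
  \<comment> \<open>In this form measurability is clear; \<open>f_eq\<close> identifies f with F cut
    off to \<open>slice\<close>.\<close>
  define f where "f = (\<lambda>g. \<Sum>r\<in>R. ennreal (F r) * indicator ((**) r ` K) g)"
  have f_meas: "f \<in> borel_measurable \<mu>"
    unfolding f_def using tr RG by (intro borel_measurable_sum borel_measurable_times_ennreal) auto
  have f_eq: "f g = ennreal (F g) * indicator slice g" if g: "g \<in> GL3" for g
  proof (cases "g \<in> slice \<and> F g \<noteq> 0")
    case True
    then obtain r k where rk: "r \<in> R" "k \<in> K" "g = r ** k" using cover' by blast
    have "g \<notin> (**) r' ` K" if r': "r' \<in> R" "r' \<noteq> r" for r'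
    proof
      assume "g \<in> (**) r' ` K"
      then obtain k' where "k' \<in> K" "g = r' ** k'" by (rule imageE)
      then have k': "k' \<in> K" "r ** k = r' ** k'" using rk(3) by simp_all
      have kG: "k \<in> GL3" using rk GL3_O_subset by (auto simp: K_def)
      have "r = r ** (k ** matrix_inv k)" by (simp add: matrix_inv_GL3[OF kG])
      also have "\<dots> = r' ** (k' ** matrix_inv k)" by (simp add: matrix_mul_assoc k')
      finally have "r = r' ** (k' ** matrix_inv k)" .
      moreover have "k' ** matrix_inv k \<in> GL3_O" using k' rk GL3_O_inv GL3_O_mult by (auto simp: K_def)
      ultimately show False using disj[OF r'(1) rk(1)] r'(2) by metis
    qed
    then have "f g = (\<Sum>r'\<in>R. if r' = r then ennreal (F r) else 0)"
      unfolding f_def using rk by (intro sum.cong) auto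
    also have "\<dots> = ennreal (F g)" using R rk FK[OF RG] by (simp add: K_def)
    finally show ?thesis using True by simp
  next
    case False
    have "ennreal (F r) * indicator ((**) r ` K) g = 0" if "r \<in> R" for r
    proof (cases "g \<in> (**) r ` K")
      case True
      then obtain k where "k \<in> K" "g = r ** k" by (rule imageE)
      then have "g \<in> slice" "F g = F r" using slice_right[of r k] R that FK[OF RG] by (auto simp: K_def)
      then show ?thesis using False by simp
    qed simp
    then have "f g = 0" unfolding f_def by (rule sum.neutral[OF ballI])
    then show ?thesis using False by (auto simp: indicator_def)
  qed
  have "(\<integral>\<^sup>+ g. f g \<partial>\<mu>) = (\<Sum>r\<in>R. ennreal (F r))"
    unfolding f_def using tr RG
    by (subst nn_integral_sum) (auto intro!: borel_measurable_times_ennreal sum.cong simp: nn_integral_cmult_indicator)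
  moreover have "(\<integral>\<^sup>+ t. f (t ** (SOME g. g \<in> C)) \<partial>\<tau>) = ennreal (G C)" if C: "C \<in> space \<nu>" for C
  proof -
    let ?g = "SOME g. g \<in> C"
    have g: "?g \<in> GL3" using rep C unfolding sp\<nu> .
    obtain t0 where t0: "t0 \<in> torus" "{t \<in> torus. t ** ?g \<in> slice} = (**) t0 ` T_compact"
      using slice_fiber[OF g] by blast
    have "(\<integral>\<^sup>+ t. f (t ** ?g) \<partial>\<tau>) = (\<integral>\<^sup>+ t. ennreal (F ?g) * indicator ((**) t0 ` T_compact) t \<partial>\<tau>)"
    proof (rule nn_integral_cong)
      fix t assume "t \<in> space \<tau>"
      then have t: "t \<in> torus" by (simp add: sp\<tau>)
      have "t ** ?g \<in> slice \<longleftrightarrow> t \<in> (**) t0 ` T_compact" using t0(2) t by blast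
      then show "f (t ** ?g) = ennreal (F ?g) * indicator ((**) t0 ` T_compact) t"
        using f_eq[of "t ** ?g"] FT[OF t g] torus_action(1)[OF t g] by (simp add: indicator_def)
    qed
    also have "\<dots> = ennreal (F ?g)"
      using emeasure_haar_translate[OF \<tau> t0(1)] by (simp add: nn_integral_cmult_indicator)
    finally show ?thesis by (simp add: G_def)
  qed
  ultimately have int: "(\<integral>\<^sup>+ C. ennreal (G C) \<partial>\<nu>) = (\<Sum>r\<in>R. ennreal (F r))"
    using bspec[OF fub f_meas] by (simp cong: nn_integral_cong)
  \<comment> \<open>The Bochner integral requires measurability on the quotient, where a set is
    measurable iff its union is. A nonzero level set of F is a countable union of cosets of
    \<open>GL3_O\<close>, a finite family for each pair of torus valuations.\<close>
  have level: "{g \<in> GL3. F g = v} \<in> sets \<mu>" if v: "v \<noteq> 0" for v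
  proof -
    define t where "t ij = (SOME t :: 'q fls^3^3. t \<in> torus \<and> ord (t$1$1) = fst ij \<and> ord (det t) = snd ij)"
      for ij :: "int \<times> int"
    have t: "t ij \<in> torus \<and> ord (t ij$1$1) = fst ij \<and> ord (det (t ij)) = snd ij" for ij :: "int \<times> int"
      unfolding t_def by (rule someI_ex) (use torus_valuations_surj in blast)
    have "{g \<in> GL3. F g = v} = (\<Union>ij. \<Union>r\<in>{r\<in>R. F r = v}. (**) (t ij ** r) ` K)"
    proof (intro equalityI subsetI)
      fix g assume "g \<in> {g \<in> GL3. F g = v}"
      then have g: "g \<in> GL3" "F g = v" by auto
      define s where "s = t (rowv g, ord (det g))"
      have s: "s \<in> torus" "ord (s$1$1) = rowv g" "ord (det s) = ord (det g)"
        using t[of "(rowv g, ord (det g))"] by (auto simp: s_def)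
      have sG: "s \<in> GL3" using s torus_GL3 by blast
      let ?h = "matrix_inv s ** g"
      have gs: "g = s ** ?h" by (simp add: matrix_mul_assoc matrix_inv_GL3[OF sG])
      have hG: "?h \<in> GL3" using GL3_mult matrix_inv_in_GL3 sG g by blast
      have "rowv g = ord (s$1$1) + rowv ?h"
        "ord (det g) = ord (det s) + ord (det ?h)"
        using torus_action(2,3)[OF s(1) hG] gs by simp_all
      then have "?h \<in> slice" using s hG by (simp add: slice_def)
      moreover have "F ?h = v" using FT[OF torus_inv[OF s(1)] g(1)] g by simp
      ultimately obtain r k where rk: "r \<in> R" "k \<in> K" "?h = r ** k" "F ?h = F r" using cover' v by blast
      then have "F r = v" using \<open>F ?h = v\<close> by simp
      moreover have "g = (s ** r) ** k" using gs rk by (simp add: matrix_mul_assoc)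
      ultimately show "g \<in> (\<Union>ij. \<Union>r\<in>{r\<in>R. F r = v}. (**) (t ij ** r) ` K)"
        using rk unfolding s_def by blast
    next
      fix g assume "g \<in> (\<Union>ij. \<Union>r\<in>{r\<in>R. F r = v}. (**) (t ij ** r) ` K)"
      then obtain ij r k where *: "r \<in> R" "F r = v" "k \<in> K" "g = (t ij ** r) ** k" by blast
      have "t ij ** r \<in> GL3" using torus_action(1) t RG * by blast
      moreover have "k \<in> GL3" using * GL3_O_subset by (auto simp: K_def)
      moreover have "F g = v" using * FK[OF \<open>t ij ** r \<in> GL3\<close>, of k] FT[of "t ij" r] t RG by (simp add: K_def)
      ultimately show "g \<in> {g \<in> GL3. F g = v}" using * GL3_mult by auto
    qed
    moreover have "(**) (t ij ** r) ` K \<in> sets \<mu>" if "r \<in> R" for ij r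
      using torus_action(1)[of "t ij" r] t[of ij] RG[OF that] by (intro tr(2)) blast
    then have "(\<Union>ij. \<Union>r\<in>{r\<in>R. F r = v}. (**) (t ij ** r) ` K) \<in> sets \<mu>"
      using R(1) by (intro sets.countable_UN'' sets.finite_UN) auto
    ultimately show ?thesis by simp
  qed
  have F_range: "F g = 0 \<or> F g \<in> F ` R" if gG: "g \<in> GL3" for g
  proof -
    obtain t where t: "t \<in> torus" "t ** g \<in> slice" using slice_cover gG by blast
    then have "F g = F (t ** g)" using FT gG by simp
    moreover have "F (t ** g) \<in> F ` R" if "F (t ** g) \<noteq> 0"
      using cover'[OF t(2) that] by auto
    ultimately show ?thesis by auto
  qed
  \<comment> \<open>The level 0 is the complement of the finitely many nonzero ones.\<close>
  have level': "{g \<in> GL3. F g = v} \<in> sets \<mu>" for v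
  proof (cases "v = 0")
    case True
    have "{g \<in> GL3. F g = v} = space \<mu> - (\<Union>w\<in>F ` R - {0}. {g \<in> GL3. F g = w})"
      using F_range True by (auto simp: sp\<mu>)
    then show ?thesis using level R(1) by (auto intro!: sets.finite_UN)
  qed (rule level)
  have "simple_function \<nu> G"
    unfolding simple_function_def
  proof (intro conjI ballI)
    have "G ` space \<nu> \<subseteq> insert 0 (F ` R)" using F_range rep by (force simp: G_def sp\<nu>)
    then show "finite (G ` space \<nu>)" using R(1) finite_subset by blast
    fix v
    have "\<Union> (G -` {v} \<inter> space \<nu>) = {g \<in> GL3. F g = v}"
    proof (intro equalityI subsetI)
      fix g assume "g \<in> \<Union> (G -` {v} \<inter> space \<nu>)"
      then obtain C where C: "g \<in> C" "G C = v" "C \<in> right_cosets torus" by (auto simp: sp\<nu>)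
      then have "g \<in> GL3" using coset_GL3 by blast
      then show "g \<in> {g \<in> GL3. F g = v}" using rep_F[OF C(3,1)] C(2) by simp
    next
      fix g assume "g \<in> {g \<in> GL3. F g = v}"
      then have g: "g \<in> GL3" "F g = v" by auto
      let ?C = "(\<lambda>t. t ** g) ` torus"
      have "?C \<in> right_cosets torus" using g by (auto simp: right_cosets_def)
      moreover have "mat 1 ** g \<in> ?C" using torus_one by blast
      ultimately show "g \<in> \<Union> (G -` {v} \<inter> space \<nu>)" using rep_F[of ?C g] g by (auto simp: sp\<nu>)
    qed
    then show "G -` {v} \<inter> space \<nu> \<in> sets \<nu>" using level' by (auto simp: sets\<nu> sp\<nu>)
  qed
  then have G_meas: "G \<in> borel_measurable \<nu>" by (rule borel_measurable_simple_function)
  have G0: "AE C in \<nu>. G C \<ge> 0" using F0 rep by (intro AE_I2) (simp add: G_def sp\<nu>)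
  have sumF: "(\<Sum>r\<in>R. ennreal (F r)) = ennreal (\<Sum>r\<in>R. F r)" using F0 RG by (intro sum_ennreal) auto
  have "integrable \<nu> G"
    using int by (intro integrableI_nonneg[OF G_meas G0]) (simp add: sumF)
  moreover have "(LINT C|\<nu>. G C) = enn2real (ennreal (\<Sum>r\<in>R. F r))"
    using integral_eq_nn_integral[OF G_meas G0] int sumF by simp
  moreover have "(\<Sum>r\<in>R. F r) \<ge> 0" using F0 RG by (intro sum_nonneg) auto
  ultimately show ?thesis by (simp add: G_def)
qed

section \<open>Counting residues\<close>

text \<open>Polynomials in eps of degree below k, the standard representatives of O / eps^k
  O.\<close>

definition residues :: "nat \<Rightarrow> 'q::field fls set" where
  "residues k = {f. val_ge 0 f \<and> (\<forall>i\<ge>int k. fls_nth f i = 0)}"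

definition truncation :: "nat \<Rightarrow> (nat \<Rightarrow> 'q) \<Rightarrow> 'q::field fls" where
  "truncation k h = fps_to_fls (Abs_fps (\<lambda>i. if i < k then h i else 0))"

lemma truncation_nth: "fls_nth (truncation k h) i = (if 0 \<le> i \<and> i < int k then h (nat i) else 0)"
  by (auto simp: truncation_def fps_to_fls_nth nat_less_iff)

lemma truncation_in_residues: "truncation k h \<in> residues k"
  by (auto simp: residues_def val_ge_nth truncation_nth)

lemma residues_card: "finite (residues k :: 'q::finite_field fls set)" "card (residues k :: 'q fls set) = CARD('q) ^ k"
proof -
  let ?A = "PiE {..<k} (\<lambda>_. UNIV :: 'q set)"
  have inj: "inj_on (truncation k) ?A"
  proof (rule inj_onI)
    fix h h' assume *: "h \<in> ?A" "h' \<in> ?A" "truncation k h = truncation k h'"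
    have "h i = h' i" if "i < k" for i
      using arg_cong[OF *(3), of "\<lambda>f. fls_nth f (int i)"] that by (simp add: truncation_nth)
    then show "h = h'" using *(1,2) by (intro PiE_ext) auto
  qed
  have im: "truncation k ` ?A = residues k"
  proof (intro equalityI subsetI)
    fix f :: "'q fls" assume f: "f \<in> residues k"
    define h where "h = restrict (\<lambda>i. fls_nth f (int i)) {..<k}"
    have "f = truncation k h"
      unfolding h_def using f by (intro fls_eqI) (auto simp: truncation_nth residues_def val_ge_nth)
    moreover have "h \<in> ?A" by (simp add: h_def)
    ultimately show "f \<in> truncation k ` ?A" by blast
  qed (use truncation_in_residues in blast)
  have "finite ?A" by (intro finite_PiE) auto
  then show "finite (residues k :: 'q fls set)" unfolding im[symmetric] by (rule finite_imageI)
  have "card ?A = CARD('q) ^ k" by (subst card_PiE) simp_all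
  then show "card (residues k :: 'q fls set) = CARD('q) ^ k"
    unfolding im[symmetric] card_image[OF inj] .
qed

lemma residues_reduce:
  assumes "val_ge 0 f"
  shows "\<exists>p\<in>residues k. val_ge (int k) (f - p)"
  using assms
  by (intro bexI[of _ "truncation k (\<lambda>i. fls_nth f (int i))"] truncation_in_residues)
     (auto simp: val_ge_nth truncation_nth)

lemma residues_unique:
  assumes "p \<in> residues k" "p' \<in> residues k" "val_ge (int k) (p - p')"
  shows "p = p'"
proof (rule fls_eqI)
  fix i show "fls_nth p i = fls_nth p' i"
    using assms by (cases "i < int k") (auto simp: residues_def val_ge_nth)
qed

lemma ep_times_nth: "fls_nth (ep e * f) i = fls_nth f (i - e)"
  by (simp add: ep_def fls_X_intpow_times_conv_shift)

lemma val_ge_ep [simp]: "val_ge k (ep e * f) \<longleftrightarrow> val_ge (k - e) f"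
  by (simp add: val_ge_mult_left)

lemma residues_card_val_ge:
  "card {p \<in> (residues k :: 'q::finite_field fls set). val_ge (int k - int s) p} = CARD('q) ^ min s k"
proof -
  \<comment> \<open>Integral elements of valuation at least k - s are eps^(k-l) times polynomials of
    degree below l; the minimum accounts for s > k, where the condition is empty.\<close>
  define l where "l = min s k"
  have l: "int l \<le> int k" "max 0 (int k - int s) = int k - int l" by (auto simp: l_def)
  have "{p \<in> (residues k :: 'q fls set). val_ge (int k - int s) p} = (*) (ep (int k - int l)) ` residues l"
  proof (intro equalityI subsetI)
    fix p :: "'q fls" assume p: "p \<in> {p \<in> residues k. val_ge (int k - int s) p}"
    have "p = ep (int k - int l) * (ep (int l - int k) * p)"
      by (simp add: mult.assoc[symmetric] ep_mult)
    moreover have "val_ge (int k - int l) p"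
      using p l(2) by (cases "int k - int s \<le> 0") (auto simp: residues_def)
    then have "ep (int l - int k) * p \<in> residues l"
      using p by (auto simp: residues_def ep_times_nth)
    ultimately show "p \<in> (*) (ep (int k - int l)) ` residues l" by blast
  next
    fix p :: "'q fls" assume "p \<in> (*) (ep (int k - int l)) ` residues l"
    then obtain f where f: "f \<in> residues l" "p = ep (int k - int l) * f" by blast
    then have "val_ge (int k - int l) p" by (simp add: residues_def)
    then have "val_ge 0 p" "val_ge (int k - int s) p" using l by (auto elim: val_ge_mono)
    then show "p \<in> {p \<in> residues k. val_ge (int k - int s) p}"
      using f by (auto simp: residues_def ep_times_nth)
  qed
  moreover have "inj ((*) (ep (int k - int l) :: 'q fls))" by (auto simp: inj_def)
  ultimately show ?thesis
    by (simp add: card_image[OF inj_on_subset[OF _ subset_UNIV]] residues_card l_def)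
qed

text \<open>W represents the classes of S modulo O^2. The last clause says that eps^s kills as many
  classes as in the direct sum of O / eps^e1 and O / eps^e2; these counts determine the sum of the
  exponents.\<close>

definition residue_system :: "('q::finite_field fls \<times> 'q fls) set \<Rightarrow> ('q fls \<times> 'q fls) set \<Rightarrow> nat \<Rightarrow> nat \<Rightarrow> bool" where
  "residue_system S W e1 e2 \<longleftrightarrow> finite W \<and> W \<subseteq> S \<and>
    (\<forall>w\<in>W. \<forall>v\<in>W. val_ge 0 (fst w - fst v) \<and> val_ge 0 (snd w - snd v) \<longrightarrow> w = v) \<and>
    (\<forall>w\<in>S. \<exists>v\<in>W. val_ge 0 (fst w - fst v) \<and> val_ge 0 (snd w - snd v)) \<and>
    card W = CARD('q) ^ (e1 + e2) \<and>
    (\<forall>s::nat. card {w\<in>W. val_ge (- int s) (fst w) \<and> val_ge (- int s) (snd w)} = CARD('q) ^ (min s e1 + min s e2))"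

text \<open>For integral c the map (x, y) -> (x, y - c x) preserves O^2 and every eps^(-s) O^2. This
  reduces the count to a product of two cyclic modules, represented by scaled
  \<open>residues\<close>.\<close>

lemma residue_system_shear:
  fixes c :: "'q::finite_field fls"
  assumes c: "val_ge 0 c"
  shows "\<exists>W. residue_system {w. val_ge (- int f1) (fst w) \<and> val_ge (- int f2) (snd w - c * fst w)} W f1 f2"
proof -
  define \<phi> where "\<phi> p = (ep (- int f1) * fst p, ep (- int f2) * snd p + c * (ep (- int f1) * fst p))"
    for p :: "'q fls \<times> 'q fls"
  have inj: "inj \<phi>" by (auto simp: inj_def \<phi>_def)
  let ?P = "residues f1 \<times> residues f2 :: ('q fls \<times> 'q fls) set"
  let ?S = "{w. val_ge (- int f1) (fst w) \<and> val_ge (- int f2) (snd w - c * fst w)}"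
  let ?W = "\<phi> ` ?P"
  have shear: "val_ge k x \<and> val_ge k (y + c * x) \<longleftrightarrow> val_ge k x \<and> val_ge k y" for k x y
    using val_ge_mult0[OF c, of k x] val_ge_add[of k y "c * x"] val_ge_diff[of k "y + c * x" "c * x"] by auto
  have fin: "finite ?P" by (simp add: residues_card)
  have "?W \<subseteq> ?S" by (auto simp: \<phi>_def residues_def)
  moreover have "w = v" if wv: "w \<in> ?W" "v \<in> ?W" "val_ge 0 (fst w - fst v)" "val_ge 0 (snd w - snd v)" for w v
  proof -
    obtain p r where pr: "p \<in> ?P" "r \<in> ?P" "w = \<phi> p" "v = \<phi> r" using wv(1,2) by blast
    have "val_ge 0 (ep (- int f1) * (fst p - fst r)) \<and>
      val_ge 0 (ep (- int f2) * (snd p - snd r) + c * (ep (- int f1) * (fst p - fst r)))"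
      using wv(3,4) by (simp add: pr \<phi>_def algebra_simps)
    then have "val_ge (int f1) (fst p - fst r)" "val_ge (int f2) (snd p - snd r)"
      unfolding shear by simp_all
    then have "p = r" using pr(1,2) residues_unique by (auto simp: prod_eq_iff)
    then show "w = v" using pr by simp
  qed
  moreover have "\<exists>v\<in>?W. val_ge 0 (fst w - fst v) \<and> val_ge 0 (snd w - snd v)" if w: "w \<in> ?S" for w
  proof -
    obtain x y where xy: "w = (x, y)" by (cases w)
    have *: "val_ge 0 (ep (int f1) * x)" "val_ge 0 (ep (int f2) * (y - c * x))" using w by (simp_all add: xy)
    obtain p1 where p1: "p1 \<in> residues f1" "val_ge (int f1) (ep (int f1) * x - p1)"
      using residues_reduce[OF *(1)] by blast
    obtain p2 where p2: "p2 \<in> residues f2" "val_ge (int f2) (ep (int f2) * (y - c * x) - p2)"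
      using residues_reduce[OF *(2)] by blast
    have 1: "x - ep (- int f1) * p1 = ep (- int f1) * (ep (int f1) * x - p1)"
      by (simp add: algebra_simps) (simp add: mult.assoc[symmetric] ep_mult)
    have 2: "y - c * x - ep (- int f2) * p2 = ep (- int f2) * (ep (int f2) * (y - c * x) - p2)"
      by (simp only: right_diff_distrib mult.assoc[symmetric] ep_mult) simp
    have "val_ge 0 (x - ep (- int f1) * p1)" "val_ge 0 (y - c * x - ep (- int f2) * p2)"
      using p1 p2 by (simp_all only: 1 2 val_ge_ep) simp_all
    moreover have "y - (ep (- int f2) * p2 + c * (ep (- int f1) * p1))
        = (y - c * x - ep (- int f2) * p2) + c * (x - ep (- int f1) * p1)"
      by (simp add: algebra_simps)
    ultimately have "val_ge 0 (fst w - fst (\<phi> (p1, p2))) \<and> val_ge 0 (snd w - snd (\<phi> (p1, p2)))"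
      using shear[of 0 "x - ep (- int f1) * p1" "y - c * x - ep (- int f2) * p2"]
      by (simp only: xy \<phi>_def fst_conv snd_conv)
    then show ?thesis using p1 p2 by blast
  qed
  moreover have "card ?W = CARD('q) ^ (f1 + f2)"
    using card_image[OF inj_on_subset[OF inj subset_UNIV]] by (simp add: card_cartesian_product residues_card power_add)
  moreover have "card {w\<in>?W. val_ge (- int s) (fst w) \<and> val_ge (- int s) (snd w)} = CARD('q) ^ (min s f1 + min s f2)" for s :: nat
  proof -
    have "{w\<in>?W. val_ge (- int s) (fst w) \<and> val_ge (- int s) (snd w)} =
      \<phi> ` ({p \<in> residues f1. val_ge (int f1 - int s) p} \<times> {p \<in> residues f2. val_ge (int f2 - int s) p})"
    proof -
      have "val_ge (- int s) (fst (\<phi> p)) \<and> val_ge (- int s) (snd (\<phi> p)) \<longleftrightarrow>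
          val_ge (int f1 - int s) (fst p) \<and> val_ge (int f2 - int s) (snd p)" for p
        unfolding \<phi>_def fst_conv snd_conv shear by simp
      then have "{w\<in>?W. val_ge (- int s) (fst w) \<and> val_ge (- int s) (snd w)} =
          \<phi> ` {p \<in> ?P. val_ge (int f1 - int s) (fst p) \<and> val_ge (int f2 - int s) (snd p)}"
        by blast
      also have "{p \<in> ?P. val_ge (int f1 - int s) (fst p) \<and> val_ge (int f2 - int s) (snd p)} =
          {p \<in> residues f1. val_ge (int f1 - int s) p} \<times> {p \<in> residues f2. val_ge (int f2 - int s) p}"
        by auto
      finally show ?thesis .
    qed
    then show ?thesis
      using card_image[OF inj_on_subset[OF inj subset_UNIV]]
      by (simp add: card_cartesian_product residues_card_val_ge power_add)
  qed
  ultimately show ?thesis unfolding residue_system_def using fin by (intro exI[of _ ?W]) auto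
qed

lemma residue_system_swap:
  fixes S W :: "('q::finite_field fls \<times> 'q fls) set"
  assumes "residue_system S W e1 e2"
  shows "residue_system (prod.swap ` S) (prod.swap ` W) e2 e1"
proof -
  have set: "{w \<in> prod.swap ` W. val_ge (- int s) (fst w) \<and> val_ge (- int s) (snd w)}
     = prod.swap ` {w \<in> W. val_ge (- int s) (fst w) \<and> val_ge (- int s) (snd w)}" for s
    by auto
  have card: "card (prod.swap ` A) = card A" for A :: "('q fls \<times> 'q fls) set"
    by (intro card_image) auto
  have fin: "finite W" and sub: "W \<subseteq> S"
    and uniq: "\<And>w v. w \<in> W \<Longrightarrow> v \<in> W \<Longrightarrow> val_ge 0 (fst w - fst v) \<Longrightarrow> val_ge 0 (snd w - snd v) \<Longrightarrow> w = v"
    and cov: "\<And>w. w \<in> S \<Longrightarrow> \<exists>v\<in>W. val_ge 0 (fst w - fst v) \<and> val_ge 0 (snd w - snd v)"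
    and cW: "card W = CARD('q) ^ (e1 + e2)"
    and cs: "\<And>s::nat. card {w\<in>W. val_ge (- int s) (fst w) \<and> val_ge (- int s) (snd w)} = CARD('q) ^ (min s e1 + min s e2)"
    using assms unfolding residue_system_def by blast+
  show ?thesis
    unfolding residue_system_def set card cW cs
  proof (intro conjI ballI impI allI)
    fix w v assume *: "w \<in> prod.swap ` W" "v \<in> prod.swap ` W" "val_ge 0 (fst w - fst v) \<and> val_ge 0 (snd w - snd v)"
    then have "prod.swap w = prod.swap v" by (intro uniq) auto
    then show "w = v" by (metis swap_swap)
  next
    fix w assume "w \<in> prod.swap ` S"
    then obtain v where "v \<in> W" "val_ge 0 (fst (prod.swap w) - fst v)" "val_ge 0 (snd (prod.swap w) - snd v)"
      using cov[of "prod.swap w"] by auto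
    then show "\<exists>v\<in>prod.swap ` W. val_ge 0 (fst w - fst v) \<and> val_ge 0 (snd w - snd v)"
      by (intro bexI[of _ "prod.swap v"]) auto
  qed (use fin sub in \<open>auto simp: add.commute\<close>)
qed

text \<open>The value d w is the number of s with d w > s. Exchanging the sums leaves, for each s,
  the number of classes not killed by eps^s.\<close>

lemma sum_depth:
  fixes W :: "('q::finite_field fls \<times> 'q fls) set" and d :: "'q fls \<times> 'q fls \<Rightarrow> nat"
  assumes W: "residue_system S W e1 e2" and e: "e1 \<le> e2"
    and d: "\<And>w s. d w \<le> s \<longleftrightarrow> val_ge (- int s) (fst w) \<and> val_ge (- int s) (snd w)"
  shows "(\<Sum>w\<in>W. real (d w)) = real e2 * real CARD('q) ^ (e1 + e2) - (\<Sum>s<e2. real CARD('q) ^ (min s e1 + s))"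
proof -
  have fin: "finite W" and cW: "card W = CARD('q) ^ (e1 + e2)"
    and cs: "\<And>s. card {w\<in>W. d w \<le> s} = CARD('q) ^ (min s e1 + min s e2)"
    using W by (auto simp: residue_system_def d)
  \<comment> \<open>The count at s = e2 is already the full cardinality, so no exponent exceeds
    e2.\<close>
  have "{w\<in>W. d w \<le> e2} = W"
    using fin cW cs[of e2] e by (intro card_subset_eq) (auto simp: min_absorb2)
  then have le: "d w \<le> e2" if "w \<in> W" for w using that by blast
  have "real (d w) = (\<Sum>s<e2. 1 - of_bool (d w \<le> s))" if "w \<in> W" for w
  proof -
    have "{..<e2} \<inter> {s. d w \<le> s} = {d w..<e2}" by auto
    then show ?thesis using le[OF that] by (simp add: sum_subtractf of_bool_def sum.If_cases of_nat_diff)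
  qed
  then have "(\<Sum>w\<in>W. real (d w)) = (\<Sum>w\<in>W. \<Sum>s<e2. 1 - of_bool (d w \<le> s))" by simp
  also have "\<dots> = (\<Sum>s<e2. \<Sum>w\<in>W. 1 - of_bool (d w \<le> s))" by (rule sum.swap)
  also have "\<dots> = (\<Sum>s<e2. real (card W) - real (card {w\<in>W. d w \<le> s}))"
    using fin by (intro sum.cong) (simp_all add: sum_subtractf of_bool_def sum.If_cases Int_def)
  also have "\<dots> = real e2 * real CARD('q) ^ (e1 + e2) - (\<Sum>s<e2. real CARD('q) ^ (min s e1 + s))"
    by (simp add: sum_subtractf cW cs)
  finally show ?thesis .
qed

section \<open>Representatives of the lattices\<close>

text \<open>The pairs \<open>w\<close> for which \<open>\<gamma>\<close> preserves the lattice \<open>base j w\<close> below (when \<open>j \<le> n\<close>).\<close>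

definition integral_pairs :: "'q::finite_field fls \<Rightarrow> 'q fls \<Rightarrow> nat \<Rightarrow> ('q fls \<times> 'q fls) set" where
  "integral_pairs A \<beta> j = {w. val_ge 0 (ep (- int j) * \<beta> * snd w - A * fst w) \<and>
      val_ge 0 (\<beta> * fls_X * (ep (int j) * fst w) - A * snd w)}"

lemma residue_system_commute: "residue_system S W e1 e2 \<longleftrightarrow> residue_system S W e2 e1"
  by (simp add: residue_system_def add.commute)

text \<open>Here b = eps^(-j) \<beta> is the coefficient of least valuation. Using it as pivot to
  eliminate y from the second condition leaves b N x up to sign, where b^2 N = A^2 - eps \<beta>^2;
  so N accounts for the second elementary divisor.\<close>

lemma integral_pairs_large:
  fixes A \<beta> :: "'q::finite_field fls"
  assumes \<beta>: "\<beta> \<noteq> 0" "ord \<beta> = int n" and j: "j \<le> n"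
    and A: "val_ge (int (n - j)) A"
  defines "c \<equiv> A / (ep (- int j) * \<beta>)"
  defines "N \<equiv> c * c - ep (int j) * (ep (int j) * fls_X)"
  shows "integral_pairs A \<beta> j = {w. val_ge (- (int (n - j) + ord N)) (fst w) \<and>
      val_ge (- int (n - j)) (snd w - c * fst w)}"
    and "val_ge 0 c"
proof -
  define b where "b = ep (- int j) * \<beta>"
  have b: "b \<noteq> 0" "ord b = int (n - j)" using \<beta> j by (simp_all add: b_def)
  have Ac: "A = b * c" and \<beta>b: "\<beta> = ep (int j) * b"
    using b by (simp_all add: c_def b_def[symmetric])
       (simp add: b_def mult.assoc[symmetric] ep_mult)
  show c: "val_ge 0 c" using A b by (simp add: c_def b_def[symmetric] val_ge_divide)
  have N: "N \<noteq> 0" unfolding N_def using norm_E2(1)[of c "ep (int j)"] by simp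
  have "val_ge 0 (b * y - A * x) \<and> val_ge 0 (\<beta> * fls_X * (ep (int j) * x) - A * y) \<longleftrightarrow>
    val_ge (- (int (n - j) + ord N)) x \<and> val_ge (- int (n - j)) (y - c * x)" for x y
  proof -
    have 1: "b * y - A * x = b * (y - c * x)" by (simp add: Ac algebra_simps)
    have 2: "\<beta> * fls_X * (ep (int j) * x) - A * y = - (b * N * x) - c * (b * (y - c * x))"
      by (simp add: Ac \<beta>b N_def algebra_simps)
    have 3: "val_ge 0 (- u - c * v) \<longleftrightarrow> val_ge 0 u" if v: "val_ge 0 v" for u v
    proof -
      have cv: "val_ge 0 (c * v)" using val_ge_mult0[OF c v] .
      then show ?thesis
        using val_ge_add[OF _ cv, of "- u - c * v"] val_ge_diff[OF _ cv, of "- u"] by auto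
    qed
    have "val_ge 0 (b * N * x) \<longleftrightarrow> val_ge (- (int (n - j) + ord N)) x"
      using b N by (simp add: val_ge_mult_left)
    moreover have "val_ge 0 (b * (y - c * x)) \<longleftrightarrow> val_ge (- int (n - j)) (y - c * x)"
      using b by (simp add: val_ge_mult_left)
    ultimately show ?thesis unfolding 1 2 using 3 by blast
  qed
  then show "integral_pairs A \<beta> j = {w. val_ge (- (int (n - j) + ord N)) (fst w) \<and>
      val_ge (- int (n - j)) (snd w - c * fst w)}"
    by (auto simp: integral_pairs_def b_def)
qed

text \<open>Now A is the pivot. Elimination multiplies the coefficient A of the second condition by
  1 - d c, a unit because d carries a factor eps. Both elementary divisors are therefore m, and the
  two coordinates change roles.\<close>

lemma integral_pairs_small:
  fixes A \<beta> :: "'q::finite_field fls"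
  assumes \<beta>: "\<beta> \<noteq> 0" "ord \<beta> = int n" and j: "j \<le> n"
    and A: "A \<noteq> 0" "ord A = int m" "m < n - j"
  defines "c \<equiv> ep (- int j) * \<beta> / A"
  shows "integral_pairs A \<beta> j = {w. val_ge (- int m) (snd w) \<and> val_ge (- int m) (fst w - c * snd w)}"
    and "val_ge 0 c"
proof -
  define b where "b = ep (- int j) * \<beta>"
  have b: "b \<noteq> 0" "ord b = int (n - j)" using \<beta> j by (simp_all add: b_def)
  have bc: "b = A * c" and \<beta>b: "\<beta> = ep (int j) * b"
    using A by (simp_all add: c_def b_def[symmetric])
       (simp add: b_def mult.assoc[symmetric] ep_mult)
  have "val_ge (int m) b" using b A by (simp add: val_ge_def)
  then show c: "val_ge 0 c" using A by (simp add: c_def b_def[symmetric] val_ge_divide)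
  define d where "d = c * (ep (int j) * (ep (int j) * fls_X))"
  have d1: "val_ge 1 d"
    using val_ge_mult0[OF c, of 1 "ep (int j) * (ep (int j) * fls_X)"] by (simp add: d_def)
  then have d: "val_ge 0 d" by (rule val_ge_mono) simp
  have "val_ge 1 (d * c)" using val_ge_mult[OF d1 c] by simp
  then have N: "1 - d * c \<noteq> 0" "ord (1 - d * c) = 0"
  proof -
    assume dc: "val_ge 1 (d * c)"
    have "1 - d * c \<noteq> 0 \<and> ord (1 - d * c) = 0"
    proof (cases "d * c = 0")
      case False
      then have "ord (d * c) \<ge> 1" using dc by (simp only: val_ge_def) blast
      then show ?thesis using subdegree_diff_distinct[of 1 "d * c"] False by auto
    qed auto
    then show "1 - d * c \<noteq> 0" "ord (1 - d * c) = 0" by auto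
  qed
  have "val_ge 0 (b * y - A * x) \<and> val_ge 0 (\<beta> * fls_X * (ep (int j) * x) - A * y) \<longleftrightarrow>
    val_ge (- int m) y \<and> val_ge (- int m) (x - c * y)" for x y
  proof -
    have 1: "b * y - A * x = - (A * (x - c * y))" by (simp add: bc algebra_simps)
    have 2: "\<beta> * fls_X * (ep (int j) * x) - A * y = d * (A * (x - c * y)) - A * (1 - d * c) * y"
      by (simp add: bc \<beta>b d_def algebra_simps)
    have 3: "val_ge 0 (d * v - u) \<longleftrightarrow> val_ge 0 u" if v: "val_ge 0 v" for u v
    proof -
      have cv: "val_ge 0 (d * v)" using val_ge_mult0[OF d v] .
      then show ?thesis
        using val_ge_diff[OF cv, of "d * v - u"] val_ge_diff[OF cv, of u] by auto
    qed
    have "val_ge 0 (A * (1 - d * c) * y) \<longleftrightarrow> val_ge (- int m) y"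
      using A N by (simp add: val_ge_mult_left)
    moreover have "val_ge 0 (- (A * (x - c * y))) \<longleftrightarrow> val_ge (- int m) (x - c * y)"
      using A by (simp add: val_ge_mult_left)
    ultimately show ?thesis unfolding 1 2 using 3[of "A * (x - c * y)" "A * (1 - d * c) * y"] by auto
  qed
  then show "integral_pairs A \<beta> j = {w. val_ge (- int m) (snd w) \<and> val_ge (- int m) (fst w - c * snd w)}"
    by (auto simp: integral_pairs_def b_def)
qed

text \<open>What remains is the valuation of N, the norm of c + eps^j eps^(1/2): it is 2 val(c) if
  val(c) \<le> j and 2 j + 1 otherwise, where val(c) = val(A) - (n - j).\<close>

lemma integral_pairs_residue_system:
  fixes A \<beta> :: "'q::finite_field fls"
  assumes \<beta>: "\<beta> \<noteq> 0" "ord \<beta> = int n" and j: "j \<le> n"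
  shows "A \<noteq> 0 \<Longrightarrow> ord A = int m \<Longrightarrow> m \<le> n \<Longrightarrow>
      \<exists>W. residue_system (integral_pairs A \<beta> j) W (min (n - j) m) (2 * m - min (n - j) m)"
    and "val_ge (int n + 1) A \<Longrightarrow>
      \<exists>W. residue_system (integral_pairs A \<beta> j) W (n - j) (2 * n + 1 - (n - j))"
proof -
  define c where "c = A / (ep (- int j) * \<beta>)"
  define N where "N = c * c - ep (int j) * (ep (int j) * fls_X)"
  have N2: "2 * k \<le> ord N \<longleftrightarrow> val_ge k c \<and> k \<le> int j"
    and N3: "2 * k + 1 \<le> ord N \<longleftrightarrow> val_ge (k + 1) c \<and> k \<le> int j" for k
    unfolding N_def using norm_E2(2,3)[of c "ep (int j)" k] by (simp_all add: val_ge_def[of _ "ep (int j)"])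
  have cv: "val_ge k c \<longleftrightarrow> val_ge (k + int (n - j)) A" for k
    using \<beta> j by (simp add: c_def val_ge_divide)
  have large: "\<exists>W. residue_system (integral_pairs A \<beta> j) W (n - j) f"
    if A: "val_ge (int (n - j)) A" and f: "int f = int (n - j) + ord N" for f
    using residue_system_shear[OF integral_pairs_large(2)[OF \<beta> j A], of f "n - j"]
    unfolding integral_pairs_large(1)[OF \<beta> j A] c_def[symmetric] N_def[symmetric] f[symmetric]
    \<comment> \<open>The shear lists the exponent belonging to x first, which is the larger one
      here.\<close>
    by (subst residue_system_commute)
  show "\<exists>W. residue_system (integral_pairs A \<beta> j) W (n - j) (2 * n + 1 - (n - j))"
    if A: "val_ge (int n + 1) A"
  proof (rule large)
    show "val_ge (int (n - j)) A" using A by (rule val_ge_mono) simp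
    have "val_ge (int j + 1) c" unfolding cv using A j by (simp add: of_nat_diff add.commute)
    then have "ord N = 2 * int j + 1" using N3[of "int j"] N2[of "int j + 1"] by simp
    then show "int (2 * n + 1 - (n - j)) = int (n - j) + ord N" using j by simp
  qed
  show "\<exists>W. residue_system (integral_pairs A \<beta> j) W (min (n - j) m) (2 * m - min (n - j) m)"
    if A: "A \<noteq> 0" "ord A = int m" "m \<le> n"
  proof (cases "m < n - j")
    case True
    have "residue_system (integral_pairs A \<beta> j) (prod.swap ` W) m m"
      if "residue_system {w. val_ge (- int m) (fst w) \<and> val_ge (- int m) (snd w - ep (- int j) * \<beta> / A * fst w)} W m m" for W
    proof -
      have "prod.swap ` {w. val_ge (- int m) (fst w) \<and> val_ge (- int m) (snd w - ep (- int j) * \<beta> / A * fst w)}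
        = integral_pairs A \<beta> j"
        unfolding integral_pairs_small(1)[OF \<beta> j A(1,2) True] by (auto simp: image_iff)
      then show ?thesis using residue_system_swap[OF that] by simp
    qed
    then show ?thesis
      using residue_system_shear[OF integral_pairs_small(2)[OF \<beta> j A(1,2) True], of m m] True by auto
  next
    case False
    have "val_ge (int m - int (n - j)) c" "\<not> val_ge (int m - int (n - j) + 1) c"
      unfolding cv using A by (simp_all add: val_ge_def)
    then have "ord N = 2 * (int m - int (n - j))"
      using N2[of "int m - int (n - j)"] N3[of "int m - int (n - j)"] A(3) j by simp
    then have "\<exists>W. residue_system (integral_pairs A \<beta> j) W (n - j) (2 * m - (n - j))"
      using A False j by (intro large) (auto simp: val_ge_def)
    moreover have "min (n - j) m = n - j" using False by simp
    ultimately show ?thesis by metis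
  qed
qed

text \<open>The columns span the lattice \<open>{(x, x u + l) | x \<in> O, l \<in> O_j}\<close> with \<open>O_j = O + \<epsilon>\<^sup>j \<epsilon>^(1/2) O\<close>; the
  extension class \<open>u \<in> E_2 / O_j\<close> is written in the basis \<open>\<epsilon>\<^sup>j \<epsilon>^(1/2), 1\<close> of \<open>O_j\<close> as \<open>w \<in> (F / O)\<^sup>2\<close>.\<close>

definition base :: "nat \<Rightarrow> 'q::finite_field fls \<times> 'q fls \<Rightarrow> 'q fls^3^3" where
  "base j w = mat3 1 0 0 (ep (int j) * fst w) (ep (int j)) 0 (snd w) 0 1"

definition base_inv :: "nat \<Rightarrow> 'q::finite_field fls \<times> 'q fls \<Rightarrow> 'q fls^3^3" where
  "base_inv j w = mat3 1 0 0 (- fst w) (ep (- int j)) 0 (- snd w) 0 1"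

lemma base_inv: "base j w ** base_inv j w = mat 1" "base_inv j w ** base j w = mat 1"
  "matrix_inv (base j w) = base_inv j w"
proof -
  have e: "ep (int j) * ep (- int j) = (1 :: 'a fls)" "ep (- int j) * (ep (int j) * x) = x" for x :: "'a fls"
    by (simp_all add: mult.assoc[symmetric] ep_mult)
  show 1: "base j w ** base_inv j w = mat 1"
    by (simp add: base_def base_inv_def mat_one_mat3 e)
  show "base_inv j w ** base j w = mat 1"
    by (simp add: base_def base_inv_def mat_one_mat3 e ep_mult)
  show "matrix_inv (base j w) = base_inv j w" using 1 by (rule matrix_inv_unique)
qed

lemma base_GL3: "base j w \<in> GL3" "det (base j w) = ep (int j)"
  by (simp_all add: base_def GL3_iff)

text \<open>The exponent of the class of \<open>w\<close> in \<open>(F / O)\<^sup>2\<close>, see \<open>depth_le_iff\<close>.\<close>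

definition depth :: "'q::finite_field fls \<times> 'q fls \<Rightarrow> nat" where
  "depth w = nat (- rowv (mat3 1 (- fst w) (- snd w) 0 1 0 0 0 1))"

lemma depth_le_iff: "depth w \<le> s \<longleftrightarrow> val_ge (- int s) (fst w) \<and> val_ge (- int s) (snd w)"
proof -
  have G: "mat3 1 (- fst w) (- snd w) 0 1 0 0 0 1 \<in> GL3" by (simp add: GL3_iff)
  have "depth w \<le> s \<longleftrightarrow> - int s \<le> rowv (mat3 1 (- fst w) (- snd w) 0 1 0 0 0 1)"
    unfolding depth_def by linarith
  then show ?thesis by (simp add: rowv_le_iff[OF G] forall_3)
qed

lemma rowv_base: "rowv (base j w) = 0"
proof -
  have "k \<le> rowv (base j w) \<longleftrightarrow> k \<le> 0" for k
    unfolding rowv_le_iff[OF base_GL3(1)] by (auto simp: base_def forall_3)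
  from this[of 0] this[of "rowv (base j w)"] show ?thesis by simp
qed

lemma colv_base: "- colv (base j w) = int (depth w)"
proof -
  let ?m = "mat3 1 (- fst w) (- snd w) 0 1 0 0 0 1"
  have G: "?m \<in> GL3" by (simp add: GL3_iff)
  have "dual (base j w) $ 1 = ?m $ 1"
    by (simp add: dual_def base_inv base_inv_def transpose_mat3 vec_eq_iff forall_3)
  then have "colv (base j w) = rowv ?m" by (simp add: colv_def rowv_def)
  moreover have "rowv ?m \<le> 0" using rowv_le_iff[OF G, of "rowv ?m"] by (auto simp: forall_3)
  ultimately show ?thesis by (simp add: depth_def)
qed

lemma base_integral_iff:
  fixes a b :: "'q::finite_field fps"
  assumes b: "b \<noteq> 0" "ord (fps_to_fls b) = int n"
  shows "base_inv j w ** gamma_elt a b ** base j w \<in> gl3_O \<longleftrightarrow>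
    j \<le> n \<and> w \<in> integral_pairs (fps_to_fls a) (fps_to_fls b) j"
proof -
  let ?A = "fps_to_fls a" and ?\<beta> = "fps_to_fls b"
  have \<beta>: "?\<beta> \<noteq> 0" using b by simp
  have eq: "base_inv j w ** gamma_elt a b ** base j w =
    mat3 ?A 0 0 (ep (- int j) * ?\<beta> * snd w - ?A * fst w) 0 (ep (- int j) * ?\<beta>)
      (?\<beta> * fls_X * (ep (int j) * fst w) - ?A * snd w) (?\<beta> * fls_X * ep (int j)) 0"
    by (simp add: gamma_mat3 base_def base_inv_def algebra_simps)
  \<comment> \<open>The only entry that restricts j: multiplication by b eps^(1/2) preserves O_j iff
    j \<le> n.\<close>
  have 1: "val_ge 0 (ep (- int j) * ?\<beta>) \<longleftrightarrow> j \<le> n" using b \<beta> by (simp add: val_ge_def)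
  have 2: "val_ge 0 (?\<beta> * fls_X * ep (int j))" using b \<beta> by (simp add: val_ge_def)
  show ?thesis
    unfolding eq gl3_O_mat3 integral_pairs_def mem_Collect_eq 1 using 2 val_ge_fps val_ge_zero by blast
qed

section \<open>Invariance of the integrality condition under the torus and GL_3(O)\<close>

lemma torus_commute_gamma: "t \<in> torus \<Longrightarrow> t ** gamma_elt a b = gamma_elt a b ** t"
  by (elim torus_cases) (simp add: tmat_def gamma_mat3 mult_ac)

lemma conj_torus:
  assumes t: "t \<in> torus" and g: "g \<in> GL3"
  shows "matrix_inv (t ** g) ** gamma_elt a b ** (t ** g) = matrix_inv g ** gamma_elt a b ** g"
proof -
  have tG: "t \<in> GL3" using t torus_GL3 by blast
  have "matrix_inv (t ** g) ** gamma_elt a b ** (t ** g)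
      = matrix_inv g ** matrix_inv t ** (gamma_elt a b ** t) ** g"
    by (simp add: matrix_inv_mult[OF tG g] matrix_mul_assoc)
  also have "\<dots> = matrix_inv g ** (matrix_inv t ** t) ** gamma_elt a b ** g"
    unfolding torus_commute_gamma[OF t, symmetric] by (simp add: matrix_mul_assoc)
  finally show ?thesis by (simp add: matrix_inv_GL3[OF tG])
qed

lemma conj_GL3_O:
  assumes g: "g \<in> GL3" and k: "k \<in> GL3_O"
  shows "matrix_inv (g ** k) ** x ** (g ** k) \<in> gl3_O \<longleftrightarrow> matrix_inv g ** x ** g \<in> gl3_O"
proof -
  have kG: "k \<in> GL3" "k \<in> gl3_O" "matrix_inv k \<in> gl3_O" using k by (auto simp: GL3_O_def)
  let ?y = "matrix_inv g ** x ** g"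
  have 1: "matrix_inv (g ** k) ** x ** (g ** k) = matrix_inv k ** ?y ** k"
    by (simp add: matrix_inv_mult[OF g kG(1)] matrix_mul_assoc)
  have 2: "?y = k ** (matrix_inv k ** ?y ** k) ** matrix_inv k"
  proof -
    have "k ** (matrix_inv k ** ?y ** k) ** matrix_inv k = (k ** matrix_inv k) ** ?y ** (k ** matrix_inv k)"
      by (simp only: matrix_mul_assoc)
    then show ?thesis by (simp add: matrix_inv_GL3[OF kG(1)])
  qed
  show ?thesis unfolding 1
    using gl3_O_mult[OF gl3_O_mult[OF kG(3)] kG(2), of ?y]
      gl3_O_mult[OF gl3_O_mult[OF kG(2)] kG(3), of "matrix_inv k ** ?y ** k"] 2 by metis
qed

text \<open>A column (p, q) of the lower block stands for q + p eps^(1/2), with norm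
  \<open>nrm p q\<close>. Since \<open>rowv g = 0\<close>, the first row can be made (1, 0, 0) over
  O, and s is taken from E_2 alone, with first entry 1.\<close>

lemma reduce_to_base:
  fixes g :: "'q::finite_field fls^3^3"
  assumes g: "g \<in> slice"
  obtains s j w k where "s \<in> torus" "s$1$1 = 1" "k \<in> GL3_O" "g = s ** base j w ** k"
proof -
  have G: "g \<in> GL3" "rowv g = 0" using g by (auto simp: slice_def)
  obtain k1 where k1: "k1 \<in> GL3_O" "(g ** k1)$1$2 = 0" "(g ** k1)$1$3 = 0"
    using row_reduction[OF G(1)] by blast
  obtain \<alpha> u1 h11 h12 u2 h21 h22 where gk1: "g ** k1 = mat3 \<alpha> 0 0 u1 h11 h12 u2 h21 h22"
    using k1(2,3) by (metis mat3_eta)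
  have k1G: "k1 \<in> GL3" using k1 GL3_O_subset by blast
  have gk1G: "g ** k1 \<in> GL3" using GL3_mult G k1G by blast
  then have det: "\<alpha> \<noteq> 0" "h11 * h22 - h12 * h21 \<noteq> 0" by (auto simp: gk1 GL3_iff)
  have "rowv (g ** k1) = 0" using rowv_right[OF G(1) k1(1)] G by simp
  then have "k \<le> 0 \<longleftrightarrow> val_ge k \<alpha>" for k
    using rowv_le_iff[OF gk1G, of k] by (simp add: gk1 forall_3)
  from this[of 0] this[of 1] have \<alpha>: "ord \<alpha> = 0" using det by (auto simp: val_ge_def)
  define nrm where "nrm p q = q * q - p * (p * fls_X)" for p q :: "'q fls"
  text \<open>The column of smaller valuation in \<open>E_2\<close> generates the lattice up to its multiplier order.\<close>
  have "\<exists>k2\<in>GL3_O. \<exists>p q p' q'. g ** k2 = mat3 1 0 0 (u1 / \<alpha>) p' p (u2 / \<alpha>) q' q \<and> p' * q - p * q' \<noteq> 0 \<and>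
      ord (nrm p q) \<le> ord (nrm p' q')"
  proof (cases "ord (nrm h12 h22) \<le> ord (nrm h11 h21)")
    case True
    let ?d = "diag3 (inverse \<alpha>) 1 1"
    have "?d \<in> GL3_O" using det \<alpha> by (simp add: GL3_O_iff gl3_O_mat3 val_ge_def)
    then have "k1 ** ?d \<in> GL3_O" using k1 GL3_O_mult by blast
    moreover have "g ** (k1 ** ?d) = mat3 1 0 0 (u1 / \<alpha>) h11 h12 (u2 / \<alpha>) h21 h22"
      using det by (simp add: matrix_mul_assoc gk1 divide_inverse)
    ultimately show ?thesis using True det by blast
  next
    case False
    let ?d = "mat3 (inverse \<alpha>) 0 0 0 0 1 0 1 0"
    have "?d \<in> GL3_O" using det \<alpha> by (simp add: GL3_O_iff gl3_O_mat3 val_ge_def)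
    then have "k1 ** ?d \<in> GL3_O" using k1 GL3_O_mult by blast
    moreover have "g ** (k1 ** ?d) = mat3 1 0 0 (u1 / \<alpha>) h12 h11 (u2 / \<alpha>) h22 h21"
      using det by (simp add: matrix_mul_assoc gk1 divide_inverse)
    moreover have "h12 * h21 - h11 * h22 \<noteq> 0" using det by (metis eq_iff_diff_eq_0)
    ultimately show ?thesis using False by (metis linear)
  qed
  then obtain k2 p q p' q' where k2: "k2 \<in> GL3_O" "g ** k2 = mat3 1 0 0 (u1 / \<alpha>) p' p (u2 / \<alpha>) q' q"
    "p' * q - p * q' \<noteq> 0" "ord (nrm p q) \<le> ord (nrm p' q')" by blast
  have nz: "q \<noteq> 0 \<or> p \<noteq> 0" "q' \<noteq> 0 \<or> p' \<noteq> 0" using k2(3) by auto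
  have N: "nrm p q \<noteq> 0" "nrm p' q' \<noteq> 0" using norm_E2(1)[OF nz(1)] norm_E2(1)[OF nz(2)] by (simp_all add: nrm_def)
  define I where "I = inverse (nrm p q)"
  have I: "I * nrm p q = 1" using N by (simp add: I_def)
  define s where "s = tmat 1 q p"
  have s: "s \<in> torus" "s$1$1 = 1" using nz by (auto simp: s_def tmat_def intro: tmat_in_torus[unfolded tmat_def])
  have sG: "s \<in> GL3" using s torus_GL3 by blast
  have sinv: "matrix_inv s = tmat 1 (q * I) (- (p * I))"
  proof (rule matrix_inv_unique)
    have "I * (q * q) = 1 + I * (p * (p * fls_X))" using I by (simp add: nrm_def algebra_simps)
    then show "s ** tmat 1 (q * I) (- (p * I)) = mat 1"
      by (simp add: s_def tmat_def mat_one_mat3 algebra_simps)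
  qed
  define v1 where "v1 = q * I * (u1 / \<alpha>) - p * I * (u2 / \<alpha>)"
  define v2 where "v2 = - (p * I * fls_X * (u1 / \<alpha>)) + q * I * (u2 / \<alpha>)"
  define x where "x = q * I * p' - p * I * q'"
  define y where "y = - (p * I * fls_X * p') + q * I * q'"
  \<comment> \<open>Division by q + p eps^(1/2) turns the chosen column into 1 = (0, 1).\<close>
  have sg: "matrix_inv s ** (g ** k2) = mat3 1 0 0 v1 x 0 v2 y 1"
  proof -
    have "- (p * I * fls_X * p) + q * I * q = 1" using I by (simp add: nrm_def algebra_simps)
    then show ?thesis
      by (simp add: k2(2) sinv tmat_def v1_def v2_def x_def y_def mult_ac)
  qed
  have "x = I * (p' * q - p * q')" by (simp add: x_def algebra_simps)
  then have x0: "x \<noteq> 0" using k2(3) N by (simp add: I_def)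
  \<comment> \<open>The norm is multiplicative, so the quotient of the other column by the chosen
    one has a norm of nonnegative valuation and is integral.\<close>
  have "nrm x y = I * I * nrm p q * nrm p' q'"
    by (simp add: nrm_def x_def y_def algebra_simps)
  also have "\<dots> = I * nrm p' q'" using I by (simp add: mult.assoc)
  finally have "ord (nrm x y) = ord (nrm p' q') - ord (nrm p q)"
    using N by (simp add: I_def)
  then have "2 * 0 \<le> ord (nrm x y)" using k2(4) by simp
  then have xy: "val_ge 0 y" "val_ge 0 x"
    using norm_E2(2)[of y x 0] x0 by (simp_all add: nrm_def)
  define j where "j = nat (ord x)"
  have j: "int j = ord x" using xy x0 by (simp add: j_def val_ge_def)
  define c where "c = ep (int j) / x"
  have c: "x * c = ep (int j)" "c \<noteq> 0" "ord c = 0" "val_ge 0 c"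
    using x0 by (simp_all add: c_def j fls_divide_subdegree val_ge_def)
  \<comment> \<open>Scales the second column by the unit c, which turns x into eps^j, and clears y
    with the column (0, 1).\<close>
  let ?k3 = "mat3 1 0 0 0 c 0 0 (- (y * c)) 1"
  have k3: "?k3 \<in> GL3_O"
    using c val_ge_mult0[OF xy(1) c(4)] by (simp add: GL3_O_iff gl3_O_mat3)
  define w where "w = (ep (- int j) * v1, v2)"
  have sgk: "matrix_inv s ** (g ** k2) ** ?k3 = base j w"
    unfolding sg by (simp add: base_def w_def c mult.assoc[symmetric] ep_mult)
  have "s ** base j w = (s ** matrix_inv s) ** g ** (k2 ** ?k3)"
    unfolding sgk[symmetric] by (simp only: matrix_mul_assoc)
  then have sb: "s ** base j w = g ** (k2 ** ?k3)" by (simp add: matrix_inv_GL3[OF sG])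
  have k: "k2 ** ?k3 \<in> GL3_O" using k2 k3 GL3_O_mult by blast
  then have kG: "k2 ** ?k3 \<in> GL3" using GL3_O_subset by blast
  have "g = g ** ((k2 ** ?k3) ** matrix_inv (k2 ** ?k3))" by (simp add: matrix_inv_GL3[OF kG])
  also have "\<dots> = s ** base j w ** matrix_inv (k2 ** ?k3)" by (simp only: sb matrix_mul_assoc)
  finally show ?thesis using that s GL3_O_inv[OF k] by blast
qed

text \<open>Compensates the determinant eps^j of \<open>base j w\<close>, as \<open>slice\<close>
  requires, without touching the first coordinate.\<close>

definition shift :: "nat \<Rightarrow> 'q::finite_field fls^3^3" where
  "shift j = (SOME t. t \<in> torus \<and> t$1$1 = 1 \<and> ord (det t) = - int j)"

lemma shift: "(shift j :: 'q::finite_field fls^3^3) \<in> torus" "(shift j :: 'q fls^3^3) $ 1 $ 1 = 1" "ord (det (shift j :: 'q fls^3^3)) = - int j"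
proof -
  obtain t :: "'q fls^3^3" where t: "t \<in> torus" "ord (t$1$1) = 0" "ord (det t) = - int j"
    using torus_valuations_surj by blast
  then obtain x y z where xyz: "t = tmat x y z" "x \<noteq> 0" "y \<noteq> 0 \<or> z \<noteq> 0" by (blast elim: torus_cases)
  have "ord (det (tmat 1 y z)) = - int j"
    using t xyz norm_E2(1)[OF xyz(3)] by (simp add: tmat_def)
  then have "tmat 1 y z \<in> torus \<and> tmat 1 y z $ 1 $ 1 = 1 \<and> ord (det (tmat 1 y z)) = - int j"
    using tmat_in_torus[of 1 y z] xyz(3) by (simp add: tmat_def)
  then have "(shift j :: 'q fls^3^3) \<in> torus \<and> shift j $ 1 $ 1 = (1 :: 'q fls) \<and>
      ord (det (shift j :: 'q fls^3^3)) = - int j"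
    unfolding shift_def by (rule someI)
  then show "(shift j :: 'q fls^3^3) \<in> torus" "shift j $ 1 $ 1 = (1 :: 'q fls)"
    "ord (det (shift j :: 'q fls^3^3)) = - int j" by auto
qed

text \<open>The parameter z runs through the units of O_(E_2) modulo those of O_j: up to a unit of
  O, every unit of O_(E_2) is 1 + z eps^(1/2), and z matters only modulo eps^j.\<close>

definition rep :: "nat \<Rightarrow> 'q::finite_field fls \<Rightarrow> 'q fls \<times> 'q fls \<Rightarrow> 'q fls^3^3" where
  "rep j z w = shift j ** tmat 1 1 z ** base j w"

text \<open>The element e1 + e2 eps^(1/2) is a unit of O_j. The lower block of k is its
  multiplication matrix in the basis eps^j eps^(1/2), 1 of O_j, so only the extension class
  changes.\<close>

lemma torus_unit_absorb:
  fixes e1 e2 :: "'q::finite_field fls"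
  assumes e: "val_ge 0 e1" "val_ge (int j) e2" "e1 \<noteq> 0 \<or> e2 \<noteq> 0" "ord (e1 * e1 - e2 * (e2 * fls_X)) = 0"
  shows "\<exists>w'. \<exists>k\<in>GL3_O. tmat 1 e1 e2 ** base j w = base j w' ** k"
proof -
  let ?k = "mat3 1 0 0 0 e1 (ep (- int j) * e2) 0 (ep (int j) * (e2 * fls_X)) e1"
  define u1 where "u1 = e1 * (ep (int j) * fst w) + e2 * snd w"
  define u2 where "u2 = e2 * fls_X * (ep (int j) * fst w) + e1 * snd w"
  have c: "ep (int j) * (ep (- int j) * x) = x" "ep (- int j) * (ep (int j) * x) = x" for x :: "'q fls"
    by (simp_all add: mult.assoc[symmetric] ep_mult)
  have "ep (- int j) * e2 * (ep (int j) * (e2 * fls_X)) = e2 * (e2 * fls_X)"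
    using c(2)[of "e2 * (e2 * fls_X)"] by (simp add: mult_ac)
  then have det: "det ?k = e1 * e1 - e2 * (e2 * fls_X)" by simp
  have "val_ge 0 e2" using e(2) by (rule val_ge_mono) simp
  then have "val_ge 0 (ep (int j) * (e2 * fls_X))"
    using val_ge_mult0[of e2 0 "ep (int j) * fls_X"] by (simp add: mult_ac val_ge_mult_right)
  then have "?k \<in> GL3_O"
    using e norm_E2(1)[OF e(3)] by (simp only: GL3_O_iff gl3_O_mat3 det) simp
  moreover have "tmat 1 e1 e2 ** base j w = base j (ep (- int j) * u1, u2) ** ?k"
    by (simp add: tmat_def base_def c ep_mult u1_def u2_def mult_ac)
  ultimately show ?thesis by blast
qed

text \<open>After \<open>shift j\<close> is removed, a unit y + z' eps^(1/2) remains. It is divided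
  by 1 + z eps^(1/2), where z is z' / y reduced modulo eps^j; the quotient lies in O_j because its
  second coordinate is a unit times z' - z y.\<close>

lemma torus_decompose:
  fixes s :: "'q::finite_field fls^3^3"
  assumes s: "s \<in> torus" "s$1$1 = 1" "ord (det s) = - int j"
  obtains z e1 e2 where "z \<in> residues j" "s = shift j ** tmat 1 1 z ** tmat 1 e1 e2"
    "val_ge 0 e1" "val_ge (int j) e2" "e1 \<noteq> 0 \<or> e2 \<noteq> 0" "ord (e1 * e1 - e2 * (e2 * fls_X)) = 0"
proof -
  have shG: "(shift j :: 'q fls^3^3) \<in> GL3" "(shift j :: 'q fls^3^3) \<in> M0" "s \<in> GL3"
    using shift(1) torus_GL3 torus_M0 s by blast+
  define s' where "s' = matrix_inv (shift j) ** s"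
  have ss': "s = shift j ** s'" by (simp add: s'_def matrix_mul_assoc matrix_inv_GL3[OF shG(1)])
  have s': "s' \<in> torus" unfolding s'_def using torus_mult torus_inv shift(1) s by blast
  then obtain x y z' where xyz: "s' = tmat x y z'" "x \<noteq> 0" "y \<noteq> 0 \<or> z' \<noteq> 0" by (rule torus_cases)
  have "s$1$1 = shift j$1$1 * s'$1$1"
    unfolding ss' using s' torus_M0 by (intro M0_mult_nth(1)[OF shG(2)]) blast
  then have "x = 1" using s shift(2)[where 'q = 'q] by (simp add: xyz tmat_def)
  have "det s = det (shift j) * det s'" unfolding ss' by (rule det_mul)
  moreover have ds': "det s' = y * y - z' * (z' * fls_X)" by (simp add: xyz tmat_def \<open>x = 1\<close>)
  ultimately have N: "ord (y * y - z' * (z' * fls_X)) = 0"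
    using s(3) shift(3)[where 'q = 'q] norm_E2(1)[OF xyz(3)] shG(1) by (simp add: GL3_iff)
  have y: "y \<noteq> 0" "ord y = 0" "val_ge 0 z'"
    using norm_E2(2)[OF xyz(3), of 0] norm_E2(3)[OF xyz(3), of 0] N by (auto simp: val_ge_def)
  then have "val_ge 0 (z' / y)" by (simp add: val_ge_divide)
  then obtain z where z: "z \<in> residues j" "val_ge (int j) (z' / y - z)" using residues_reduce by blast
  have "y * (z' / y - z) = z' - z * y" using y by (simp add: algebra_simps)
  then have zz: "val_ge (int j) (z' - z * y)"
    using z(2) y val_ge_mult_left[of y "int j" "z' / y - z"] by simp
  have z0: "val_ge 0 z" using z by (simp add: residues_def)
  define M where "M = 1 * 1 - z * (z * fls_X)"
  have M: "M \<noteq> 0" "ord M = 0"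
    using norm_E2(1)[of 1 z] norm_E2(2)[of 1 z 0] norm_E2(3)[of 1 z 0] z0 by (auto simp: M_def)
  define I where "I = inverse M"
  have I: "val_ge 0 I" "I * (1 - z * (z * fls_X)) = 1" using M by (simp_all add: I_def val_ge_def M_def)
  define e1 where "e1 = I * (y - z * (z' * fls_X))"
  define e2 where "e2 = I * (z' - z * y)"
  have "e1 + z * (e2 * fls_X) = (I * (1 - z * (z * fls_X))) * y" "e2 + z * e1 = (I * (1 - z * (z * fls_X))) * z'"
    by (simp_all add: e1_def e2_def algebra_simps)
  then have e: "e1 + z * (e2 * fls_X) = y" "e2 + z * e1 = z'" by (simp_all only: I(2) mult_1)
  have prod: "s' = tmat 1 1 z ** tmat 1 e1 e2"
    using e by (simp add: xyz \<open>x = 1\<close> tmat_def) (simp add: algebra_simps flip: e)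
  have nz: "e1 \<noteq> 0 \<or> e2 \<noteq> 0" using e xyz(3) by auto
  have "det s' = det (tmat 1 1 z) * det (tmat 1 e1 e2)" unfolding prod by (rule det_mul)
  then have "y * y - z' * (z' * fls_X) = M * (e1 * e1 - e2 * (e2 * fls_X))"
    unfolding ds' by (simp add: tmat_def M_def)
  then have "ord (e1 * e1 - e2 * (e2 * fls_X)) = 0"
    using N M norm_E2(1)[OF nz] by simp
  moreover have "val_ge 0 (z' * fls_X)" using val_ge_mono[OF y(3), of "-1"] by (simp add: val_ge_mult_right)
  then have "val_ge 0 e1"
    unfolding e1_def using I y z0 by (intro val_ge_mult0 val_ge_diff) (auto simp: val_ge_def[of _ y])
  moreover have "val_ge (int j) e2" unfolding e2_def using I(1) zz by (rule val_ge_mult0)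
  moreover have "s = shift j ** tmat 1 1 z ** tmat 1 e1 e2"
    unfolding ss' prod by (rule matrix_mul_assoc)
  ultimately show ?thesis using that z(1) nz by blast
qed

lemma slice_rep:
  fixes g :: "'q::finite_field fls^3^3"
  assumes g: "g \<in> slice"
  obtains j z w k where "z \<in> residues j" "k \<in> GL3_O" "g = rep j z w ** k"
proof -
  obtain s j w k where s: "s \<in> torus" "s$1$1 = 1" "k \<in> GL3_O" "g = s ** base j w ** k"
    using reduce_to_base[OF g] .
  have sG: "s \<in> GL3" using s torus_GL3 by blast
  have "det g = det s * det (base j w) * det k" by (simp add: s det_mul)
  moreover have "det s \<noteq> 0" "det k \<noteq> 0" "ord (det k) = 0"
    using s(3) sG by (simp_all add: GL3_O_iff GL3_iff)
  ultimately have "ord (det g) = ord (det s) + int j" by (simp add: base_GL3)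
  then have "ord (det s) = - int j" using g by (simp add: slice_def)
  then obtain z e1 e2 where z: "z \<in> residues j" "s = shift j ** tmat 1 1 z ** tmat 1 e1 e2" and
    e: "val_ge 0 e1" "val_ge (int j) e2" "e1 \<noteq> 0 \<or> e2 \<noteq> 0" "ord (e1 * e1 - e2 * (e2 * fls_X)) = 0"
    using torus_decompose[OF s(1,2)] by metis
  obtain w' k' where k': "k' \<in> GL3_O" "tmat 1 e1 e2 ** base j w = base j w' ** k'"
    using torus_unit_absorb[OF e] by blast
  have "g = shift j ** tmat 1 1 z ** (tmat 1 e1 e2 ** base j w) ** k"
    by (simp add: s(4) z(2) matrix_mul_assoc)
  also have "\<dots> = rep j z w' ** (k' ** k)" by (simp only: k' rep_def matrix_mul_assoc)
  finally show ?thesis using that z(1) GL3_O_mult[OF k'(1) s(3)] by blast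
qed

lemma rep_shift: "shift j ** tmat 1 1 z \<in> torus"
  by (intro torus_mult shift tmat_in_torus) auto

lemma rep_shift_11: "(shift j ** tmat 1 1 z)$1$1 = 1"
proof -
  have "shift j \<in> M0" "tmat 1 1 z \<in> M0"
    using torus_M0 shift(1) tmat_in_torus[of 1 1 z] by auto
  then have "(shift j ** tmat 1 1 z)$1$1 = shift j$1$1 * tmat 1 1 z$1$1" by (rule M0_mult_nth(1))
  also have "\<dots> = 1" by (simp add: shift(2) tmat_def)
  finally show ?thesis .
qed

lemma rep_in_slice:
  assumes "z \<in> residues j" shows "rep j z w \<in> slice"
proof -
  have z: "val_ge 0 z" using assms by (simp add: residues_def)
  have N: "1 * 1 - z * (z * fls_X) \<noteq> 0" "ord (1 * 1 - z * (z * fls_X)) = 0"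
    using norm_E2(1)[of 1 z] norm_E2(2)[of 1 z 0] norm_E2(3)[of 1 z 0] z by auto
  have "det (tmat 1 1 z) = 1 * 1 - z * (z * fls_X)" by (simp add: tmat_def)
  then have d: "det (shift j ** tmat 1 1 z) = det (shift j) * (1 * 1 - z * (z * fls_X))"
    by (simp only: det_mul)
  have "(shift j :: 'a fls^3^3) \<in> GL3" using shift(1) torus_GL3 by blast
  then have "det (shift j :: 'a fls^3^3) \<noteq> 0" by (simp add: GL3_iff)
  then have "ord (det (shift j ** tmat 1 1 z)) = - int j"
    unfolding d fls_subdegree_mult[OF \<open>det (shift j) \<noteq> 0\<close> N(1)] N(2) shift(3) by simp
  then show ?thesis
    using torus_action(1-3)[OF rep_shift[of j z] base_GL3(1)[of j w]]
    by (simp add: slice_def rep_def rep_shift_11 rowv_base base_GL3)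
qed

text \<open>The torus element x relating the two representatives maps O_j' onto O_j. So x, the image
  of 1, lies in O_j and has integral norm, and comparing determinants gives j' \<le> j. Exchanging
  the representatives yields the opposite inequality.\<close>

lemma rep_le:
  fixes z z' :: "'q::finite_field fls"
  assumes z: "z \<in> residues j" "z' \<in> residues j'" and k: "k \<in> GL3_O" and eq: "rep j' z' w' = rep j z w ** k"
  obtains x1 x2 where "shift j' ** tmat 1 1 z' = shift j ** tmat 1 1 z ** tmat 1 x1 x2"
    "k = base_inv j w ** tmat 1 x1 x2 ** base j' w'" "j' \<le> j" "val_ge (int j) x2" "x1 \<noteq> 0 \<or> x2 \<noteq> 0"
proof -
  define p where "p = shift j ** tmat 1 1 z"
  define p' where "p' = shift j' ** tmat 1 1 z'"
  have p: "p \<in> torus" "p' \<in> torus" by (simp_all add: p_def p'_def rep_shift)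
  have pG: "p \<in> GL3" using p torus_GL3 by blast
  define x where "x = matrix_inv p ** p'"
  have px: "p' = p ** x" by (simp add: x_def matrix_mul_assoc matrix_inv_GL3[OF pG])
  have "x \<in> torus" unfolding x_def using torus_mult torus_inv p by blast
  then obtain x0 x1 x2 where x: "x = tmat x0 x1 x2" "x0 \<noteq> 0" "x1 \<noteq> 0 \<or> x2 \<noteq> 0" by (rule torus_cases)
  have sl: "rep j z w \<in> slice" "rep j' z' w' \<in> slice" using z rep_in_slice by blast+
  have rp: "rep j z w = p ** base j w" "rep j' z' w' = p' ** base j' w'" by (simp_all add: rep_def p_def p'_def)
  have "p ** (x ** base j' w') = p ** (base j w ** k)"
    using eq by (simp add: rp px matrix_mul_assoc)
  then have "matrix_inv p ** p ** (x ** base j' w') = matrix_inv p ** p ** (base j w ** k)"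
    by (metis matrix_mul_assoc)
  then have xb: "x ** base j' w' = base j w ** k" by (simp add: matrix_inv_GL3[OF pG])
  have keq: "k = base_inv j w ** x ** base j' w'"
  proof -
    have "base_inv j w ** x ** base j' w' = (base_inv j w ** base j w) ** k"
      by (simp only: matrix_mul_assoc[symmetric] xb)
    then show ?thesis by (simp add: base_inv)
  qed
  have "p$1$1 = 1" "p'$1$1 = 1" unfolding p_def p'_def by (rule rep_shift_11)+
  moreover have "p'$1$1 = p$1$1 * x$1$1"
    unfolding px using p \<open>x \<in> torus\<close> torus_M0 by (intro M0_mult_nth(1)) blast+
  ultimately have x0: "x0 = 1" by (simp add: x tmat_def)
  have "k \<in> gl3_O" using k GL3_O_subset by blast
  then have "val_ge 0 (k$3$3)" "val_ge 0 (k$2$3)" by (simp_all add: gl3_O_iff)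
  then have v: "val_ge 0 x1" "val_ge (int j) x2"
    by (simp_all add: keq x base_inv_def base_def tmat_def)
  then have "val_ge 0 x2" by (auto elim: val_ge_mono)
  then have "0 \<le> ord (det x)"
    using norm_E2(2)[OF x(3), of 0] v by (simp add: x x0 tmat_def)
  moreover have "det x * ep (int j') = ep (int j) * det k"
    using arg_cong[OF xb, of det] by (simp add: det_mul base_GL3)
  then have "ord (det x * ep (int j')) = ord (ep (int j) * det k)" by simp
  then have "ord (det x) + int j' = int j"
    using k norm_E2(1)[OF x(3)] by (simp add: GL3_O_iff x x0 tmat_def)
  ultimately have "j' \<le> j" by simp
  then show ?thesis
    using that px keq v(2) x(3) by (simp only: x x0 p_def p'_def)
qed

lemma rep_unique:
  fixes z z' :: "'q::finite_field fls"
  assumes z: "z \<in> residues j" "z' \<in> residues j'" and k: "k \<in> GL3_O" and eq: "rep j' z' w' = rep j z w ** k"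
  shows "j' = j \<and> z' = z \<and> val_ge 0 (fst w' - fst w) \<and> val_ge 0 (snd w' - snd w)"
proof -
  obtain x1 x2 where x: "shift j' ** tmat 1 1 z' = shift j ** tmat 1 1 z ** tmat 1 x1 x2"
    "k = base_inv j w ** tmat 1 x1 x2 ** base j' w'" "j' \<le> j" "val_ge (int j) x2" "x1 \<noteq> 0 \<or> x2 \<noteq> 0"
    using rep_le[OF z k eq] .
  have kG: "k \<in> GL3" using k GL3_O_subset by blast
  have "rep j z w = rep j z w ** (k ** matrix_inv k)" by (simp add: matrix_inv_GL3[OF kG])
  also have "\<dots> = rep j' z' w' ** matrix_inv k" by (simp only: matrix_mul_assoc eq)
  finally have eq': "rep j z w = rep j' z' w' ** matrix_inv k" .
  have "j \<le> j'" using rep_le[OF z(2,1) GL3_O_inv[OF k] eq'] .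
  then have j: "j' = j" using x(3) by simp
  have shG: "(shift j :: 'q fls^3^3) \<in> GL3" using shift(1) torus_GL3 by blast
  have "matrix_inv (shift j) ** (shift j ** tmat 1 1 z') = matrix_inv (shift j) ** (shift j ** (tmat 1 1 z ** tmat 1 x1 x2))"
    using x(1) by (simp only: j matrix_mul_assoc)
  then have "tmat 1 1 z' = tmat 1 1 z ** tmat 1 x1 x2"
    by (simp only: matrix_mul_assoc matrix_inv_GL3[OF shG] matrix_mul_lid)
  then have e: "1 = x1 + z * (x2 * fls_X)" "z' = x2 + z * x1"
    by (simp_all add: tmat_def)
  have z0: "val_ge 0 z" "val_ge 0 z'" using z by (simp_all add: residues_def)
  \<comment> \<open>The first equation of \<open>e\<close> times z; it eliminates x1 from the second
    and shows that eps^j divides z' - z.\<close>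
  have z_eq: "z = z * x1 + z * (z * (x2 * fls_X))"
    using arg_cong[OF e(1), of "(*) z"] by (simp add: distrib_left)
  have "z' - z = x2 + z * x1 - (z * x1 + z * (z * (x2 * fls_X)))" using e(2) z_eq by metis
  then have "z' - z = x2 - z * (z * (x2 * fls_X))" by simp
  moreover have "val_ge (int j) (fls_X * x2)" using val_ge_mult0[of fls_X "int j" x2] x(4) by simp
  ultimately have "val_ge (int j) (z' - z)"
    using x(4) z0 by (simp add: mult.commute[of x2]) (intro val_ge_diff val_ge_mult0; simp)
  then have zz: "z' = z" using residues_unique z j by blast
  \<comment> \<open>With z' = z the same elimination leaves x2 times the norm of 1 + z eps^(1/2),
    which is nonzero.\<close>
  have "x2 + z * x1 = z * x1 + z * (z * (x2 * fls_X))" using e(2) z_eq zz by metis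
  then have "x2 * (1 * 1 - z * (z * fls_X)) = 0" by (simp add: algebra_simps)
  then have "x2 = 0" using norm_E2(1)[of 1 z] by simp
  then have "x1 = 1" using e by simp
  have "k = base_inv j w ** (tmat 1 1 0 ** base j w')" using x(2) by (simp add: j \<open>x1 = 1\<close> \<open>x2 = 0\<close> matrix_mul_assoc)
  then have "k$2$1 = fst w' - fst w" "k$3$1 = snd w' - snd w"
    by (simp_all add: base_inv_def base_def tmat_def) (simp_all add: mult.assoc[symmetric] ep_mult)
  moreover have "val_ge 0 (k$2$1)" "val_ge 0 (k$3$1)" using k by (simp_all add: GL3_O_iff gl3_O_iff)
  ultimately show ?thesis using j zz by simp
qed

text \<open>The unipotent factor lies in \<open>GL3_O\<close> when w and w' agree modulo O^2, so the
  lattice depends only on the extension class.\<close>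

lemma base_shear:
  "base j w ** mat3 1 0 0 (fst w' - fst w) 1 0 (snd w' - snd w) 0 1 = base j w'"
  by (simp add: base_def algebra_simps)

section \<open>The orbital integral as a finite sum\<close>

definition conj_weight ::
  "('q::finite_field functional \<Rightarrow> 'q functional \<Rightarrow> real)
    \<Rightarrow> 'q fls^3^3 \<Rightarrow> 'q fls^3^3 \<Rightarrow> real" where
  "conj_weight B \<gamma> g = indicator gl3_O (matrix_inv g ** \<gamma> ** g) * weight_M0 B g"

lemma conj_weight_torus:
  assumes "weyl_inner_product B" "t \<in> torus" "g \<in> GL3"
  shows "conj_weight B (gamma_elt a b) (t ** g) = conj_weight B (gamma_elt a b) g"
  using torus_action[OF assms(2,3)]
  by (simp add: conj_weight_def conj_torus[OF assms(2,3)] weight_M0_rowv_colv[OF assms(1)] assms(3))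

lemma conj_weight_GL3_O:
  assumes "weyl_inner_product B" "g \<in> GL3" "k \<in> GL3_O"
  shows "conj_weight B x (g ** k) = conj_weight B x g"
proof -
  have "g ** k \<in> GL3" using GL3_mult assms GL3_O_subset by blast
  then show ?thesis
    using assms(2,3) conj_GL3_O[OF assms(2,3), of x]
    by (simp add: conj_weight_def weight_M0_rowv_colv[OF assms(1)] rowv_right colv_right indicator_def)
qed

lemma conj_weight_base:
  fixes a b :: "'q::finite_field fps"
  assumes "weyl_inner_product B" "b \<noteq> 0" "ord (fps_to_fls b) = int n" "j \<le> n"
    "w \<in> integral_pairs (fps_to_fls a) (fps_to_fls b) j"
  shows "conj_weight B (gamma_elt a b) (base j w) = covol_M0 B * real (depth w)"
  using assms(4,5) base_integral_iff[OF assms(2,3), of j w a]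
  by (simp add: conj_weight_def base_inv weight_M0_rowv_colv[OF assms(1) base_GL3(1)] rowv_base colv_base)

text \<open>A representative differs from \<open>base j w\<close> by a torus element, so the
  integrand does not depend on z, and summation over \<open>residues j\<close> contributes the
  factor q^j.\<close>

lemma orbital_integral_eq_sum:
  fixes a b :: "'q::finite_field fps"
    and B :: "'q functional \<Rightarrow> 'q functional \<Rightarrow> real"
  assumes b: "b \<noteq> 0" "ord (fps_to_fls b) = int n"
    and inner: "weyl_inner_product B"
    and haar_G: "haar_measure GL3 \<mu>" "emeasure \<mu> GL3_O = 1"
    and haar_T: "haar_measure (centralizer (gamma_elt a b)) \<tau>" "emeasure \<tau> T_compact = 1"
    and quot: "quotient_measure (centralizer (gamma_elt a b)) \<mu> \<tau> \<nu>"
    and W: "\<And>j. j \<le> n \<Longrightarrow> \<exists>W. residue_system (integral_pairs (fps_to_fls a) (fps_to_fls b) j) W (e1 j) (e2 j)"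
    and e: "\<And>j. j \<le> n \<Longrightarrow> e1 j \<le> e2 j"
  shows "integrable \<nu> (orbital_integrand B (gamma_elt a b)) \<and>
    J_M0 B \<nu> (gamma_elt a b) = covol_M0 B * (\<Sum>j\<le>n. real CARD('q) ^ j *
      (real (e2 j) * real CARD('q) ^ (e1 j + e2 j) - (\<Sum>s<e2 j. real CARD('q) ^ (min s (e1 j) + s))))"
proof -
  let ?S = "integral_pairs (fps_to_fls a) (fps_to_fls b)"
  define F where "F = conj_weight B (gamma_elt a b)"
  have "\<forall>j\<in>{..n}. \<exists>W. residue_system (?S j) W (e1 j) (e2 j)" using W by simp
  then obtain W where "\<forall>j\<in>{..n}. residue_system (?S j) (W j) (e1 j) (e2 j)" by (rule bchoice[THEN exE])
  then have W: "residue_system (?S j) (W j) (e1 j) (e2 j)" if "j \<le> n" for j using that by simp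
  have W_fin: "finite (W j)" and W_sub: "W j \<subseteq> ?S j"
    and W_uniq: "\<And>w v. w \<in> W j \<Longrightarrow> v \<in> W j \<Longrightarrow> val_ge 0 (fst w - fst v) \<Longrightarrow> val_ge 0 (snd w - snd v) \<Longrightarrow> w = v"
    and W_cov: "\<And>w. w \<in> ?S j \<Longrightarrow> \<exists>v\<in>W j. val_ge 0 (fst w - fst v) \<and> val_ge 0 (snd w - snd v)"
    if "j \<le> n" for j
    using W[OF that] unfolding residue_system_def by blast+
  \<comment> \<open>The triples (j, z, w) give distinct cosets of \<open>GL3_O\<close>, and these
    exhaust the part of \<open>slice\<close> where the integrand is nonzero.\<close>
  define X where "X = Sigma {..n} (\<lambda>j. (residues j :: 'q fls set) \<times> W j)"
  define r where "r x = rep (fst x) (fst (snd x)) (snd (snd x))" for x :: "nat \<times> 'q fls \<times> 'q fls \<times> 'q fls"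
  have X: "finite X" unfolding X_def by (intro finite_SigmaI finite_cartesian_product residues_card W_fin) auto
  have r_eq: "x' = x" if x: "x \<in> X" "x' \<in> X" and k: "k \<in> GL3_O" "r x' = r x ** k" for x x' k
  proof -
    obtain j z w j' z' w' where xs: "x = (j, z, w)" "x' = (j', z', w')" by (metis prod_cases3)
    have m: "j \<le> n" "z \<in> residues j" "w \<in> W j" "j' \<le> n" "z' \<in> residues j'" "w' \<in> W j'"
      using x by (auto simp: X_def xs)
    have "j' = j \<and> z' = z \<and> val_ge 0 (fst w' - fst w) \<and> val_ge 0 (snd w' - snd w)"
      using rep_unique[OF m(2,5) k(1)] k(2) by (simp add: r_def xs)
    then show "x' = x" using W_uniq[of j w' w] m by (auto simp: xs)
  qed
  have inj: "inj_on r X"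
  proof (rule inj_onI)
    fix x x' assume "x \<in> X" "x' \<in> X" "r x = r x'"
    then show "x = x'" using r_eq[of x' x "mat 1"] GL3_O_one by simp
  qed
  have Fr: "F (r x) = covol_M0 B * real (depth (snd (snd x)))" if x: "x \<in> X" for x
  proof -
    obtain j z w where xs: "x = (j, z, w)" by (metis prod_cases3)
    have m: "j \<le> n" "w \<in> ?S j" using x W_sub by (auto simp: X_def xs)
    show ?thesis
      unfolding F_def r_def rep_def xs fst_conv snd_conv conj_weight_torus[OF inner rep_shift base_GL3(1)]
      by (rule conj_weight_base[OF inner b m])
  qed
  have T: "centralizer (gamma_elt a b) = torus" by (rule centralizer_gamma[OF b(1)])
  have "integrable \<nu> (\<lambda>C. F (SOME g. g \<in> C)) \<and> (LINT C|\<nu>. F (SOME g. g \<in> C)) = (\<Sum>g\<in>r ` X. F g)"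
  proof (rule quotient_integral[OF haar_G haar_T[unfolded T] quot[unfolded T]])
    show "F g \<ge> 0" for g by (simp add: F_def conj_weight_def weight_M0_def)
    show "F (t ** g) = F g" if "t \<in> torus" "g \<in> GL3" for t g
      unfolding F_def by (rule conj_weight_torus[OF inner that])
    show "F (g ** k) = F g" if "g \<in> GL3" "k \<in> GL3_O" for g k
      unfolding F_def by (rule conj_weight_GL3_O[OF inner that])
    show "finite (r ` X)" using X by simp
    show "r ` X \<subseteq> slice" by (auto simp: r_def X_def intro: rep_in_slice)
    show "g' = g" if g: "g \<in> r ` X" "g' \<in> r ` X" "k \<in> GL3_O" "g' = g ** k" for g g' k
    proof -
      obtain x x' where "x \<in> X" "g = r x" "x' \<in> X" "g' = r x'" using g(1,2) by (elim imageE)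
      then show ?thesis using r_eq[of x x' k] g(3,4) by metis
    qed
    show "\<exists>h\<in>r ` X. \<exists>k\<in>GL3_O. g = h ** k" if g: "g \<in> slice" "F g \<noteq> 0" for g
    proof -
      obtain j z w k where z: "z \<in> residues j" and k: "k \<in> GL3_O" and gr: "g = rep j z w ** k"
        using slice_rep[OF g(1)] .
      have G: "rep j z w \<in> GL3" using rep_in_slice[OF z] by (simp add: slice_def)
      have "matrix_inv g ** gamma_elt a b ** g \<in> gl3_O"
        using g(2) by (auto simp: F_def conj_weight_def indicator_def split: if_splits)
      then have "matrix_inv (rep j z w) ** gamma_elt a b ** rep j z w \<in> gl3_O"
        unfolding gr conj_GL3_O[OF G k] .
      then have "base_inv j w ** gamma_elt a b ** base j w \<in> gl3_O"
        unfolding rep_def conj_torus[OF rep_shift base_GL3(1)] base_inv .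
      then have j: "j \<le> n" "w \<in> ?S j" by (simp_all add: base_integral_iff[OF b])
      obtain v where v: "v \<in> W j" "val_ge 0 (fst w - fst v)" "val_ge 0 (snd w - snd v)"
        using W_cov[OF j] by blast
      \<comment> \<open>Replaces w by its representative v at the cost of an integral unipotent
        factor.\<close>
      let ?k = "mat3 1 0 0 (fst w - fst v) 1 0 (snd w - snd v) 0 1"
      have "?k \<in> GL3_O" using v by (simp add: GL3_O_iff gl3_O_mat3)
      moreover have "g = rep j z v ** (?k ** k)"
        unfolding gr rep_def base_shear[of j v w, symmetric] by (simp only: matrix_mul_assoc)
      moreover have "(j, z, v) \<in> X" using j z v by (simp add: X_def)
      then have "rep j z v \<in> r ` X" by (force simp: r_def)
      ultimately show ?thesis using GL3_O_mult[OF _ k] by blast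
    qed
  qed
  moreover have "orbital_integrand B (gamma_elt a b) = (\<lambda>C. F (SOME g. g \<in> C))"
    by (simp add: fun_eq_iff orbital_integrand_def F_def conj_weight_def Let_def)
  moreover have "(\<Sum>g\<in>r ` X. F g) = covol_M0 B * (\<Sum>j\<le>n. real CARD('q) ^ j *
      (real (e2 j) * real CARD('q) ^ (e1 j + e2 j) - (\<Sum>s<e2 j. real CARD('q) ^ (min s (e1 j) + s))))"
  proof -
    have "(\<Sum>g\<in>r ` X. F g) = (\<Sum>x\<in>X. covol_M0 B * real (depth (snd (snd x))))"
      by (simp add: sum.reindex[OF inj] Fr)
    also have "\<dots> = covol_M0 B * (\<Sum>x\<in>X. real (depth (snd (snd x))))" by (simp add: sum_distrib_left)
    also have "(\<Sum>x\<in>X. real (depth (snd (snd x)))) = (\<Sum>j\<le>n. \<Sum>p\<in>(residues j :: 'q fls set) \<times> W j. real (depth (snd p)))"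
      unfolding X_def using W_fin residues_card(1) by (subst sum.Sigma) (auto simp: case_prod_beta)
    also have "\<dots> = (\<Sum>j\<le>n. real CARD('q) ^ j * (\<Sum>w\<in>W j. real (depth w)))"
    proof (rule sum.cong[OF refl])
      fix j
      have "(\<Sum>p\<in>(residues j :: 'q fls set) \<times> W j. real (depth (snd p))) = (\<Sum>z\<in>(residues j :: 'q fls set). \<Sum>w\<in>W j. real (depth w))"
        unfolding sum.cartesian_product by (rule sum.cong) auto
      then show "(\<Sum>p\<in>(residues j :: 'q fls set) \<times> W j. real (depth (snd p))) = real CARD('q) ^ j * (\<Sum>w\<in>W j. real (depth w))"
        by (simp add: residues_card)
    qed
    also have "\<dots> = (\<Sum>j\<le>n. real CARD('q) ^ j *
      (real (e2 j) * real CARD('q) ^ (e1 j + e2 j) - (\<Sum>s<e2 j. real CARD('q) ^ (min s (e1 j) + s))))"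
      using sum_depth[OF W e, OF _ _ depth_le_iff] by simp
    finally show ?thesis .
  qed
  ultimately show ?thesis by (simp add: J_M0_def)
qed

section \<open>Evaluation of the sum\<close>

text \<open>The terms e = 2 s and e = 2 s + 1 combine to (s + 1) (q^(2 s) - q^(2 s + 2)), to which
  summation by parts applies.\<close>

lemma telescope_half:
  fixes q :: real
  shows "(\<Sum>e<2 * M. (real (e div 2) + 1) * (q ^ e - q ^ Suc e)) = (\<Sum>s<M. q ^ (2 * s)) - real M * q ^ (2 * M)"
  by (induction M) (simp_all add: algebra_simps)

text \<open>The increment of the subtracted sum in the recursion on N. Below e = 2 (N + 1) both
  minima equal \<open>e div 2\<close>, from there on both are saturated; hence the induction on D
  starts at 2 (N + 1).\<close>

lemma telescope_min:
  fixes q :: real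
  assumes "2 * Suc N \<le> D"
  shows "(\<Sum>e<D. (real (min (e div 2) (Suc N)) + 1) * q ^ e) - (\<Sum>e<D. (real (min (e div 2) N) + 1) * q ^ Suc e)
    = (\<Sum>s<D - Suc N. q ^ (min s (Suc N) + s)) - real (Suc N) * q ^ D"
  using assms
proof (induction D rule: dec_induct)
  case base
  have "(\<Sum>e<2 * Suc N. (real (min (e div 2) (Suc N)) + 1) * q ^ e) - (\<Sum>e<2 * Suc N. (real (min (e div 2) N) + 1) * q ^ Suc e)
    = (\<Sum>e<2 * Suc N. (real (e div 2) + 1) * (q ^ e - q ^ Suc e))"
    unfolding sum_subtractf[symmetric]
  proof (rule sum.cong[OF refl])
    fix e assume "e \<in> {..<2 * Suc N}"
    then have "min (e div 2) (Suc N) = e div 2" "min (e div 2) N = e div 2" by auto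
    then show "(real (min (e div 2) (Suc N)) + 1) * q ^ e - (real (min (e div 2) N) + 1) * q ^ Suc e
      = (real (e div 2) + 1) * (q ^ e - q ^ Suc e)" by (simp only: right_diff_distrib)
  qed
  moreover have "(\<Sum>s<2 * Suc N - Suc N. q ^ (min s (Suc N) + s)) = (\<Sum>s<Suc N. q ^ (2 * s))"
    by (intro sum.cong) (auto simp: mult_2)
  ultimately show ?case using telescope_half[of q "Suc N"] by simp
next
  case (step D)
  have "min (D div 2) (Suc N) = Suc N" "min (D div 2) N = N" using step(1) by auto
  moreover have "Suc D - Suc N = Suc (D - Suc N)" "min (D - Suc N) (Suc N) + (D - Suc N) = D" using step(1) by auto
  ultimately show ?case using step(3) by (simp add: algebra_simps)
qed

text \<open>Substituting \<open>i = n - j\<close> makes the summand independent of \<open>n\<close>, so that the sum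
  satisfies a one-step recursion in \<open>N\<close>; \<open>D - 2 i\<close> is a truncated subtraction.\<close>

lemma sum_evaluation:
  fixes q :: real and D h N :: nat
  assumes "D = 2 * h \<or> D = 2 * h + 1 \<and> N \<le> h"
  shows "(\<Sum>i\<le>N. q ^ (N - i) * (real (D - min i h) * q ^ D - (\<Sum>s<D - min i h. q ^ (min s (min i h) + s))))
    = (\<Sum>i\<le>N. real (D - 2 * i) * q ^ (D + N - i)) - (\<Sum>e<D. (real (min (e div 2) N) + 1) * q ^ e)"
  using assms
proof (induction N)
  case 0
  have "(\<Sum>s<D. q ^ (min s 0 + s)) = (\<Sum>e<D. (real (min (e div 2) 0) + 1) * q ^ e)" by simp
  then show ?case by simp
next
  case (Suc N)
  define Bt where "Bt i = real (D - min i h) * q ^ D - (\<Sum>s<D - min i h. q ^ (min s (min i h) + s))" for i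
  have "(\<Sum>i\<le>Suc N. q ^ (Suc N - i) * Bt i) = q * (\<Sum>i\<le>N. q ^ (N - i) * Bt i) + Bt (Suc N)"
    by (simp add: sum_distrib_left Suc_diff_le mult.assoc)
  also have "(\<Sum>i\<le>N. q ^ (N - i) * Bt i) =
      (\<Sum>i\<le>N. real (D - 2 * i) * q ^ (D + N - i)) - (\<Sum>e<D. (real (min (e div 2) N) + 1) * q ^ e)"
    unfolding Bt_def using Suc by auto
  finally have L: "(\<Sum>i\<le>Suc N. q ^ (Suc N - i) * Bt i) =
      q * (\<Sum>i\<le>N. real (D - 2 * i) * q ^ (D + N - i)) - (\<Sum>e<D. (real (min (e div 2) N) + 1) * q ^ Suc e) + Bt (Suc N)"
    by (simp add: right_diff_distrib sum_distrib_left mult_ac)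
  have R: "(\<Sum>i\<le>Suc N. real (D - 2 * i) * q ^ (D + Suc N - i))
      = q * (\<Sum>i\<le>N. real (D - 2 * i) * q ^ (D + N - i)) + real (D - 2 * Suc N) * q ^ D"
    by (simp add: sum_distrib_left Suc_diff_le mult_ac)
  \<comment> \<open>By \<open>L\<close> and \<open>R\<close> the claim for \<open>Suc N\<close>
    reduces to this value of the new summand.\<close>
  have "Bt (Suc N) = real (D - 2 * Suc N) * q ^ D - ((\<Sum>e<D. (real (min (e div 2) (Suc N)) + 1) * q ^ e)
      - (\<Sum>e<D. (real (min (e div 2) N) + 1) * q ^ Suc e))"
  proof (cases "Suc N \<le> h")
    case True
    then have "2 * Suc N \<le> D" using Suc.prems by auto
    moreover have "min (Suc N) h = Suc N" using True by simp
    moreover have "real (D - Suc N) = real (D - 2 * Suc N) + real (Suc N)" using \<open>2 * Suc N \<le> D\<close> by (simp add: of_nat_diff)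
    ultimately show ?thesis unfolding Bt_def by (simp only: telescope_min) (simp add: algebra_simps)
  next
    case False
    \<comment> \<open>The odd case requires \<open>Suc N\<close> \<le> h, so D is even here. The
      minimum in \<open>Bt\<close> has saturated at h, and the first sum gains only a zero
      term.\<close>
    then have D: "D = 2 * h" "min (Suc N) h = h" "D - 2 * Suc N = 0" using Suc.prems by auto
    have "min (e div 2) (Suc N) = e div 2" "min (e div 2) N = e div 2" if "e < D" for e
      using that False D(1) by auto
    then have "(\<Sum>e<D. (real (min (e div 2) (Suc N)) + 1) * q ^ e) - (\<Sum>e<D. (real (min (e div 2) N) + 1) * q ^ Suc e)
      = (\<Sum>e<D. (real (e div 2) + 1) * q ^ e) - (\<Sum>e<D. (real (e div 2) + 1) * q ^ Suc e)"
      by simp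
    also have "\<dots> = (\<Sum>e<D. (real (e div 2) + 1) * (q ^ e - q ^ Suc e))"
      by (simp only: sum_subtractf right_diff_distrib)
    also have "\<dots> = (\<Sum>s<h. q ^ (2 * s)) - real h * q ^ D" using telescope_half[of q h] D(1) by simp
    finally have C: "(\<Sum>e<D. (real (min (e div 2) (Suc N)) + 1) * q ^ e)
      - (\<Sum>e<D. (real (min (e div 2) N) + 1) * q ^ Suc e) = (\<Sum>s<h. q ^ (2 * s)) - real h * q ^ D" .
    have "(\<Sum>s<D - h. q ^ (min s h + s)) = (\<Sum>s<h. q ^ (2 * s))"
      using D(1) by (intro sum.cong) (auto simp: mult_2)
    then show ?thesis unfolding Bt_def C D(2,3) using D(1) by simp
  qed
  then show ?case using L R unfolding Bt_def by simp
qed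

text \<open>D stands for e_1 + e_2 and h for the upper bound of e_1. Since e < D \<le> 2 n + 1
  implies e div 2 \<le> n, the minimum disappears and leaves the floor function of the
  theorem.\<close>

lemma sum_evaluation_floor:
  fixes q :: real and D h n :: nat
  assumes "D = 2 * h \<or> D = 2 * h + 1 \<and> n \<le> h" "D \<le> 2 * n + 1"
  shows "(\<Sum>j\<le>n. q ^ j * (real (D - min (n - j) h) * q ^ D - (\<Sum>s<D - min (n - j) h. q ^ (min s (min (n - j) h) + s))))
    = real D * q ^ (D + n) + (\<Sum>i\<in>{0<..n}. real (D - 2 * i) * q ^ (D + n - i))
      - (\<Sum>e<D. (real_of_int \<lfloor>real e / 2\<rfloor> + 1) * q ^ e)"
proof -
  define g where "g i = real (D - min i h) * q ^ D - (\<Sum>s<D - min i h. q ^ (min s (min i h) + s))" for i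
  have "(\<Sum>j\<le>n. q ^ j * g (n - j)) = (\<Sum>i\<le>n. q ^ (n - i) * g i)"
    by (rule sum.reindex_bij_witness[of _ "\<lambda>i. n - i" "\<lambda>i. n - i"]) auto
  also have "\<dots> = (\<Sum>i\<le>n. real (D - 2 * i) * q ^ (D + n - i)) - (\<Sum>e<D. (real (min (e div 2) n) + 1) * q ^ e)"
    unfolding g_def using assms(1) by (rule sum_evaluation)
  also have "(\<Sum>e<D. (real (min (e div 2) n) + 1) * q ^ e) = (\<Sum>e<D. (real_of_int \<lfloor>real e / 2\<rfloor> + 1) * q ^ e)"
  proof (rule sum.cong[OF refl])
    fix e assume "e \<in> {..<D}"
    then have "min (e div 2) n = e div 2" using assms(2) by auto
    then show "(real (min (e div 2) n) + 1) * q ^ e = (real_of_int \<lfloor>real e / 2\<rfloor> + 1) * q ^ e"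
      using floor_divide_of_nat_eq[of e 2, where 'a = real] by simp
  qed
  also have "(\<Sum>i\<le>n. real (D - 2 * i) * q ^ (D + n - i))
      = real D * q ^ (D + n) + (\<Sum>i\<in>{0<..n}. real (D - 2 * i) * q ^ (D + n - i))"
    using sum.head[of 0 n "\<lambda>i. real (D - 2 * i) * q ^ (D + n - i)"] by (simp add: atMost_atLeast0)
  finally show ?thesis by (simp add: g_def)
qed

lemma evaluation_le:
  fixes q :: real
  assumes "m \<le> n"
  shows "(\<Sum>j\<le>n. q ^ j * (real (2 * m - min (n - j) m) * q ^ (2 * m)
      - (\<Sum>s<2 * m - min (n - j) m. q ^ (min s (min (n - j) m) + s))))
    = 2 * real m * q ^ (2 * m + n)
         + (\<Sum>j = m + n + 1..<2 * m + n. 2 * (real j - real m - real n) * q ^ j)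
         - (\<Sum>j<2 * m. (real_of_int \<lfloor>real j / 2\<rfloor> + 1) * q ^ j)"
proof -
  \<comment> \<open>The truncated difference is 0 for i >= m; the other terms are rewritten with j =
    2 m + n - i.\<close>
  have "(\<Sum>i\<in>{0<..n}. real (2 * m - 2 * i) * q ^ (2 * m + n - i)) = (\<Sum>i\<in>{0<..<m}. real (2 * m - 2 * i) * q ^ (2 * m + n - i))"
    using assms by (intro sum.mono_neutral_right) auto
  also have "\<dots> = (\<Sum>j = m + n + 1..<2 * m + n. 2 * (real j - real m - real n) * q ^ j)"
    by (rule sum.reindex_bij_witness[of _ "\<lambda>j. 2 * m + n - j" "\<lambda>i. 2 * m + n - i"]) (auto simp: of_nat_diff)
  finally show ?thesis using sum_evaluation_floor[of "2 * m" m n q] assms by simp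
qed

lemma evaluation_gt:
  fixes q :: real
  shows "(\<Sum>j\<le>n. q ^ j * (real (2 * n + 1 - (n - j)) * q ^ (2 * n + 1)
      - (\<Sum>s<2 * n + 1 - (n - j). q ^ (min s (n - j) + s))))
    = (2 * real n + 1) * q ^ (3 * n + 1)
         + (\<Sum>j = 2 * n + 1..3 * n. (2 * real j - 4 * real n - 1) * q ^ j)
         - (\<Sum>j = 0..2 * n. (real_of_int \<lfloor>real j / 2\<rfloor> + 1) * q ^ j)"
proof -
  \<comment> \<open>The substitution is j = 3 n + 1 - i; as i \<le> n, the difference 2 n + 1 - 2 i
    is not truncated.\<close>
  have "(\<Sum>i\<in>{0<..n}. real (2 * n + 1 - 2 * i) * q ^ (2 * n + 1 + n - i))
      = (\<Sum>j = 2 * n + 1..3 * n. (2 * real j - 4 * real n - 1) * q ^ j)"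
    by (rule sum.reindex_bij_witness[of _ "\<lambda>j. 3 * n + 1 - j" "\<lambda>i. 3 * n + 1 - i"]) (auto simp: of_nat_diff)
  moreover have "{..<2 * n + 1} = {0..2 * n}" "min (n - j) n = n - j" "2 * n + 1 + n = 3 * n + 1" for j by auto
  ultimately show ?thesis using sum_evaluation_floor[of "2 * n + 1" n n q] by (simp only:) simp
qed

theorem theorem1p2:
  fixes a b :: "'q::finite_field fps"
    and n :: nat
    and B :: "(('q fls^3^3 \<Rightarrow> 'q fls) \<Rightarrow> real) \<Rightarrow> (('q fls^3^3 \<Rightarrow> 'q fls) \<Rightarrow> real) \<Rightarrow> real"
    and \<mu> \<tau> :: "('q fls^3^3) measure"
    and \<nu> :: "('q fls^3^3) set measure"
  assumes char: "CHAR('q) > fact 3"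
    and b_nz: "b \<noteq> 0"
    and val_b: "val b = enat n"
    and inner: "weyl_inner_product B"
    and haar_G: "haar_measure GL3 \<mu>" "emeasure \<mu> GL3_O = 1"
    and haar_T: "haar_measure (centralizer (gamma_elt a b)) \<tau>" "emeasure \<tau> T_compact = 1"
    and quot: "quotient_measure (centralizer (gamma_elt a b)) \<mu> \<tau> \<nu>"
  shows "integrable \<nu> (orbital_integrand B (gamma_elt a b)) \<and>
    (\<forall>m. val a = enat m \<and> m \<le> n \<longrightarrow>
      J_M0 B \<nu> (gamma_elt a b) = covol_M0 B *
        (2 * real m * real CARD('q) ^ (2 * m + n)
         + (\<Sum>j = m + n + 1..<2 * m + n. 2 * (real j - real m - real n) * real CARD('q) ^ j)
         - (\<Sum>j<2 * m. (real_of_int \<lfloor>real j / 2\<rfloor> + 1) * real CARD('q) ^ j))) \<and>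
    (val a > enat n \<longrightarrow>
      J_M0 B \<nu> (gamma_elt a b) = covol_M0 B *
        ((2 * real n + 1) * real CARD('q) ^ (3 * n + 1)
         + (\<Sum>j = 2 * n + 1..3 * n. (2 * real j - 4 * real n - 1) * real CARD('q) ^ j)
         - (\<Sum>j = 0..2 * n. (real_of_int \<lfloor>real j / 2\<rfloor> + 1) * real CARD('q) ^ j)))"
proof -
  let ?A = "fps_to_fls a" and ?\<beta> = "fps_to_fls b"
  have sb: "fls_subdegree ?\<beta> = int n" and \<beta>: "?\<beta> \<noteq> 0"
    using val_b b_nz by (simp_all add: val_def fls_subdegree_fls_to_fps)
  note eq_sum = orbital_integral_eq_sum[OF b_nz sb inner haar_G haar_T quot]
  have le: "integrable \<nu> (orbital_integrand B (gamma_elt a b)) \<and>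
      J_M0 B \<nu> (gamma_elt a b) = covol_M0 B *
        (2 * real m * real CARD('q) ^ (2 * m + n)
         + (\<Sum>j = m + n + 1..<2 * m + n. 2 * (real j - real m - real n) * real CARD('q) ^ j)
         - (\<Sum>j<2 * m. (real_of_int \<lfloor>real j / 2\<rfloor> + 1) * real CARD('q) ^ j))"
    if m: "val a = enat m" "m \<le> n" for m
  proof -
    have A: "?A \<noteq> 0" "fls_subdegree ?A = int m"
      using m(1) by (simp_all add: val_def fls_subdegree_fls_to_fps split: if_splits)
    have e: "min (n - j) m + (2 * m - min (n - j) m) = 2 * m" "min (n - j) m \<le> 2 * m - min (n - j) m" for j
      by simp_all
    show ?thesis
      using eq_sum[of "\<lambda>j. min (n - j) m" "\<lambda>j. 2 * m - min (n - j) m",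
          OF integral_pairs_residue_system(1)[OF \<beta> sb _ A m(2)] e(2)]
      unfolding e(1) evaluation_le[OF m(2)] by blast
  qed
  have gt: "integrable \<nu> (orbital_integrand B (gamma_elt a b)) \<and>
      J_M0 B \<nu> (gamma_elt a b) = covol_M0 B *
        ((2 * real n + 1) * real CARD('q) ^ (3 * n + 1)
         + (\<Sum>j = 2 * n + 1..3 * n. (2 * real j - 4 * real n - 1) * real CARD('q) ^ j)
         - (\<Sum>j = 0..2 * n. (real_of_int \<lfloor>real j / 2\<rfloor> + 1) * real CARD('q) ^ j))"
    if "val a > enat n"
  proof -
    \<comment> \<open>The case a = 0 is included, since \<open>val 0\<close> is infinite and
      \<open>val_ge\<close> holds for 0.\<close>
    have A: "val_ge (int n + 1) ?A"
      using that by (auto simp: val_def val_ge_def fls_subdegree_fls_to_fps split: if_splits)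
    have e: "n - j + (2 * n + 1 - (n - j)) = 2 * n + 1" "n - j \<le> 2 * n + 1 - (n - j)" for j
      by simp_all
    show ?thesis
      using eq_sum[of "\<lambda>j. n - j" "\<lambda>j. 2 * n + 1 - (n - j)",
          OF integral_pairs_residue_system(2)[OF \<beta> sb _ A] e(2)]
      unfolding e(1) evaluation_gt by blast
  qed
  show ?thesis
  proof (cases "val a > enat n")
    case True
    then show ?thesis using gt by auto
  next
    case False
    then obtain m where "val a = enat m" "m \<le> n" by (cases "val a") auto
    then show ?thesis using le False by auto
  qed
qed

end
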